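(* Algorithm 1 (described below) enumerates all ideals of a finite poset $P$ on $n$ elements with constant amortized delay while requiring $O(n^2)$ space. For every $k\in\mathbb{N}$, the $k$-th ideal is visited within time $O(k+n(n+q))$, where $q$ is the number of incomparable pairs of $P$.
   Context: An ideal of a poset is a downward-closed subset; an incomparable pair is a 2-element antichain. Given a longest chain $C=\{c_1\prec\cdots\prec c_k\}$ of $P$, add virtual elements $c_0,c_{k+1}$ with $c_0\prec u\prec c_{k+1}$ for all $u$; for $i\in\{0,\dots,k\}$ let $P_i$ be the subposet of all $u$ with $u\not\preceq c_i$ and $u\not\succeq c_{i+1}$, and $D_i=\{u: u\preceq c_i\}$ ($D_0=\emptyset$). Algorithm 1: the input poset is given by its comparability matrix; in an initialization step the elements are relabeled so that $u\preceq v$ implies $u\le v$. The recursive procedure Enumerate$(P,I)$ ($I$ an array of elements outside $P$) does: if $P=\emptyset$, visit $I$; otherwise compute a longest chain $C$ of $P$ (via an antichain decomposition, in $O(n+q)$ time) and, for $i=0,\dots,k$, call Enumerate$(P_i, I\cup D_i)$, maintaining $P_i$ and $I$ incrementally. The main call is Enumerate$(P,\emptyset)$. Outputs are given by a pointer to the array $I$ modified between outputs; computation model is a RAM. Amortized delay is total running time divided by the number of outputs.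
   Formalization: The constant amortized delay is proved for the main call; the initialization (relabeling) is excluded and bounded separately by O(n^2), since an n-element chain has only n+1 ideals while relabeling it needs more than linear time. *)

theory Defs
  imports Complex_Main
begin

section \<open>Posets, ideals, incomparable pairs\<close>

definition ideals :: "'a set \<Rightarrow> 'a rel \<Rightarrow> 'a set set" where
  "ideals P r = {J. J \<subseteq> P \<and> (\<forall>u\<in>J. \<forall>v\<in>P. (v, u) \<in> r \<longrightarrow> v \<in> J)}"

definition incomparable_pairs :: "'a set \<Rightarrow> 'a rel \<Rightarrow> 'a set set" where
  "incomparable_pairs P r = {{u, v} |u v. u \<in> P \<and> v \<in> P \<and> (u, v) \<notin> r \<and> (v, u) \<notin> r}"


section \<open>The enumeration recursion on sets\<close>

definition chain_in :: "'a rel \<Rightarrow> 'a set \<Rightarrow> 'a list \<Rightarrow> bool" where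
  "chain_in r P cs \<longleftrightarrow> set cs \<subseteq> P \<and> sorted_wrt (\<lambda>u v. (u, v) \<in> r \<and> u \<noteq> v) cs"

definition longest_chain :: "'a rel \<Rightarrow> 'a set \<Rightarrow> 'a list \<Rightarrow> bool" where
  "longest_chain r P cs \<longleftrightarrow> chain_in r P cs \<and> (\<forall>ds. chain_in r P ds \<longrightarrow> length ds \<le> length cs)"

text \<open>
  The chain element $c_i$ with $1 \le i \le k$ is \<open>cs ! (i - 1)\<close>. The virtual elements
  $c_0$ and $c_{k+1}$ lie below, respectively above, every element of the poset.
\<close>

definition below_chain :: "'a rel \<Rightarrow> 'a list \<Rightarrow> nat \<Rightarrow> 'a \<Rightarrow> bool" where
  "below_chain r cs i u \<longleftrightarrow> (if i = 0 then False else if i \<le> length cs then (u, cs ! (i - 1)) \<in> r else True)"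

definition above_chain :: "'a rel \<Rightarrow> 'a list \<Rightarrow> nat \<Rightarrow> 'a \<Rightarrow> bool" where
  "above_chain r cs i u \<longleftrightarrow> (if i = 0 then True else if i \<le> length cs then (cs ! (i - 1), u) \<in> r else False)"

definition sub_poset :: "'a rel \<Rightarrow> 'a set \<Rightarrow> 'a list \<Rightarrow> nat \<Rightarrow> 'a set" where
  "sub_poset r P cs i = {u \<in> P. \<not> below_chain r cs i u \<and> \<not> above_chain r cs (i + 1) u}"

definition down_part :: "'a rel \<Rightarrow> 'a set \<Rightarrow> 'a list \<Rightarrow> nat \<Rightarrow> 'a set" where
  "down_part r P cs i = {u \<in> P. below_chain r cs i u}"

text \<open>
  \<open>enumerates r P I Js\<close>: the call Enumerate$(P, I)$ can visit exactly the sets \<open>Js\<close>, in this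
  order. It is a relation because the longest chain is not unique.
\<close>

inductive enumerates :: "'a rel \<Rightarrow> 'a set \<Rightarrow> 'a set \<Rightarrow> 'a set list \<Rightarrow> bool" for r where
  visit: "enumerates r {} I [I]"
| branch: "\<lbrakk> P \<noteq> {}; longest_chain r P cs; length Jss = length cs + 1;
     \<And>i. i \<le> length cs \<Longrightarrow> enumerates r (sub_poset r P cs i) (I \<union> down_part r P cs i) (Jss ! i) \<rbrakk>
   \<Longrightarrow> enumerates r P I (concat Jss)"


section \<open>A random access machine with structured control\<close>

text \<open>
  A machine has finitely many registers \<open>'r\<close> and finitely many arrays \<open>'a\<close> of words with random
  access; finitely many arrays can be interleaved in one linear memory at the price of a constant
  factor in the addresses. Expressions only involve registers, memory is accessed by explicit
  loads and stores, and accesses out of bounds have no semantics. The uniform cost measure is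
  used: every instruction and every node of an expression takes one time unit.
\<close>

datatype 'r aexp = N nat | V 'r
  | Plus "'r aexp" "'r aexp"  (infixl \<open>\<oplus>\<close> 65)
  | Minus "'r aexp" "'r aexp"  (infixl \<open>\<ominus>\<close> 65)
  | Times "'r aexp" "'r aexp"  (infixl \<open>\<otimes>\<close> 70)

datatype 'r bexp =
    Less "'r aexp" "'r aexp"  (infix \<open>\<lhd>\<close> 50)
  | Equal "'r aexp" "'r aexp"  (infix \<open>\<doteq>\<close> 50)
  | Neg "'r bexp"
  | Conj "'r bexp" "'r bexp"  (infixr \<open>AND\<close> 35)
  | Disj "'r bexp" "'r bexp"  (infixr \<open>OR\<close> 30)

datatype ('r, 'a) com =
    Skip
  | Assign 'r "'r aexp"  (\<open>_ ::= _\<close> [1000, 61] 61)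
  | Load 'r 'a "'r aexp"  (\<open>_ ::= _\<lbrakk>_\<rbrakk>\<close> [1000, 1000, 0] 61)
  | Store 'a "'r aexp" "'r aexp"  (\<open>_\<lbrakk>_\<rbrakk> ::= _\<close> [1000, 0, 61] 61)
  | Alloc 'a "'r aexp"
  | Visit 'a "'r aexp"
  | Seq "('r, 'a) com" "('r, 'a) com"  (infixr \<open>;;\<close> 60)
  | Cond "'r bexp" "('r, 'a) com" "('r, 'a) com"  (\<open>(IF _/ THEN _/ ELSE _)\<close> [0, 0, 61] 61)
  | While "'r bexp" "('r, 'a) com"  (\<open>(WHILE _/ DO _)\<close> [0, 61] 61)
  | Call "('r \<times> 'r aexp) list"

primrec aval :: "'r aexp \<Rightarrow> ('r \<Rightarrow> nat) \<Rightarrow> nat" where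
  "aval (N n) \<sigma> = n"
| "aval (V x) \<sigma> = \<sigma> x"
| "aval (a \<oplus> b) \<sigma> = aval a \<sigma> + aval b \<sigma>"
| "aval (a \<ominus> b) \<sigma> = aval a \<sigma> - aval b \<sigma>"
| "aval (a \<otimes> b) \<sigma> = aval a \<sigma> * aval b \<sigma>"

primrec bval :: "'r bexp \<Rightarrow> ('r \<Rightarrow> nat) \<Rightarrow> bool" where
  "bval (a \<lhd> b) \<sigma> \<longleftrightarrow> aval a \<sigma> < aval b \<sigma>"
| "bval (a \<doteq> b) \<sigma> \<longleftrightarrow> aval a \<sigma> = aval b \<sigma>"
| "bval (Neg p) \<sigma> \<longleftrightarrow> \<not> bval p \<sigma>"
| "bval (p AND q) \<sigma> \<longleftrightarrow> bval p \<sigma> \<and> bval q \<sigma>"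
| "bval (p OR q) \<sigma> \<longleftrightarrow> bval p \<sigma> \<or> bval q \<sigma>"

primrec acost :: "'r aexp \<Rightarrow> nat" where
  "acost (N n) = 1"
| "acost (V x) = 1"
| "acost (a \<oplus> b) = 1 + acost a + acost b"
| "acost (a \<ominus> b) = 1 + acost a + acost b"
| "acost (a \<otimes> b) = 1 + acost a + acost b"

primrec bcost :: "'r bexp \<Rightarrow> nat" where
  "bcost (a \<lhd> b) = 1 + acost a + acost b"
| "bcost (a \<doteq> b) = 1 + acost a + acost b"
| "bcost (Neg p) = 1 + bcost p"
| "bcost (p AND q) = 1 + bcost p + bcost q"
| "bcost (p OR q) = 1 + bcost p + bcost q"

text \<open>
  \<open>visited\<close> lists the outputs so far, each with the time at which it was produced. \<open>depth\<close> is the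
  number of active procedure calls, \<open>peak\<close> the largest amount of space occupied so far.
\<close>

record ('r, 'a) machine =
  regs :: "'r \<Rightarrow> nat"
  mem :: "'a \<Rightarrow> nat list"
  clock :: nat
  visited :: "(nat \<times> nat set) list"
  depth :: nat
  peak :: nat

text \<open>
  Each active call occupies one word per register of its caller, and one for the return address.
\<close>

definition space :: "('r::finite, 'a::finite) machine \<Rightarrow> nat" where
  "space s = (\<Sum>a\<in>UNIV. length (mem s a)) + (depth s + 1) * (card (UNIV :: 'r set) + 1)"

definition tick :: "nat \<Rightarrow> ('r, 'a) machine \<Rightarrow> ('r, 'a) machine" where
  "tick t s = s\<lparr>clock := clock s + t\<rparr>"

definition record_space :: "('r::finite, 'a::finite) machine \<Rightarrow> ('r, 'a) machine" where
  "record_space s = s\<lparr>peak := max (peak s) (space s)\<rparr>"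

definition set_reg :: "'r \<Rightarrow> nat \<Rightarrow> ('r, 'a) machine \<Rightarrow> ('r, 'a) machine" where
  "set_reg x v s = s\<lparr>regs := (regs s)(x := v)\<rparr>"

definition set_array :: "'a \<Rightarrow> nat list \<Rightarrow> ('r, 'a) machine \<Rightarrow> ('r, 'a) machine" where
  "set_array a xs s = s\<lparr>mem := (mem s)(a := xs)\<rparr>"

definition output_set :: "nat set \<Rightarrow> ('r, 'a) machine \<Rightarrow> ('r, 'a) machine" where
  "output_set J s = s\<lparr>visited := visited s @ [(clock s, J)]\<rparr>"

definition enter_call :: "('r \<times> 'r aexp) list \<Rightarrow> ('r::finite, 'a::finite) machine \<Rightarrow> ('r, 'a) machine" where
  "enter_call args s = record_space (s\<lparr>
     regs := (\<lambda>x. case map_of args x of None \<Rightarrow> regs s x | Some e \<Rightarrow> aval e (regs s)),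
     depth := depth s + 1\<rparr>)"

definition leave_call :: "('r, 'a) machine \<Rightarrow> ('r, 'a) machine \<Rightarrow> ('r, 'a) machine" where
  "leave_call s t = t\<lparr>regs := regs s, depth := depth s\<rparr>"

text \<open>
  \<open>exec B c s t\<close>: started in \<open>s\<close>, the command \<open>c\<close> terminates in \<open>t\<close>, where \<open>B\<close> is the body of the
  (only) recursive procedure. \<open>Visit a e\<close> outputs the first \<open>e\<close> entries of \<open>a\<close> in constant time, by
  means of a pointer to \<open>a\<close>. \<open>Alloc a e\<close> clears the array, in time proportional to its new length.
  \<open>Call args\<close> pays for saving and restoring all registers; the callee starts with a copy of the
  registers of the caller, updated by the arguments.
\<close>

inductive exec ::
  "('r::finite, 'a::finite) com \<Rightarrow> ('r, 'a) com \<Rightarrow> ('r, 'a) machine \<Rightarrow> ('r, 'a) machine \<Rightarrow> bool"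
  for B where
  Skip: "exec B Skip s (tick 1 s)"
| Assign: "exec B (x ::= e) s (tick (1 + acost e) (set_reg x (aval e (regs s)) s))"
| Load: "aval e (regs s) < length (mem s a) \<Longrightarrow>
    exec B (x ::= a\<lbrakk>e\<rbrakk>) s (tick (1 + acost e) (set_reg x (mem s a ! aval e (regs s)) s))"
| Store: "aval e (regs s) < length (mem s a) \<Longrightarrow>
    exec B (a\<lbrakk>e\<rbrakk> ::= f) s (tick (1 + acost e + acost f)
      (set_array a ((mem s a)[aval e (regs s) := aval f (regs s)]) s))"
| Alloc: "exec B (Alloc a e) s (record_space (tick (1 + acost e + aval e (regs s))
    (set_array a (replicate (aval e (regs s)) 0) s)))"
| Visit: "aval e (regs s) \<le> length (mem s a) \<Longrightarrow>
    exec B (Visit a e) s (output_set (set (take (aval e (regs s)) (mem s a))) (tick (1 + acost e) s))"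
| Seq: "exec B c1 s t \<Longrightarrow> exec B c2 t u \<Longrightarrow> exec B (c1 ;; c2) s u"
| IfTrue: "bval b (regs s) \<Longrightarrow> exec B c1 (tick (1 + bcost b) s) t \<Longrightarrow>
    exec B (IF b THEN c1 ELSE c2) s t"
| IfFalse: "\<not> bval b (regs s) \<Longrightarrow> exec B c2 (tick (1 + bcost b) s) t \<Longrightarrow>
    exec B (IF b THEN c1 ELSE c2) s t"
| WhileFalse: "\<not> bval b (regs s) \<Longrightarrow> exec B (WHILE b DO c) s (tick (1 + bcost b) s)"
| WhileTrue: "bval b (regs s) \<Longrightarrow> exec B c (tick (1 + bcost b) s) t \<Longrightarrow>
    exec B (WHILE b DO c) t u \<Longrightarrow> exec B (WHILE b DO c) s u"
| Call: "exec B B (enter_call args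
      (tick (1 + 2 * card (UNIV :: 'r set) + sum_list (map (\<lambda>(x, e). acost e) args)) s)) t \<Longrightarrow>
    exec B (Call args) s (leave_call s t)"

inductive_cases exec_SkipE: "exec B Skip s t"
inductive_cases exec_AssignE: "exec B (x ::= e) s t"
inductive_cases exec_LoadE: "exec B (x ::= a\<lbrakk>e\<rbrakk>) s t"
inductive_cases exec_StoreE: "exec B (a\<lbrakk>e\<rbrakk> ::= f) s t"
inductive_cases exec_AllocE: "exec B (Alloc a e) s t"
inductive_cases exec_VisitE: "exec B (Visit a e) s t"
inductive_cases exec_SeqE: "exec B (c1 ;; c2) s t"
inductive_cases exec_IfE: "exec B (IF b THEN c1 ELSE c2) s t"
inductive_cases exec_WhileE: "exec B (WHILE b DO c) s t"
inductive_cases exec_CallE: "exec B (Call args) s t"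

lemma exec_deterministic: "exec B c s t \<Longrightarrow> exec B c s t' \<Longrightarrow> t' = t"
proof (induction arbitrary: t' rule: exec.induct)
  case Skip then show ?case by (elim exec_SkipE) simp
next
  case Assign then show ?case by (elim exec_AssignE) simp
next
  case Load then show ?case by (elim exec_LoadE) simp
next
  case Store then show ?case by (elim exec_StoreE) simp
next
  case Alloc then show ?case by (elim exec_AllocE) simp
next
  case Visit then show ?case by (elim exec_VisitE) simp
next
  case (Seq c1 s t c2 u)
  from Seq.prems show ?case by (rule exec_SeqE) (use Seq.IH in blast)
next
  case (IfTrue b s c1 t c2)
  have "exec B c1 (tick (1 + bcost b) s) t'"
    using IfTrue.prems IfTrue.hyps(1) by (auto elim: exec_IfE)
  then show ?case by (rule IfTrue.IH)
next
  case (IfFalse b s c2 t c1)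
  have "exec B c2 (tick (1 + bcost b) s) t'"
    using IfFalse.prems IfFalse.hyps(1) by (auto elim: exec_IfE)
  then show ?case by (rule IfFalse.IH)
next
  case (WhileFalse b s c)
  from WhileFalse.prems show ?case by (rule exec_WhileE) (use WhileFalse.hyps in simp_all)
next
  case (WhileTrue b s c t u)
  have *: "t'' = t" if "exec B c (tick (Suc (bcost b)) s) t''" for t''
    using WhileTrue.IH(1) that by simp
  from WhileTrue.prems show ?case
  proof (rule exec_WhileE)
    assume "\<not> bval b (regs s)"
    with WhileTrue.hyps show ?thesis by simp
  next
    fix t'' assume "exec B c (tick (Suc (bcost b)) s) t''" and "exec B (WHILE b DO c) t'' t'"
    with * WhileTrue.IH(2) show ?thesis by blast
  qed
next
  case (Call args s t)
  from Call.prems show ?case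
  proof (rule exec_CallE)
    fix t'' assume t': "t' = leave_call s t''" and "exec B B (enter_call args
      (tick (Suc (2 * card (UNIV :: 'a set) + (\<Sum>(x, e)\<leftarrow>args. acost e))) s)) t''"
    with Call.IH have "t'' = t" by simp
    with t' show ?thesis by simp
  qed
qed


section \<open>The enumeration algorithm as a machine program\<close>

datatype register = rn | rw | rfp | rm | rlen | rh | rk | ri | rj | rt | rs | rr | ru | rv | rx

datatype array = Matrix | Count | Label | Leq | Elems | Chain | Upper | Bucket | BucketNext
  | Level | LevelNext | Pred | Temp | Ideal

instance register :: finite
proof
  have "(UNIV :: register set) \<subseteq> {rn, rw, rfp, rm, rlen, rh, rk, ri, rj, rt, rs, rr, ru, rv, rx}"
    by (auto intro: register.exhaust)
  then show "finite (UNIV :: register set)" by (rule finite_subset) simp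
qed

instance array :: finite
proof
  have "(UNIV :: array set) \<subseteq> {Matrix, Count, Label, Leq, Elems, Chain, Upper, Bucket, BucketNext,
      Level, LevelNext, Pred, Temp, Ideal}"
    by (auto intro: array.exhaust)
  then show "finite (UNIV :: array set)" by (rule finite_subset) simp
qed

definition for_upto ::
    "register \<Rightarrow> register aexp \<Rightarrow> (register, array) com \<Rightarrow> (register, array) com"
    (\<open>(FOR _ < _/ DO _)\<close> [1000, 0, 61] 61) where
  "(FOR x < e DO c) = (x ::= N 0 ;; WHILE V x \<lhd> e DO (c ;; x ::= V x \<oplus> N 1))"

text \<open>
  The elements are sorted by the sizes of their principal ideals (ties are broken
  by their names), which yields a linear extension: \<open>Label\<close> maps new to old names, and \<open>Leq\<close> is the
  comparability matrix for the new names. The arrays allocated with \<open>n + 1\<close> frames of width \<open>w = n + 2\<close>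
  hold the data of one recursive call per frame, and the elements of the poset that is the argument of
  a call are stored in increasing order in \<open>Elems[fp], \<dots>, Elems[fp + m - 1]\<close>.
\<close>

definition init_arrays :: "(register, array) com" where
  "init_arrays =
     rw ::= V rn \<oplus> N 2 ;;
     Alloc Count (V rn) ;;
     Alloc Label (V rn) ;;
     Alloc Leq (V rn \<otimes> V rn) ;;
     Alloc Elems ((V rn \<oplus> N 1) \<otimes> V rw) ;;
     Alloc Chain ((V rn \<oplus> N 1) \<otimes> V rw) ;;
     Alloc Upper ((V rn \<oplus> N 1) \<otimes> V rw) ;;
     Alloc Bucket ((V rn \<oplus> N 1) \<otimes> V rw) ;;
     Alloc BucketNext ((V rn \<oplus> N 1) \<otimes> V rw) ;;
     Alloc Level (V rn \<oplus> N 1) ;;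
     Alloc LevelNext (V rn) ;;
     Alloc Pred (V rn) ;;
     Alloc Temp (V rn) ;;
     Alloc Ideal (V rn)"

definition init_relabel :: "(register, array) com" where
  "init_relabel =
     FOR rv < V rn DO (
       rk ::= N 0 ;;
       FOR ru < V rn DO (
         rx ::= Matrix\<lbrakk>V ru \<otimes> V rn \<oplus> V rv\<rbrakk> ;;
         rk ::= V rk \<oplus> V rx) ;;
       Count\<lbrakk>V rv\<rbrakk> ::= V rk) ;;
     FOR rv < V rn DO (
       rk ::= N 0 ;;
       rj ::= Count\<lbrakk>V rv\<rbrakk> ;;
       FOR ru < V rn DO (
         rx ::= Count\<lbrakk>V ru\<rbrakk> ;;
         IF V rx \<lhd> V rj OR (V rx \<doteq> V rj AND V ru \<lhd> V rv) THEN rk ::= V rk \<oplus> N 1 ELSE Skip) ;;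
       Label\<lbrakk>V rk\<rbrakk> ::= V rv) ;;
     FOR ru < V rn DO (
       rj ::= Label\<lbrakk>V ru\<rbrakk> ;;
       FOR rv < V rn DO (
         rk ::= Label\<lbrakk>V rv\<rbrakk> ;;
         rx ::= Matrix\<lbrakk>V rj \<otimes> V rn \<oplus> V rk\<rbrakk> ;;
         Leq\<lbrakk>V ru \<otimes> V rn \<oplus> V rv\<rbrakk> ::= V rx)) ;;
     FOR ru < V rn DO Elems\<lbrakk>V ru\<rbrakk> ::= V ru"

definition initialize :: "(register, array) com" where
  "initialize = init_arrays ;; init_relabel"

text \<open>
  Level \<open>j\<close> is an antichain, stored as a linked list that starts
  at \<open>Level[j]\<close> and ends with the value \<open>n\<close>; there are \<open>h\<close> levels. The next element \<open>u\<close> is compared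
  with the elements of levels \<open>h, h - 1, \<dots>\<close> until one below \<open>u\<close> is found, say on level \<open>j\<close>, which becomes
  the predecessor of \<open>u\<close>; if there is none, then \<open>j = 0\<close>. Then \<open>u\<close> is put on level \<open>j + 1\<close>.
\<close>

definition antichain_decomposition :: "(register, array) com" where
  "antichain_decomposition =
     rh ::= N 0 ;;
     FOR rt < V rm DO (
       ru ::= Elems\<lbrakk>V rfp \<oplus> V rt\<rbrakk> ;;
       rj ::= V rh ;;
       rv ::= Level\<lbrakk>V rj\<rbrakk> ;;
       rx ::= N 0 ;;
       WHILE V rx \<doteq> N 0 AND N 0 \<lhd> V rj DO (
         IF V rv \<doteq> V rn
         THEN (rj ::= V rj \<ominus> N 1 ;; rv ::= Level\<lbrakk>V rj\<rbrakk>)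
         ELSE (
           rx ::= Leq\<lbrakk>V rv \<otimes> V rn \<oplus> V ru\<rbrakk> ;;
           IF V rx \<doteq> N 0 THEN rv ::= LevelNext\<lbrakk>V rv\<rbrakk> ELSE Skip)) ;;
       Pred\<lbrakk>V ru\<rbrakk> ::= V rv ;;
       IF V rj \<doteq> V rh
       THEN (rh ::= V rh \<oplus> N 1 ;; Level\<lbrakk>V rh\<rbrakk> ::= V rn)
       ELSE Skip ;;
       rx ::= Level\<lbrakk>V rj \<oplus> N 1\<rbrakk> ;;
       LevelNext\<lbrakk>V ru\<rbrakk> ::= V rx ;;
       Level\<lbrakk>V rj \<oplus> N 1\<rbrakk> ::= V ru)"

text \<open>The longest chain $c_1, \ldots, c_k$ is stored in \<open>Chain[fp + 1], \<dots>, Chain[fp + k]\<close>.\<close>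

definition extract_chain :: "(register, array) com" where
  "extract_chain =
     rk ::= V rh ;;
     rj ::= V rh ;;
     rv ::= Level\<lbrakk>V rj\<rbrakk> ;;
     WHILE N 0 \<lhd> V rj DO (
       Chain\<lbrakk>V rfp \<oplus> V rj\<rbrakk> ::= V rv ;;
       rv ::= Pred\<lbrakk>V rv\<rbrakk> ;;
       rj ::= V rj \<ominus> N 1)"

text \<open>
  An element \<open>u\<close> outside of the chain belongs to $P_i$ iff \<open>a \<le> i < b\<close>, where \<open>a\<close> is maximal such that
  $c_a$ is below \<open>u\<close>, and \<open>b\<close> is minimal such that $c_b$ is above \<open>u\<close> (including virtual elements). The
  value \<open>b\<close> is stored in \<open>Upper[fp + u]\<close>, and \<open>u\<close> is put into bucket \<open>a\<close>. As the elements are inserted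
  in decreasing order, the linked lists \<open>Bucket[fp + a]\<close> are increasing. Throughout, \<open>s\<close> is the number of
  chain elements that precede position \<open>t\<close>, so only chain elements incomparable to \<open>u\<close> are skipped.
\<close>

definition classify_elements :: "(register, array) com" where
  "classify_elements =
     FOR rt < V rk \<oplus> N 1 DO Bucket\<lbrakk>V rfp \<oplus> V rt\<rbrakk> ::= V rn ;;
     rs ::= V rk ;;
     rt ::= V rm ;;
     WHILE N 0 \<lhd> V rt DO (
       rt ::= V rt \<ominus> N 1 ;;
       ru ::= Elems\<lbrakk>V rfp \<oplus> V rt\<rbrakk> ;;
       rv ::= V rn ;;
       IF N 0 \<lhd> V rs THEN rv ::= Chain\<lbrakk>V rfp \<oplus> V rs\<rbrakk> ELSE Skip ;;
       IF V ru \<doteq> V rv THEN rs ::= V rs \<ominus> N 1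
       ELSE (
         rj ::= V rs \<oplus> N 1 ;;
         rx ::= N 0 ;;
         WHILE V rx \<doteq> N 0 AND V rj \<lhd> V rk \<oplus> N 1 DO (
           rv ::= Chain\<lbrakk>V rfp \<oplus> V rj\<rbrakk> ;;
           rx ::= Leq\<lbrakk>V ru \<otimes> V rn \<oplus> V rv\<rbrakk> ;;
           IF V rx \<doteq> N 0 THEN rj ::= V rj \<oplus> N 1 ELSE Skip) ;;
         Upper\<lbrakk>V rfp \<oplus> V ru\<rbrakk> ::= V rj ;;
         rj ::= V rs ;;
         rx ::= N 0 ;;
         WHILE V rx \<doteq> N 0 AND N 0 \<lhd> V rj DO (
           rv ::= Chain\<lbrakk>V rfp \<oplus> V rj\<rbrakk> ;;
           rx ::= Leq\<lbrakk>V rv \<otimes> V rn \<oplus> V ru\<rbrakk> ;;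
           IF V rx \<doteq> N 0 THEN rj ::= V rj \<ominus> N 1 ELSE Skip) ;;
         rx ::= Bucket\<lbrakk>V rfp \<oplus> V rj\<rbrakk> ;;
         BucketNext\<lbrakk>V rfp \<oplus> V ru\<rbrakk> ::= V rx ;;
         Bucket\<lbrakk>V rfp \<oplus> V rj\<rbrakk> ::= V ru))"

text \<open>
  At the start of round \<open>i\<close>, the next frame of \<open>Elems\<close> contains the \<open>r\<close>
  elements of $P_{i-1}$, and the first \<open>len\<close> entries of \<open>Ideal\<close> are those of $I \cup D_{i-1}$. The elements
  of $P_{i-1}$ that are below $c_i$ and $c_i$ itself are appended to \<open>Ideal\<close> (under their original
  names), the other \<open>s\<close> elements of $P_{i-1}$ are merged with bucket \<open>i\<close> to form $P_i$.
\<close>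

definition update_ideal :: "(register, array) com" where
  "update_ideal =
     rs ::= N 0 ;;
     FOR rt < V rr DO (
       ru ::= Elems\<lbrakk>V rfp \<oplus> V rw \<oplus> V rt\<rbrakk> ;;
       rx ::= Upper\<lbrakk>V rfp \<oplus> V ru\<rbrakk> ;;
       IF V rx \<doteq> V ri
       THEN (rx ::= Label\<lbrakk>V ru\<rbrakk> ;; Ideal\<lbrakk>V rlen\<rbrakk> ::= V rx ;; rlen ::= V rlen \<oplus> N 1)
       ELSE (Temp\<lbrakk>V rs\<rbrakk> ::= V ru ;; rs ::= V rs \<oplus> N 1)) ;;
     IF N 0 \<lhd> V ri
     THEN (
       ru ::= Chain\<lbrakk>V rfp \<oplus> V ri\<rbrakk> ;;
       rx ::= Label\<lbrakk>V ru\<rbrakk> ;;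
       Ideal\<lbrakk>V rlen\<rbrakk> ::= V rx ;;
       rlen ::= V rlen \<oplus> N 1)
     ELSE Skip"

definition update_poset :: "(register, array) com" where
  "update_poset =
     rt ::= N 0 ;;
     rr ::= N 0 ;;
     rv ::= Bucket\<lbrakk>V rfp \<oplus> V ri\<rbrakk> ;;
     WHILE V rt \<lhd> V rs OR V rv \<lhd> V rn DO (
       IF V rt \<lhd> V rs THEN ru ::= Temp\<lbrakk>V rt\<rbrakk> ELSE ru ::= V rn ;;
       IF V rv \<lhd> V ru
       THEN (Elems\<lbrakk>V rfp \<oplus> V rw \<oplus> V rr\<rbrakk> ::= V rv ;; rv ::= BucketNext\<lbrakk>V rfp \<oplus> V rv\<rbrakk>)
       ELSE (Elems\<lbrakk>V rfp \<oplus> V rw \<oplus> V rr\<rbrakk> ::= V ru ;; rt ::= V rt \<oplus> N 1) ;;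
       rr ::= V rr \<oplus> N 1)"

text \<open>
  The body of the recursive procedure Enumerate$(P, I)$ with parameters \<open>fp\<close>, \<open>m\<close>, \<open>len\<close>: the poset $P$
  has size \<open>m\<close> and is stored at position \<open>fp\<close> of \<open>Elems\<close>, and $I$ is given by the first \<open>len\<close>
  entries of \<open>Ideal\<close>.
\<close>

definition enumerate_call :: "register aexp \<Rightarrow> register aexp \<Rightarrow> register aexp \<Rightarrow> (register, array) com" where
  "enumerate_call fp m len = Call [(rfp, fp), (rm, m), (rlen, len)]"

definition enumerate_body :: "(register, array) com" where
  "enumerate_body =
     IF V rm \<doteq> N 0 THEN Visit Ideal (V rlen)
     ELSE (
       antichain_decomposition ;;
       extract_chain ;;
       classify_elements ;;
       rr ::= N 0 ;;
       FOR ri < V rk \<oplus> N 1 DO (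
         update_ideal ;;
         update_poset ;;
         enumerate_call (V rfp \<oplus> V rw) (V rr) (V rlen)))"

definition main_call :: "(register, array) com" where
  "main_call = enumerate_call (N 0) (V rn) (N 0)"

text \<open>
  The input is a poset on \<open>{..<n}\<close>, given by its size and its comparability matrix (in row-major order).
\<close>

definition comparability_matrix :: "nat \<Rightarrow> nat rel \<Rightarrow> nat list" where
  "comparability_matrix n r = concat (map (\<lambda>u. map (\<lambda>v. if (u, v) \<in> r then 1 else 0) [0..<n]) [0..<n])"

definition start :: "nat \<Rightarrow> nat rel \<Rightarrow> (register, array) machine" where
  "start n r = record_space
     \<lparr>regs = (\<lambda>_. 0)(rn := n), mem = (\<lambda>_. [])(Matrix := comparability_matrix n r),
      clock = 0, visited = [], depth = 0, peak = 0\<rparr>"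

end

theory Submission
  imports Defs
begin

text \<open>
  The amortization rests on a potential. For a chain $c_1 \prec \cdots \prec c_k$, an element outside of the
  chain belongs to the $P_i$ with $a \le i < b$, where $c_a$ is the last chain element below and $c_b$ the first
  one above it. If an antichain $X$ without chain elements is contained in $s(X) \ge 1$ of the
  posets $P_i$, then it extends by at most $s(X) - 1$ chain elements to a larger antichain. Hence
  $\sum_i \Phi(P_i) - \Phi(P) \ge \sum_X (s(X) - 1)$ for $\Phi(P) = \sum_X (4 - |X|)$, where all sums are over antichains
  with at most three elements. As the chain is longest, $b \ge a + 2$, and the gain pays for all elements and
  all incomparable pairs with $s \ge 2$. The remaining pairs have $b(u) = a(v) + 1$; their number is bounded
  by the squares of the sizes of the sets of elements with a common value of $a$ or $b$. Partitioning such a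
  set into levels, those at distance $j$ from the end of the interval contribute at least $j$ times
  the number of their subsets of size one, two and three to the gain, and
  $(\sum_j \ell_j)^2 \le 9 \sum_j j \ell_j^3$. So a call takes time $O(\sum_i \Phi(P_i) - \Phi(P))$ outside of the recursive
  calls, which telescopes to the number of outputs. At any time, at most $n + 1$ calls are active, and only
  their local work of $O(n + q)$ each is not yet paid for by completed calls.
\<close>

section \<open>Positions relative to a chain\<close>

text \<open>The weight 4 - |X| comes from double counting. An antichain X off the chain that lies in
  s of the P_i weighs s (4 - |X|) after the split; before it, X and up to s - 1 extensions by a
  chain element weigh (4 - |X|) + (s - 1)(3 - |X|). The difference is s - 1 for every |X| \<le> 3,
  because the weight drops by one per element. Triples cannot be dropped on this route: singletons
  and pairs alone would require (\<Sum> l_j)^2 to be bounded by a constant times \<Sum> j l_j^2, but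
  l_j close to m / j for j \<le> m violates this by a factor of order log m. The obstacle is the
  pairs that lie in a single P_i: they have s - 1 = 0 and must be paid for by other antichains. The
  cost constants are generous. The local work of a nonempty call is at most 1000 (1 + |P| + q(P)),
  with q(P) the number of incomparable pairs of P; 113 times the gain covers 1 + |P| + q(P), so a
  unit of potential is worth 113000. An output is charged 500000, more than the 452000 that the
  potential 4 of the empty poset is worth.\<close>

locale finite_poset =
  fixes r :: "'a rel" and P :: "'a set"
  assumes finite_P: "finite P"
    and refl_P: "u \<in> P \<Longrightarrow> (u, u) \<in> r"
    and trans_r: "trans r"
    and antisym_P: "u \<in> P \<Longrightarrow> v \<in> P \<Longrightarrow> (u, v) \<in> r \<Longrightarrow> (v, u) \<in> r \<Longrightarrow> u = v"
begin

lemma finite_poset_subset: "Q \<subseteq> P \<Longrightarrow> finite_poset r Q"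
  using finite_P refl_P trans_r antisym_P by unfold_locales (blast intro: finite_subset)+

end

text \<open>The index a of the overview. A prefix length equals the 1-based index of the last
  element of the prefix, so 0 stands for the virtual c_0.\<close>

definition lower_index :: "'a rel \<Rightarrow> 'a list \<Rightarrow> 'a \<Rightarrow> nat" where
  "lower_index r cs u = length (takeWhile (\<lambda>c. (c, u) \<in> r) cs)"

text \<open>The index b of the overview. \<open>Suc\<close> turns a position into a 1-based index;
  if no chain element is above u, the value is \<open>length cs + 1\<close>, which stands for the
  upper virtual element.\<close>

definition upper_index :: "'a rel \<Rightarrow> 'a list \<Rightarrow> 'a \<Rightarrow> nat" where
  "upper_index r cs u = Suc (length (takeWhile (\<lambda>c. (u, c) \<notin> r) cs))"

locale poset_chain = finite_poset r P for r :: "'a rel" and P +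
  fixes cs :: "'a list"
  assumes chain: "chain_in r P cs"
begin

abbreviation lo where "lo \<equiv> lower_index r cs"
abbreviation hi where "hi \<equiv> upper_index r cs"

lemma chain_less: "i < j \<Longrightarrow> j < length cs \<Longrightarrow> (cs ! i, cs ! j) \<in> r \<and> cs ! i \<noteq> cs ! j"
  using chain by (auto simp: chain_in_def sorted_wrt_iff_nth_less)

lemma chain_mem: "i < length cs \<Longrightarrow> cs ! i \<in> P"
  using chain by (auto simp: chain_in_def)

lemma set_chain: "set cs \<subseteq> P"
  using chain by (simp add: chain_in_def)

lemma chain_le: "i \<le> j \<Longrightarrow> j < length cs \<Longrightarrow> (cs ! i, cs ! j) \<in> r"
  using chain_less[of i j] refl_P[OF chain_mem] by (cases "i = j") auto

lemma distinct_chain: "distinct cs"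
  unfolding distinct_conv_nth using chain_less by (metis nat_neq_iff)

lemma lower_index_le: "lo u \<le> length cs"
  by (simp add: lower_index_def length_takeWhile_le)

lemma upper_index_bounds: "1 \<le> hi u" "hi u \<le> Suc (length cs)"
  by (simp_all add: upper_index_def length_takeWhile_le)

text \<open>By transitivity the chain elements below u form a prefix, so the prefix length decides
  every single comparison.\<close>

lemma less_lower_index_iff:
  assumes "i < length cs" shows "i < lo u \<longleftrightarrow> (cs ! i, u) \<in> r"
proof
  assume "i < lo u"
  then show "(cs ! i, u) \<in> r"
    unfolding lower_index_def by (metis nth_mem set_takeWhileD takeWhile_nth)
next
  assume *: "(cs ! i, u) \<in> r"
  have "(cs ! j, u) \<in> r" if "j \<le> i" for j
    using chain_le[OF that assms] * trans_r by (meson transD)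
  then show "i < lo u"
    unfolding lower_index_def using assms nth_length_takeWhile[of "\<lambda>c. (c, u) \<in> r" cs]
    by (meson leI le_less_trans)
qed

lemma upper_index_le_iff:
  assumes "i < length cs" shows "hi u \<le> Suc i \<longleftrightarrow> (u, cs ! i) \<in> r"
proof
  assume "hi u \<le> Suc i"
  then have j: "length (takeWhile (\<lambda>c. (u, c) \<notin> r) cs) \<le> i" by (simp add: upper_index_def)
  then have "(u, cs ! length (takeWhile (\<lambda>c. (u, c) \<notin> r) cs)) \<in> r"
    using assms nth_length_takeWhile[of "\<lambda>c. (u, c) \<notin> r" cs] by simp
  with chain_le[OF j assms] trans_r show "(u, cs ! i) \<in> r" by (meson transD)
next
  assume *: "(u, cs ! i) \<in> r"
  have "\<not> i < length (takeWhile (\<lambda>c. (u, c) \<notin> r) cs)"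
    using * by (metis (no_types, lifting) nth_mem set_takeWhileD takeWhile_nth)
  then show "hi u \<le> Suc i" by (simp add: upper_index_def)
qed

lemma below_chain_iff: "i \<le> length cs \<Longrightarrow> below_chain r cs i u \<longleftrightarrow> hi u \<le> i"
  using upper_index_le_iff[of "i - 1" u] upper_index_bounds[of u] by (auto simp: below_chain_def)

lemma above_chain_iff: "i \<le> length cs \<Longrightarrow> above_chain r cs (Suc i) u \<longleftrightarrow> i < lo u"
  using less_lower_index_iff[of i u] lower_index_le[of u] by (auto simp: above_chain_def)

lemma sub_poset_iff: "i \<le> length cs \<Longrightarrow> u \<in> sub_poset r P cs i \<longleftrightarrow> u \<in> P \<and> lo u \<le> i \<and> i < hi u"
  by (auto simp: sub_poset_def below_chain_iff above_chain_iff)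

lemma down_part_iff: "i \<le> length cs \<Longrightarrow> u \<in> down_part r P cs i \<longleftrightarrow> u \<in> P \<and> hi u \<le> i"
  by (auto simp: down_part_def below_chain_iff)

lemma index_chain:
  assumes "i < length cs" shows "lo (cs ! i) = Suc i" "hi (cs ! i) = Suc i"
proof -
  have "j < lo (cs ! i) \<longleftrightarrow> j \<le> i" if "j < length cs" for j
    using less_lower_index_iff[OF that] chain_le[of j i] chain_less[of i j] assms that
      antisym_P[OF chain_mem chain_mem]
    by (metis leI less_imp_le)
  from this[of i] this[of "Suc i"] show "lo (cs ! i) = Suc i"
    using assms lower_index_le[of "cs ! i"] by (cases "Suc i < length cs") auto
  have "hi (cs ! i) \<le> Suc j \<longleftrightarrow> i \<le> j" if "j < length cs" for j
    using upper_index_le_iff[OF that] chain_le[of i j] chain_less[of j i] assms that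
      antisym_P[OF chain_mem chain_mem]
    by (metis leI less_imp_le)
  from this[of i] this[of "i - 1"] show "hi (cs ! i) = Suc i"
    using assms upper_index_bounds[of "cs ! i"] by (cases i) (auto simp: not_le)
qed

text \<open>If \<open>hi u \<le> lo u\<close>, the chain element with index \<open>hi u\<close> is
  both above and below u, and antisymmetry makes u that element.\<close>

lemma chain_index_less: "u \<in> P - set cs \<Longrightarrow> lo u < hi u"
proof (rule ccontr)
  assume u: "u \<in> P - set cs" and "\<not> lo u < hi u"
  then have i: "hi u - 1 < length cs" "hi u - 1 < lo u" "hi u \<le> Suc (hi u - 1)"
    using lower_index_le[of u] upper_index_bounds[of u] by auto
  then have "(cs ! (hi u - 1), u) \<in> r" "(u, cs ! (hi u - 1)) \<in> r"
    using less_lower_index_iff[OF i(1), of u] upper_index_le_iff[OF i(1), of u] by auto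
  then have "u = cs ! (hi u - 1)" using u i(1) chain_mem antisym_P by blast
  then show False using u nth_mem[OF i(1)] by simp
qed

lemma in_chain_iff: "u \<in> P \<Longrightarrow> u \<in> set cs \<longleftrightarrow> lo u = hi u"
  using chain_index_less[of u] index_chain by (metis DiffI in_set_conv_nth less_irrefl)

lemma sub_poset_subset: "i \<le> length cs \<Longrightarrow> sub_poset r P cs i \<subseteq> P - set cs"
  by (auto simp: sub_poset_iff in_chain_iff subset_iff)

text \<open>Otherwise v lies below the chain element with index \<open>hi v\<close>, which lies
  below u. Applied in both directions to incomparable elements off the chain, this says that their
  index intervals meet.\<close>

lemma incomparable_index_less:
  assumes "u \<in> P" "v \<in> P" "(v, u) \<notin> r" shows "lo u < hi v"
proof (rule ccontr)
  assume *: "\<not> lo u < hi v"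
  let ?i = "hi v - 1"
  have i: "?i < length cs" "?i < lo u" using * lower_index_le[of u] upper_index_bounds[of v] by auto
  then have "(cs ! ?i, u) \<in> r" "(v, cs ! ?i) \<in> r"
    using less_lower_index_iff[of ?i u] upper_index_le_iff[of ?i v] upper_index_bounds[of v] by auto
  with assms(3) trans_r show False by (meson transD)
qed

end

text \<open>
  The existence of a level function, whose values do not exceed the length of the chain, certifies
  that the chain is longest.
\<close>

locale leveled_chain = poset_chain r P cs for r :: "'a rel" and P cs +
  fixes f :: "'a \<Rightarrow> nat"
  assumes level_pos: "u \<in> P \<Longrightarrow> 1 \<le> f u"
    and level_le: "u \<in> P \<Longrightarrow> f u \<le> length cs"
    and level_mono: "u \<in> P \<Longrightarrow> v \<in> P \<Longrightarrow> (u, v) \<in> r \<Longrightarrow> u \<noteq> v \<Longrightarrow> f u < f v"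
begin

text \<open>Levels increase strictly along the chain and stay within 1 and its length, which leaves
  only one possibility: the climb from c_1 gives the lower bound, the room up to the last element
  the upper one.\<close>

lemma level_chain:
  assumes "i < length cs" shows "f (cs ! i) = Suc i"
proof (rule antisym)
  have "f (cs ! i) + (j - i) \<le> f (cs ! j)" if "i \<le> j" "j < length cs" for j
    using that
  proof (induction j rule: dec_induct)
    case (step j)
    have "f (cs ! j) < f (cs ! Suc j)"
      using step chain_less[of j "Suc j"] by (intro level_mono) (auto simp: chain_mem)
    with step show ?case by simp
  qed simp
  from this[of "length cs - 1"] show "f (cs ! i) \<le> Suc i"
    using assms level_le[OF chain_mem, of "length cs - 1"] by force
  show "Suc i \<le> f (cs ! i)"
    using assms
  proof (induction i)
    case 0 then show ?case using level_pos chain_mem by simp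
  next
    case (Suc i)
    have "f (cs ! i) < f (cs ! Suc i)"
      using Suc chain_less[of i "Suc i"] by (intro level_mono) (auto simp: chain_mem)
    with Suc show ?case by simp
  qed
qed

text \<open>Along any chain the levels are distinct values in 1, ..., k. This is the easy half of
  the duality between chains and partitions into antichains.\<close>

lemma longest: "longest_chain r P cs"
proof -
  have "length ds \<le> length cs" if ds: "chain_in r P ds" for ds
  proof -
    have "sorted_wrt (\<lambda>u v. f u < f v) ds"
    proof (rule sorted_wrt_mono_rel)
      show "sorted_wrt (\<lambda>u v. (u, v) \<in> r \<and> u \<noteq> v) ds" using ds by (simp add: chain_in_def)
    qed (use ds level_mono in \<open>auto simp: chain_in_def\<close>)
    then have "sorted_wrt (<) (map f ds)" by (simp add: sorted_wrt_map)
    then have "card (set (map f ds)) = length ds" by (metis strict_sorted_iff distinct_card length_map)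
    moreover have "set (map f ds) \<subseteq> {1..length cs}"
      using ds level_pos level_le by (force simp: chain_in_def)
    ultimately show ?thesis
      using card_mono[of "{1..length cs}" "set (map f ds)"] by (simp del: set_map)
  qed
  with chain show ?thesis by (simp add: longest_chain_def)
qed

text \<open>The level of u is compared with those of its two chain neighbors, which equal their
  indices; at the virtual ends the range of f takes over. The consequence
  \<open>lo u + 2 \<le> hi u\<close> is where the maximality of the chain enters the
  counting.\<close>

lemma level_between:
  assumes "u \<in> P - set cs" shows "lo u < f u" "f u < hi u"
proof -
  show "lo u < f u"
  proof (cases "lo u")
    case 0 then show ?thesis using level_pos assms by force
  next
    case (Suc i)
    then have i: "i < length cs" using lower_index_le[of u] by simp
    then have "f (cs ! i) < f u"
      using Suc less_lower_index_iff[OF i, of u] assms by (intro level_mono) (auto simp: chain_mem)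
    with Suc i show ?thesis by (simp add: level_chain)
  qed
  show "f u < hi u"
  proof (cases "hi u \<le> length cs")
    case False then show ?thesis using level_le[of u] assms by simp
  next
    case True
    then have i: "hi u - 1 < length cs" using upper_index_bounds[of u] by simp
    then have "f u < f (cs ! (hi u - 1))"
      using upper_index_le_iff[OF i, of u] assms upper_index_bounds[of u] nth_mem[OF i]
      by (intro level_mono) (auto simp: chain_mem simp del: nth_mem)
    with i upper_index_bounds[of u] show ?thesis by (simp add: level_chain)
  qed
qed



end

section \<open>The potential of a poset\<close>

definition antichains :: "'a rel \<Rightarrow> 'a set \<Rightarrow> 'a set set" where
  "antichains r P = {X. X \<subseteq> P \<and> (\<forall>u\<in>X. \<forall>v\<in>X. (u, v) \<in> r \<longrightarrow> u = v)}"

text \<open>Natural subtraction truncates at 0, so antichains with four or more elements contribute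
  nothing without an explicit bound on the size.\<close>

definition potential :: "'a rel \<Rightarrow> 'a set \<Rightarrow> nat" where
  "potential r P = (\<Sum>X\<in>antichains r P. 4 - card X)"

lemma potential_empty: "potential r {} = 4"
proof -
  have "antichains r {} = {{}}" by (auto simp: antichains_def)
  then show ?thesis by (simp add: potential_def)
qed

lemma finite_antichains: "finite P \<Longrightarrow> finite (antichains r P)"
  by (rule finite_subset[of _ "Pow P"]) (auto simp: antichains_def)

context leveled_chain
begin

text \<open>\<open>card (span X)\<close> is the s(X) of the overview. The empty antichain lies in
  every P_i, so its span has \<open>length cs + 1\<close> elements.\<close>

definition span :: "'a set \<Rightarrow> nat set" where
  "span X = {i. i \<le> length cs \<and> X \<subseteq> sub_poset r P cs i}"

definition gain :: nat where
  "gain = (\<Sum>X | X \<in> antichains r (P - set cs) \<and> card X \<le> 3. card (span X) - 1)"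

lemma finite_span: "finite (span X)"
  by (simp add: span_def)

lemma span_iff: "X \<subseteq> P \<Longrightarrow> i \<in> span X \<longleftrightarrow> i \<le> length cs \<and> (\<forall>x\<in>X. lo x \<le> i \<and> i < hi x)"
  using sub_poset_iff[of i] by (auto simp: span_def)

text \<open>Helly's theorem on the line: the index intervals meet pairwise, so the largest lower end
  belongs to all of them.\<close>

lemma span_nonempty:
  assumes "X \<in> antichains r (P - set cs)" shows "span X \<noteq> {}"
proof (cases "X = {}")
  case False
  have X: "X \<subseteq> P" "finite X" using assms finite_P by (auto simp: antichains_def intro: finite_subset)
  define i where "i = Max (lo ` X)"
  have "i \<in> lo ` X" unfolding i_def using False X by (intro Max_in) auto
  then obtain x where x: "x \<in> X" "i = lo x" by auto
  have "lo y \<le> i \<and> i < hi y" if y: "y \<in> X" for y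
  proof
    show "lo y \<le> i" unfolding i_def using y X by simp
    show "i < hi y"
    proof (cases "x = y")
      case True then show ?thesis using x y level_between[of y] assms by (force simp: antichains_def)
    next
      case False
      then show ?thesis
        using x y assms X unfolding x(2) by (intro incomparable_index_less) (auto simp: antichains_def)
    qed
  qed
  then have "i \<in> span X" using X x lower_index_le[of x] by (auto simp: span_iff)
  then show ?thesis by auto
qed (auto simp: span_def)

text \<open>If the element at position i extends X, it is incomparable to all of X, which puts both
  i and i + 1 into the span. Hence i is never the maximum of the span, which saves one.\<close>

lemma chain_extensions:
  assumes X: "X \<in> antichains r (P - set cs)"
  shows "card {c \<in> set cs. insert c X \<in> antichains r P} \<le> card (span X) - 1"
proof -
  let ?I = "{i. i < length cs \<and> insert (cs ! i) X \<in> antichains r P}"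
  have XP: "X \<subseteq> P" using X by (auto simp: antichains_def)
  have span: "i \<in> span X \<and> Suc i \<in> span X" if i: "i \<in> ?I" for i
  proof -
    have "lo x \<le> i \<and> Suc i < hi x" if x: "x \<in> X" for x
    proof -
      have "x \<noteq> cs ! i" using x X i by (auto simp: antichains_def)
      then have "(cs ! i, x) \<notin> r" "(x, cs ! i) \<notin> r" using x i by (auto simp: antichains_def)
      then show ?thesis using less_lower_index_iff[of i x] upper_index_le_iff[of i x] i by auto
    qed
    then show ?thesis using i XP by (force simp: span_iff)
  qed
  then have sub: "?I \<subseteq> span X - {Max (span X)}"
    using Max_ge[OF finite_span, of _ X] by force
  have "{c \<in> set cs. insert c X \<in> antichains r P} = (\<lambda>i. cs ! i) ` ?I"
    by (auto simp: in_set_conv_nth)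
  then have "card {c \<in> set cs. insert c X \<in> antichains r P} \<le> card ?I"
    by (simp add: card_image_le)
  also have "\<dots> \<le> card (span X - {Max (span X)})"
    using sub by (intro card_mono) (auto simp: finite_span)
  also have "\<dots> = card (span X) - 1"
    using span_nonempty[OF X] finite_span by (simp add: card_Diff_singleton)
  finally show ?thesis .
qed

text \<open>Chain elements are pairwise comparable, so an antichain contains at most one of them and
  is either an X off the chain or such an X with one c inserted. An upper bound suffices, so the sum
  over the image can be estimated without injectivity of the insertion.\<close>

lemma potential_split:
  "potential r P \<le> (\<Sum>X\<in>antichains r (P - set cs).
     (4 - card X) + card {c \<in> set cs. insert c X \<in> antichains r P} * (3 - card X))"
proof -
  let ?A = "antichains r (P - set cs)"
  let ?E = "\<lambda>X. {c \<in> set cs. insert c X \<in> antichains r P}"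
  let ?B = "(\<lambda>(X, c). insert c X) ` Sigma ?A ?E"
  have fin: "finite ?A" "\<And>X. finite (?E X)" using finite_P by (auto simp: finite_antichains)
  have cover: "antichains r P \<subseteq> ?A \<union> ?B"
  proof
    fix Y assume Y: "Y \<in> antichains r P"
    show "Y \<in> ?A \<union> ?B"
    proof (cases "Y \<inter> set cs = {}")
      case True then show ?thesis using Y by (auto simp: antichains_def)
    next
      case False
      then obtain c where c: "c \<in> Y" "c \<in> set cs" by auto
      have "d = c" if "d \<in> Y" "d \<in> set cs" for d
        using that c Y chain_le unfolding antichains_def in_set_conv_nth
        by (smt (verit) mem_Collect_eq nle_le)
      then have "Y - {c} \<in> ?A" using Y by (auto simp: antichains_def)
      moreover have "insert c (Y - {c}) = Y" using c by auto
      ultimately have "(Y - {c}, c) \<in> Sigma ?A ?E" using c Y by simp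
      then have "(\<lambda>(X, c). insert c X) (Y - {c}, c) \<in> ?B" by (rule imageI)
      then show ?thesis using \<open>insert c (Y - {c}) = Y\<close> by simp
    qed
  qed
  have "potential r P \<le> (\<Sum>X\<in>?A \<union> ?B. 4 - card X)"
    unfolding potential_def using fin cover by (intro sum_mono2) auto
  also have "\<dots> \<le> (\<Sum>X\<in>?A. 4 - card X) + (\<Sum>X\<in>?B. 4 - card X)"
    using fin by (subst sum_Un_nat) auto
  also have "(\<Sum>X\<in>?B. 4 - card X) \<le> (\<Sum>(X, c)\<in>Sigma ?A ?E. 4 - card (insert c X))"
    using fin sum_image_le[of "Sigma ?A ?E" "\<lambda>X. 4 - card X" "\<lambda>(X, c). insert c X"]
    by (simp add: case_prod_unfold comp_def)
  also have "\<dots> = (\<Sum>X\<in>?A. \<Sum>c\<in>?E X. 4 - card (insert c X))"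
    using fin by (simp add: sum.Sigma)
  also have "\<dots> = (\<Sum>X\<in>?A. card (?E X) * (3 - card X))"
  proof (intro sum.cong refl)
    fix X assume X: "X \<in> ?A"
    then have "finite X" using finite_P by (auto simp: antichains_def intro: finite_subset)
    moreover have "c \<notin> X" if "c \<in> set cs" for c using that X by (auto simp: antichains_def)
    ultimately show "(\<Sum>c\<in>?E X. 4 - card (insert c X)) = card (?E X) * (3 - card X)" by simp
  qed
  finally show ?thesis by (simp add: sum.distrib)
qed

lemma potential_gain: "potential r P + gain \<le> (\<Sum>i\<le>length cs. potential r (sub_poset r P cs i))"
proof -
  let ?A = "antichains r (P - set cs)"
  have fin: "finite ?A" using finite_P by (simp add: finite_antichains)
  \<comment> \<open>The P_i avoid the chain, so their antichains are exactly those X of the outer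
    sum whose span contains i; this permits the exchange of summation.\<close>
  have A: "antichains r (sub_poset r P cs i) = {X \<in> ?A. i \<in> span X}" if "i \<le> length cs" for i
    using that sub_poset_subset[OF that] by (auto simp: antichains_def span_def)
  have "gain = (\<Sum>X\<in>?A. if card X \<le> 3 then card (span X) - 1 else 0)"
    unfolding gain_def using fin by (subst sum.inter_filter[symmetric]) (auto intro: sum.cong)
  then have "potential r P + gain \<le> (\<Sum>X\<in>?A. (4 - card X)
      + card {c \<in> set cs. insert c X \<in> antichains r P} * (3 - card X)
      + (if card X \<le> 3 then card (span X) - 1 else 0))"
    using potential_split by (simp add: sum.distrib)
  also have "\<dots> \<le> (\<Sum>X\<in>?A. card (span X) * (4 - card X))"
  proof (intro sum_mono)
    fix X assume X: "X \<in> ?A"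
    define s where "s = card (span X) - 1"
    have s: "card (span X) = Suc s" using span_nonempty[OF X] finite_span[of X] by (simp add: s_def card_gt_0_iff)
    define e where "e = card {c \<in> set cs. insert c X \<in> antichains r P}"
    have "e \<le> s" using chain_extensions[OF X] by (simp add: e_def s_def)
    then have le: "e * (3 - card X) \<le> s * (3 - card X)" by simp
    show "(4 - card X) + e * (3 - card X) + (if card X \<le> 3 then card (span X) - 1 else 0)
        \<le> card (span X) * (4 - card X)"
    \<comment> \<open>For |X| > 3 every term is 0. Otherwise the extreme case e = s is the identity
      (4 - |X|) + s (3 - |X|) + s = (s + 1)(4 - |X|).\<close>
    proof (cases "card X \<le> 3")
      case True
      then have "4 - card X = Suc (3 - card X)" by simp
      then show ?thesis using le True by (simp only: s if_True mult_Suc mult_Suc_right diff_Suc_1)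
    qed simp
  qed
  also have "\<dots> = (\<Sum>X\<in>?A. \<Sum>i\<le>length cs. if i \<in> span X then 4 - card X else 0)"
  proof (intro sum.cong refl)
    fix X
    have "{i. i \<le> length cs \<and> i \<in> span X} = span X" by (auto simp: span_def)
    then show "card (span X) * (4 - card X) = (\<Sum>i\<le>length cs. if i \<in> span X then 4 - card X else 0)"
      by (simp add: sum.If_cases Int_def)
  qed
  also have "\<dots> = (\<Sum>i\<le>length cs. \<Sum>X\<in>?A. if i \<in> span X then 4 - card X else 0)"
    by (rule sum.swap)
  also have "\<dots> = (\<Sum>i\<le>length cs. potential r (sub_poset r P cs i))"
    using fin by (intro sum.cong refl) (simp add: potential_def A sum.inter_filter)
  finally show ?thesis .
qed

end

section \<open>The potential pays for the local work\<close>

lemma sum_inverse_sqrt_le: "(\<Sum>j=1..m. 1 / sqrt (real j)) \<le> 2 * sqrt (real m)"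
proof (induction m)
  case (Suc m)
  \<comment> \<open>Here a and b are consecutive square roots; the claim is 0 \<le> (a - b)^2
    rewritten with a^2 = b^2 - 1 and divided by b.\<close>
  have *: "1 / b + 2 * a \<le> 2 * b" if "b > 0" "b\<^sup>2 = a\<^sup>2 + 1" for a b :: real
  proof -
    have "0 \<le> (a - b)\<^sup>2" by simp
    then have "1 + 2 * a * b \<le> 2 * b\<^sup>2"
      using that by (simp add: power2_diff)
    then have "(1 + 2 * a * b) / b \<le> 2 * b\<^sup>2 / b" using that by (intro divide_right_mono) auto
    then show ?thesis using that by (simp add: add_divide_distrib power2_eq_square)
  qed
  have "1 / sqrt (real (Suc m)) + 2 * sqrt (real m) \<le> 2 * sqrt (real (Suc m))"
    by (rule *) auto
  with Suc show ?case by simp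
qed simp

text \<open>With M the weighted sum of cubes and s = sqrt M, the indices are split by whether j
  l_j^2 \<le> s. If so, l_j \<le> sqrt (s / j), and l_j \<ge> 1 forces j \<le> s, so these terms sum
  to at most 2 s. If not, l_j \<le> j l_j^3 / s, and these sum to at most M / s = s. The total 3 s
  explains the factor 9.\<close>

lemma square_sum_le_weighted_cubes:
  fixes l :: "nat \<Rightarrow> nat"
  assumes "finite J" and pos: "\<And>j. j \<in> J \<Longrightarrow> 1 \<le> j \<and> 1 \<le> l j"
  shows "(\<Sum>j\<in>J. l j)\<^sup>2 \<le> 9 * (\<Sum>j\<in>J. j * l j ^ 3)"
proof (cases "J = {}")
  case False
  define M where "M = real (\<Sum>j\<in>J. j * l j ^ 3)"
  define s where "s = sqrt M"
  have "0 < (\<Sum>j\<in>J. j * l j ^ 3)"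
    using False assms by (intro sum_pos) force+
  then have M: "M > 0" unfolding M_def by linarith
  then have s: "s > 0" "s * s = M" by (simp_all add: s_def)
  have term_le: "real (l j) \<le> (if real j \<le> s then sqrt s * (1 / sqrt (real j)) else 0) + real (j * l j ^ 3) / s"
    if j: "j \<in> J" for j
  proof (cases "real (j * (l j)\<^sup>2) \<le> s")
    case True
    have "j * 1 \<le> j * (l j)\<^sup>2" using pos[OF j] by (intro mult_left_mono) auto
    then have "real j \<le> real (j * (l j)\<^sup>2)" by linarith
    with True have js: "real j \<le> s" by linarith
    have "(real (l j))\<^sup>2 \<le> s / real j" using True pos[OF j] by (simp add: field_simps)
    then have "real (l j) \<le> sqrt (s / real j)" by (simp add: real_le_rsqrt)
    then show ?thesis using js s by (simp add: real_sqrt_divide add_increasing2)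
  next
    case False
    then have "s * real (l j) \<le> real (j * (l j)\<^sup>2) * real (l j)" by (intro mult_right_mono) auto
    then have "real (l j) \<le> real (j * l j ^ 3) / s"
      using s by (simp add: field_simps power2_eq_square power3_eq_cube)
    moreover have "0 \<le> (if real j \<le> s then sqrt s * (1 / sqrt (real j)) else 0)" using s by simp
    ultimately show ?thesis by linarith
  qed
  have le: "real (\<Sum>j\<in>J. l j) \<le> (\<Sum>j\<in>J. (if real j \<le> s then sqrt s * (1 / sqrt (real j)) else 0)
      + real (j * l j ^ 3) / s)"
    unfolding of_nat_sum by (intro sum_mono term_le)
  have "(\<Sum>j\<in>J. if real j \<le> s then sqrt s * (1 / sqrt (real j)) else 0)
      = (\<Sum>j | j \<in> J \<and> real j \<le> s. sqrt s * (1 / sqrt (real j)))"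
    using assms(1) by (rule sum.inter_filter[symmetric])
  also have "\<dots> \<le> (\<Sum>j=1..nat \<lfloor>s\<rfloor>. sqrt s * (1 / sqrt (real j)))"
    using pos s by (intro sum_mono2) (auto simp: le_nat_iff le_floor_iff)
  also have "\<dots> \<le> sqrt s * (2 * sqrt (real (nat \<lfloor>s\<rfloor>)))"
    unfolding sum_distrib_left[symmetric] using s by (intro mult_left_mono sum_inverse_sqrt_le) auto
  also have "\<dots> \<le> sqrt s * (2 * sqrt s)"
    using s by (intro mult_left_mono) auto
  also have "\<dots> = 2 * s" using s by simp
  finally have "(\<Sum>j\<in>J. if real j \<le> s then sqrt s * (1 / sqrt (real j)) else 0) \<le> 2 * s" .
  with le have "real (\<Sum>j\<in>J. l j) \<le> 2 * s + (\<Sum>j\<in>J. real (j * l j ^ 3) / s)"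
    unfolding sum.distrib by linarith
  also have "(\<Sum>j\<in>J. real (j * l j ^ 3) / s) = M / s"
    by (simp add: M_def sum_divide_distrib)
  also have "M / s = s" using s by (simp add: field_simps)
  finally have "(real (\<Sum>j\<in>J. l j))\<^sup>2 \<le> (3 * s)\<^sup>2" by (intro power_mono) (auto simp: sum_nonneg)
  then have "real ((\<Sum>j\<in>J. l j)\<^sup>2) \<le> real (9 * (\<Sum>j\<in>J. j * l j ^ 3))"
    using s by (simp add: power2_eq_square M_def)
  then show ?thesis by (simp only: of_nat_le_iff)
qed simp

lemma cube_le_small_subsets:
  assumes "finite A"
  shows "card A ^ 3 \<le> 6 * card {X. X \<subseteq> A \<and> X \<noteq> {} \<and> card X \<le> 3}"
proof -
  have two: "2 * (m choose 2) + m = m\<^sup>2" for m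
    by (induction m) (auto simp: numeral_2_eq_2 power2_eq_square algebra_simps)
  \<comment> \<open>The closed form dominates m^3, which yields the factor 6 in the claim.\<close>
  have three: "6 * (m + (m choose 2) + (m choose 3)) = m ^ 3 + 5 * m" for m
  proof (induction m)
    case (Suc m)
    have "Suc m choose 2 = m + (m choose 2)" "Suc m choose 3 = (m choose 2) + (m choose 3)"
      by (simp_all add: numeral_2_eq_2 numeral_3_eq_3)
    then show ?case
      using Suc two[of m] by (simp add: power2_eq_square power3_eq_cube algebra_simps)
  qed simp
  let ?S = "\<lambda>m. {X. X \<subseteq> A \<and> card X = m}"
  have fin: "finite (?S m)" for m using assms by simp
  have eq: "{X. X \<subseteq> A \<and> X \<noteq> {} \<and> card X \<le> 3} = ?S 1 \<union> (?S 2 \<union> ?S 3)"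
    using assms by (auto simp: le_Suc_eq numeral_2_eq_2 numeral_3_eq_3 dest: finite_subset)
  have "card {X. X \<subseteq> A \<and> X \<noteq> {} \<and> card X \<le> 3} = card A + ((card A choose 2) + (card A choose 3))"
    unfolding eq using fin by (subst card_Un_disjoint, simp, simp, force)+ (simp add: n_subsets[OF assms])
  with three[of "card A"] show ?thesis by simp
qed

text \<open>A is partitioned by the values of h; the factor is 54 = 9 * 6, from the two preceding
  estimates.\<close>

lemma card_square_le_small_subsets:
  fixes h :: "'a \<Rightarrow> nat"
  assumes A: "finite A" and pos: "\<And>u. u \<in> A \<Longrightarrow> 1 \<le> h u"
  shows "(card A)\<^sup>2 \<le> 54 * (\<Sum>j\<in>h ` A. j * card {X. X \<subseteq> {u \<in> A. h u = j} \<and> X \<noteq> {} \<and> card X \<le> 3})"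
proof -
  let ?l = "\<lambda>j. card {u \<in> A. h u = j}"
  have "card A = (\<Sum>j\<in>h ` A. ?l j)"
    using sum.group[of A "h ` A" h "\<lambda>_. 1::nat"] A by simp
  then have "(card A)\<^sup>2 = (\<Sum>j\<in>h ` A. ?l j)\<^sup>2" by simp
  also have "\<dots> \<le> 9 * (\<Sum>j\<in>h ` A. j * ?l j ^ 3)"
    using A pos by (intro square_sum_le_weighted_cubes) (auto simp: Suc_le_eq card_gt_0_iff)
  also have "\<dots> \<le> 9 * (\<Sum>j\<in>h ` A. j * (6 * card {X. X \<subseteq> {u \<in> A. h u = j} \<and> X \<noteq> {} \<and> card X \<le> 3}))"
    using A by (intro mult_left_mono sum_mono cube_le_small_subsets) auto
  also have "\<dots> = 54 * (\<Sum>j\<in>h ` A. j * card {X. X \<subseteq> {u \<in> A. h u = j} \<and> X \<noteq> {} \<and> card X \<le> 3})"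
    by (simp add: sum_distrib_left mult.left_commute mult.commute)
  finally show ?thesis .
qed

context leveled_chain
begin

section \<open>Lower bounds on the gain from particular families of antichains\<close>

lemma gain_ge:
  assumes "F \<subseteq> {X \<in> antichains r (P - set cs). card X \<le> 3}"
  shows "(\<Sum>X\<in>F. card (span X) - 1) \<le> gain"
  unfolding gain_def using assms finite_P
  by (intro sum_mono2) (auto intro: finite_subset[OF _ finite_antichains[of "P - set cs" r]])

text \<open>The whole interval from i to i + j lies in the span; any element of X keeps its right
  end within the range of indices.\<close>

lemma card_span_ge:
  assumes "X \<subseteq> P" "\<And>x. x \<in> X \<Longrightarrow> lo x \<le> i" "\<And>x. x \<in> X \<Longrightarrow> i + j < hi x" "X \<noteq> {}"
  shows "j \<le> card (span X) - 1"
proof -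
  obtain x where "x \<in> X" using assms by auto
  then have "i + j \<le> length cs" using assms(3)[of x] upper_index_bounds[of x] by simp
  then have "{i..i + j} \<subseteq> span X" using assms by (force simp: span_iff)
  then have "card {i..i + j} \<le> card (span X)" by (intro card_mono finite_span)
  then show ?thesis by simp
qed

lemma span_singleton: "u \<in> P - set cs \<Longrightarrow> card (span {u}) - 1 = hi u - lo u - 1"
proof -
  assume u: "u \<in> P - set cs"
  then have "span {u} = {lo u..<hi u}" using upper_index_bounds[of u] by (auto simp: span_iff)
  then show ?thesis by simp
qed

text \<open>The contribution of the singletons. The summand counts the chain elements incomparable
  to u, so the sum also counts the incomparable pairs that meet the chain.\<close>

lemma gain_index: "(\<Sum>u\<in>P - set cs. hi u - lo u - 1) \<le> gain"
proof -
  have "(\<Sum>u\<in>P - set cs. hi u - lo u - 1) = (\<Sum>u\<in>P - set cs. card (span {u}) - 1)"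
    using span_singleton by (intro sum.cong) simp_all
  also have "\<dots> = (\<Sum>X\<in>(\<lambda>u. {u}) ` (P - set cs). card (span X) - 1)"
    by (subst sum.reindex) auto
  also have "\<dots> \<le> gain" by (rule gain_ge) (auto simp: antichains_def)
  finally show ?thesis .
qed

lemma gain_card: "card (P - set cs) \<le> gain"
proof -
  have "card (P - set cs) = (\<Sum>u\<in>P - set cs. 1)" by simp
  also have "\<dots> \<le> (\<Sum>u\<in>P - set cs. hi u - lo u - 1)"
    using level_between by (intro sum_mono) fastforce
  also note gain_index
  finally show ?thesis .
qed

text \<open>The contribution of the empty antichain, which lies in all k + 1 subposets.\<close>

lemma gain_length: "length cs \<le> gain"
proof -
  have "span {} = {..length cs}" by (auto simp: span_def)
  then show ?thesis using gain_ge[of "{{}}"] by (simp add: antichains_def)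
qed

text \<open>
  \<open>key\<close> is either end of the interval of indices of an element, and \<open>h\<close> its distance from the level.
  For a common value of \<open>key\<close>, the elements with the same level form an antichain.
\<close>

lemma gain_squares:
  fixes key h :: "'a \<Rightarrow> nat"
  assumes pos: "\<And>u. u \<in> P - set cs \<Longrightarrow> 1 \<le> h u"
    and level: "\<And>u v. u \<in> P - set cs \<Longrightarrow> v \<in> P - set cs \<Longrightarrow> key u = key v \<Longrightarrow> h u = h v \<Longrightarrow> f u = f v"
    and span: "\<And>X i j. X \<subseteq> P - set cs \<Longrightarrow> X \<noteq> {} \<Longrightarrow> (\<And>x. x \<in> X \<Longrightarrow> key x = i \<and> h x = j) \<Longrightarrow>
      j \<le> card (span X) - 1"
  shows "(\<Sum>i\<in>key ` (P - set cs). (card {u \<in> P - set cs. key u = i})\<^sup>2) \<le> 54 * gain"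
proof -
  let ?T = "P - set cs"
  let ?A = "\<lambda>i. {u \<in> ?T. key u = i}"
  let ?F = "\<lambda>(i, j). {X. X \<subseteq> {u \<in> ?A i. h u = j} \<and> X \<noteq> {} \<and> card X \<le> 3}"
  let ?I = "Sigma (key ` ?T) (\<lambda>i. h ` ?A i)"
  have T: "finite ?T" using finite_P by simp
  have fin: "finite (?F p)" for p
    by (rule finite_subset[of _ "Pow ?T"]) (use T in \<open>auto split: prod.splits\<close>)
  have "(\<Sum>i\<in>key ` ?T. (card (?A i))\<^sup>2) \<le> (\<Sum>i\<in>key ` ?T. 54 * (\<Sum>j\<in>h ` ?A i. j * card (?F (i, j))))"
    unfolding prod.case using T pos by (intro sum_mono card_square_le_small_subsets) auto
  also have "\<dots> = 54 * (\<Sum>p\<in>?I. \<Sum>X\<in>?F p. snd p)"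
    using T by (simp add: sum_distrib_left[symmetric] sum.Sigma mult.commute case_prod_unfold)
  also have "(\<Sum>p\<in>?I. \<Sum>X\<in>?F p. snd p) \<le> (\<Sum>p\<in>?I. \<Sum>X\<in>?F p. card (span X) - 1)"
  proof (intro sum_mono)
    fix p X assume "X \<in> ?F p"
    then show "snd p \<le> card (span X) - 1"
      by (intro span[of _ "fst p"]) (auto split: prod.splits)
  qed
  \<comment> \<open>A nonempty X determines its value of \<open>key\<close> and its level, so the
    families are disjoint and no antichain is counted twice.\<close>
  also have "\<dots> = (\<Sum>X\<in>(\<Union>p\<in>?I. ?F p). card (span X) - 1)"
  proof (rule sum.UNION_disjoint[symmetric])
    show "finite ?I" using T by auto
    show "\<forall>p\<in>?I. finite (?F p)" using fin by blast
    show "\<forall>p\<in>?I. \<forall>p'\<in>?I. p \<noteq> p' \<longrightarrow> ?F p \<inter> ?F p' = {}"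
    proof (intro ballI impI, rule ccontr)
      fix p p' assume "p \<noteq> p'" "?F p \<inter> ?F p' \<noteq> {}"
      then obtain X x where "X \<in> ?F p" "X \<in> ?F p'" "x \<in> X" by blast
      then have "(key x, h x) = p" "(key x, h x) = p'" by (auto split: prod.splits)
      with \<open>p \<noteq> p'\<close> show False by simp
    qed
  qed
  also have "\<dots> \<le> gain"
  proof (rule gain_ge, rule subsetI)
    fix X assume "X \<in> (\<Union>p\<in>?I. ?F p)"
    then obtain i j where "X \<in> ?F (i, j)" by auto
    then have X: "X \<subseteq> ?T" "\<And>u. u \<in> X \<Longrightarrow> key u = i \<and> h u = j" "card X \<le> 3" by auto
    \<comment> \<open>Equal \<open>key\<close> and equal h mean equal f, whereas f increases
      strictly between distinct comparable elements.\<close>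
    have "u = v" if uv: "u \<in> X" "v \<in> X" "(u, v) \<in> r" for u v
    proof (rule ccontr)
      assume "u \<noteq> v"
      then have "f u < f v" using uv X by (intro level_mono) auto
      moreover have "f u = f v" using uv X by (intro level) auto
      ultimately show False by simp
    qed
    then show "X \<in> {X \<in> antichains r ?T. card X \<le> 3}" using X by (auto simp: antichains_def)
  qed
  finally show ?thesis by simp
qed

text \<open>For a common lower end i, the elements with f = i + j have their upper end beyond i + j,
  so they share the indices i, ..., i + j.\<close>

lemma gain_lower_squares:
  "(\<Sum>i\<in>lo ` (P - set cs). (card {u \<in> P - set cs. lo u = i})\<^sup>2) \<le> 54 * gain"
proof (rule gain_squares[where h = "\<lambda>u. f u - lo u"])
  fix X i j assume X: "X \<subseteq> P - set cs" "X \<noteq> {}" "\<And>x. x \<in> X \<Longrightarrow> lo x = i \<and> f x - lo x = j"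
  show "j \<le> card (span X) - 1"
    using X level_between by (intro card_span_ge[of _ i]) fastforce+
qed (use level_between in \<open>fastforce+\<close>)

lemma gain_upper_squares:
  "(\<Sum>i\<in>hi ` (P - set cs). (card {u \<in> P - set cs. hi u = i})\<^sup>2) \<le> 54 * gain"
proof (rule gain_squares[where h = "\<lambda>u. hi u - f u"])
  fix X i j assume X: "X \<subseteq> P - set cs" "X \<noteq> {}" "\<And>x. x \<in> X \<Longrightarrow> hi x = i \<and> hi x - f x = j"
  then obtain x where "x \<in> X" by auto
  then have "j < i" using X level_between[of x] by fastforce
  \<comment> \<open>Mirror image: from \<open>lo x < f x = i - j\<close> all lower ends are at most
    i - 1 - j, and j steps later the index i - 1 is still below the common upper end i.\<close>
  then show "j \<le> card (span X) - 1"
    using X level_between by (intro card_span_ge[of _ "i - 1 - j"]) fastforce+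
qed (use level_between in \<open>fastforce+\<close>)

text \<open>For each i the pairs form a product of the class with upper end i + 1 and the class with
  lower end i; a b \<le> a^2 + b^2 separates the two kinds of classes, each of which costs 54 times
  the gain.\<close>

lemma staggered_pairs:
  "card {(u, v). u \<in> P - set cs \<and> v \<in> P - set cs \<and> hi u = lo v + 1} \<le> 108 * gain"
proof -
  let ?T = "P - set cs"
  let ?A = "\<lambda>i. {u \<in> ?T. hi u = i + 1}" and ?B = "\<lambda>i. {u \<in> ?T. lo u = i}"
  have T: "finite ?T" using finite_P by simp
  have "{(u, v). u \<in> ?T \<and> v \<in> ?T \<and> hi u = lo v + 1} = (\<Union>i\<in>lo ` ?T. ?A i \<times> ?B i)" by auto
  then have "card {(u, v). u \<in> ?T \<and> v \<in> ?T \<and> hi u = lo v + 1} \<le> (\<Sum>i\<in>lo ` ?T. card (?A i \<times> ?B i))"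
    using T by (simp only:) (rule card_UN_le, simp)
  also have "\<dots> \<le> (\<Sum>i\<in>lo ` ?T. (card (?A i))\<^sup>2 + (card (?B i))\<^sup>2)"
  proof (intro sum_mono)
    fix i
    have "a * b \<le> a\<^sup>2 + b\<^sup>2" for a b :: nat
      by (cases "a \<le> b") (auto simp: power2_eq_square intro: le_trans[OF mult_le_mono1] le_trans[OF mult_le_mono2] trans_le_add1 trans_le_add2)
    then show "card (?A i \<times> ?B i) \<le> (card (?A i))\<^sup>2 + (card (?B i))\<^sup>2" by (simp add: card_cartesian_product)
  qed
  also have "\<dots> = (\<Sum>i\<in>lo ` ?T. (card (?A i))\<^sup>2) + (\<Sum>i\<in>lo ` ?T. (card (?B i))\<^sup>2)"
    by (rule sum.distrib)
  also have "(\<Sum>i\<in>lo ` ?T. (card (?A i))\<^sup>2) = (\<Sum>i\<in>Suc ` lo ` ?T. (card {u \<in> ?T. hi u = i})\<^sup>2)"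
    by (subst sum.reindex) auto
  also have "\<dots> \<le> (\<Sum>i\<in>Suc ` lo ` ?T \<union> hi ` ?T. (card {u \<in> ?T. hi u = i})\<^sup>2)"
    using T by (intro sum_mono2) auto
  also have "\<dots> = (\<Sum>i\<in>hi ` ?T. (card {u \<in> ?T. hi u = i})\<^sup>2)"
  proof (intro sum.mono_neutral_right ballI)
    fix i assume "i \<in> Suc ` lo ` ?T \<union> hi ` ?T - hi ` ?T"
    then have "{u \<in> ?T. hi u = i} = {}" by auto
    then show "(card {u \<in> ?T. hi u = i})\<^sup>2 = 0" by (simp only: card.empty) simp
  qed (use T in auto)
  finally show ?thesis using gain_lower_squares gain_upper_squares by linarith
qed

text \<open>Three kinds of pairs: those that meet the chain are paid for by singletons, those off
  the chain in at least two P_i by themselves, and the rest are staggered. Thus 110 = 1 + 1 +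
  108.\<close>

lemma card_incomparable_pairs_le:
  "card (incomparable_pairs P r) \<le> 110 * gain"
proof -
  let ?T = "P - set cs"
  let ?S1 = "Sigma ?T (\<lambda>u. {lo u..<hi u - 1})"
  let ?F1 = "(\<lambda>(u, i). {u, cs ! i}) ` ?S1"
  let ?F2 = "{X \<in> antichains r ?T. card X = 2 \<and> card (span X) \<noteq> 1}"
  let ?S3 = "{(u, v). u \<in> ?T \<and> v \<in> ?T \<and> hi u = lo v + 1}"
  let ?F3 = "(\<lambda>(u, v). {u, v}) ` ?S3"
  have T: "finite ?T" using finite_P by simp
  have S3: "finite ?S3" by (rule finite_subset[of _ "?T \<times> ?T"]) (use T in auto)
  have F1: "{u, v} \<in> ?F1" if uv: "u \<in> ?T" "v \<in> set cs" "(u, v) \<notin> r" "(v, u) \<notin> r" for u v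
  proof -
    obtain i where i: "i < length cs" "v = cs ! i" using uv by (auto simp: in_set_conv_nth)
    then have "(u, i) \<in> ?S1"
      using uv less_lower_index_iff[OF i(1), of u] upper_index_le_iff[OF i(1), of u] by auto
    then have "(\<lambda>(u, i). {u, cs ! i}) (u, i) \<in> ?F1" by (rule imageI)
    then show ?thesis using i by simp
  qed
  have "incomparable_pairs P r \<subseteq> ?F1 \<union> (?F2 \<union> ?F3)"
  proof
    fix X assume "X \<in> incomparable_pairs P r"
    then obtain u v where X: "X = {u, v}" and uv: "u \<in> P" "v \<in> P" "(u, v) \<notin> r" "(v, u) \<notin> r"
      by (auto simp: incomparable_pairs_def)
    have "u \<noteq> v" using uv refl_P by auto
    show "X \<in> ?F1 \<union> (?F2 \<union> ?F3)"
    proof (cases "u \<in> set cs \<or> v \<in> set cs")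
      case True
      show ?thesis
      proof (cases "u \<in> set cs \<and> v \<in> set cs")
        case True
        then obtain i j where "i < length cs" "j < length cs" "u = cs ! i" "v = cs ! j"
          by (auto simp: in_set_conv_nth)
        then show ?thesis using uv chain_le[of i j] chain_le[of j i] by (cases "i \<le> j") auto
      next
        case False
        then have "{u, v} \<in> ?F1 \<or> {v, u} \<in> ?F1"
          using F1[of u v] F1[of v u] uv \<open>u \<in> set cs \<or> v \<in> set cs\<close> by blast
        then show ?thesis by (simp add: X insert_commute)
      qed
    next
      case False
      then have uv': "u \<in> ?T" "v \<in> ?T" using uv by auto
      show ?thesis
      proof (cases "hi u = lo v + 1 \<or> hi v = lo u + 1")
        case True
        then have "(u, v) \<in> ?S3 \<or> (v, u) \<in> ?S3" using uv' by auto
        then have "(\<lambda>(u, v). {u, v}) (u, v) \<in> ?F3 \<or> (\<lambda>(u, v). {u, v}) (v, u) \<in> ?F3"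
          by (metis (no_types, lifting) imageI)
        then show ?thesis by (simp add: X insert_commute)
      next
        case False
        then have lt: "lo u + 1 < hi v" "lo v + 1 < hi u" "lo u + 1 < hi u" "lo v + 1 < hi v"
          using incomparable_index_less[of u v] incomparable_index_less[of v u] uv
            level_between[OF uv'(1)] level_between[OF uv'(2)] by auto
        \<comment> \<open>The larger lower end and its successor are both below both upper
          ends.\<close>
        have "1 \<le> card (span X) - 1"
          unfolding X using uv lt by (intro card_span_ge[of _ "max (lo u) (lo v)"]) auto
        then have "X \<in> ?F2"
          using uv' uv \<open>u \<noteq> v\<close> by (auto simp: X antichains_def)
        then show ?thesis by simp
      qed
    qed
  qed
  then have "card (incomparable_pairs P r) \<le> card (?F1 \<union> (?F2 \<union> ?F3))"
    using T S3 by (intro card_mono) (auto simp: finite_antichains)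
  also have "\<dots> \<le> card ?F1 + (card ?F2 + card ?F3)"
    by (meson add_left_mono card_Un_le le_trans)
  also have "card ?F1 \<le> card ?S1" by (rule card_image_le) (use T in auto)
  also have "card ?S1 \<le> gain" using T gain_index by (simp add: card_SigmaI)
  also have "card ?F2 = (\<Sum>X\<in>?F2. 1)" by simp
  also have "\<dots> \<le> (\<Sum>X\<in>?F2. card (span X) - 1)"
  proof (intro sum_mono)
    fix X assume "X \<in> ?F2"
    then have "card (span X) \<noteq> 0" "card (span X) \<noteq> 1"
      using span_nonempty[of X] finite_span[of X] by auto
    then show "1 \<le> card (span X) - 1" by linarith
  qed
  also have "\<dots> \<le> gain" by (rule gain_ge) auto
  also have "card ?F3 \<le> card ?S3" by (rule card_image_le[OF S3])
  also have "card ?S3 \<le> 108 * gain" by (rule staggered_pairs)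
  finally show ?thesis by simp
qed

text \<open>113 = 110 + 3: besides the pairs, the summand 1, the chain and the elements off the
  chain each cost at most the gain. The summand 1 needs a nonempty chain.\<close>

lemma size_le_gain:
  assumes "P \<noteq> {}"
  shows "1 + card P + card (incomparable_pairs P r) \<le> 113 * gain"
proof -
  obtain u where "u \<in> P" using assms by auto
  then have "1 \<le> length cs" using level_pos[of u] level_le[of u] by simp
  moreover have "card P = card (P - set cs) + length cs"
    using set_chain finite_P distinct_chain
    by (metis List.finite_set add.commute card_Diff_subset card_mono distinct_card le_add_diff_inverse)
  ultimately show ?thesis
    using gain_length gain_card card_incomparable_pairs_le by linarith
qed

theorem potential_pays:
  assumes "P \<noteq> {}"
  shows "1 + card P + card (incomparable_pairs P r) + 113 * potential r P
    \<le> 113 * (\<Sum>i\<le>length cs. potential r (sub_poset r P cs i))"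
  using size_le_gain[OF assms] potential_gain by linarith

end

section \<open>Correctness of the recursion\<close>

context poset_chain
begin

text \<open>The members of the chain in an ideal form a prefix; its length is the index i of the
  branch that produces the ideal. What lies below c_i is then forced in, what lies above c_{i+1} is
  forced out, and P_i remains free.\<close>

lemma ideals_split:
  "ideals P r = (\<Union>i\<le>length cs. (\<union>) (down_part r P cs i) ` ideals (sub_poset r P cs i) r)"
proof (intro equalityI subsetI)
  fix J assume J: "J \<in> ideals P r"
  define i where "i = length (takeWhile (\<lambda>c. c \<in> J) cs)"
  have i: "i \<le> length cs" by (simp add: i_def length_takeWhile_le)
  have in_J: "cs ! j \<in> J" if "j < i" for j
    using that unfolding i_def by (metis nth_mem set_takeWhileD takeWhile_nth)
  have notin_J: "cs ! i \<notin> J" if "i < length cs"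
    using that unfolding i_def by (rule nth_length_takeWhile)
  have "u \<in> J" if u: "u \<in> P" "hi u \<le> i" for u
  proof -
    have j: "hi u - 1 < length cs" "hi u - 1 < i" using u i upper_index_bounds[of u] by auto
    then have "(u, cs ! (hi u - 1)) \<in> r" using upper_index_le_iff[OF j(1), of u] by linarith
    then show ?thesis using J in_J[OF j(2)] u by (auto simp: ideals_def)
  qed
  moreover have "lo u \<le> i" if u: "u \<in> J" for u
  proof (rule ccontr)
    assume "\<not> lo u \<le> i"
    then have j: "i < length cs" "i < lo u" using lower_index_le[of u] by auto
    then have "(cs ! i, u) \<in> r" using less_lower_index_iff by simp
    then show False using J u notin_J[OF j(1)] chain_mem[OF j(1)] by (auto simp: ideals_def)
  qed
  moreover have "J \<subseteq> P" using J by (simp add: ideals_def)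
  ultimately have "J = down_part r P cs i \<union> (J \<inter> sub_poset r P cs i)"
    using i by (auto simp: down_part_iff sub_poset_iff not_le)
  moreover have "J \<inter> sub_poset r P cs i \<in> ideals (sub_poset r P cs i) r"
    using J by (auto simp: ideals_def sub_poset_def)
  ultimately have "J \<in> (\<union>) (down_part r P cs i) ` ideals (sub_poset r P cs i) r" by (rule image_eqI)
  with i show "J \<in> (\<Union>i\<le>length cs. (\<union>) (down_part r P cs i) ` ideals (sub_poset r P cs i) r)" by blast
next
  fix J assume "J \<in> (\<Union>i\<le>length cs. (\<union>) (down_part r P cs i) ` ideals (sub_poset r P cs i) r)"
  then obtain i J' where i: "i \<le> length cs" and J': "J' \<in> ideals (sub_poset r P cs i) r"
    and J: "J = down_part r P cs i \<union> J'" by auto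
  have "v \<in> J" if uv: "u \<in> J" "v \<in> P" "(v, u) \<in> r" for u v
  proof (cases "u \<in> down_part r P cs i")
    case True
    then have u: "hi u \<le> i" "1 \<le> i" using i upper_index_bounds[of u] by (auto simp: down_part_iff)
    then have k: "i - 1 < length cs" using i by simp
    have "(u, cs ! (i - 1)) \<in> r" using upper_index_le_iff[OF k, of u] u by simp
    then have "(v, cs ! (i - 1)) \<in> r" using uv trans_r by (meson transD)
    then have "hi v \<le> i" using upper_index_le_iff[OF k, of v] u by simp
    then show ?thesis using uv i by (simp add: J down_part_iff)
  next
    case False
    then have u: "u \<in> J'" using uv J by simp
    then have "lo u \<le> i" using J' i by (auto simp: ideals_def sub_poset_iff)
    then have "lo v \<le> i"
      using less_lower_index_iff[of i u] less_lower_index_iff[of i v] lower_index_le[of v] uv trans_r i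
      by (metis leI le_less_trans not_less_iff_gr_or_eq order_le_less transD)
    then show ?thesis
    proof (cases "hi v \<le> i")
      case True then show ?thesis using uv i by (simp add: J down_part_iff)
    next
      case False
      then have "v \<in> sub_poset r P cs i" using \<open>lo v \<le> i\<close> uv i by (simp add: sub_poset_iff)
      then show ?thesis using J' u uv by (auto simp: J ideals_def)
    qed
  qed
  moreover have "J \<subseteq> P" using J J' by (auto simp: ideals_def down_part_def sub_poset_def)
  ultimately show "J \<in> ideals P r" by (auto simp: ideals_def)
qed

text \<open>The index i can be read off from the ideal, so different branches have disjoint
  outputs.\<close>

lemma chain_mem_split:
  assumes "J \<in> (\<union>) (down_part r P cs i) ` ideals (sub_poset r P cs i) r" "i \<le> length cs" "j < length cs"
  shows "cs ! j \<in> J \<longleftrightarrow> j < i"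
proof -
  obtain J' where J': "J' \<subseteq> sub_poset r P cs i" and J: "J = down_part r P cs i \<union> J'"
    using assms by (auto simp: ideals_def)
  have "cs ! j \<notin> J'" using J' sub_poset_subset[OF assms(2)] assms(3) by auto
  then show ?thesis using assms by (auto simp: J down_part_iff index_chain chain_mem)
qed

end

lemma distinct_concat_nth:
  assumes "\<And>i. i < length xss \<Longrightarrow> distinct (xss ! i)"
    and "\<And>i j. i < j \<Longrightarrow> j < length xss \<Longrightarrow> set (xss ! i) \<inter> set (xss ! j) = {}"
  shows "distinct (concat xss)"
  using assms
proof (induction xss)
  case (Cons xs xss)
  have "distinct (concat xss)"
    using Cons.prems(1)[of "Suc i" for i] Cons.prems(2)[of "Suc i" "Suc j" for i j]
    by (intro Cons.IH) auto
  moreover have "set xs \<inter> set ys = {}" if "ys \<in> set xss" for ys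
    using that Cons.prems(2)[of 0 "Suc j" for j] by (fastforce simp: in_set_conv_nth)
  ultimately show ?case using Cons.prems(1)[of 0] by auto
qed simp

text \<open>For i < j, the element \<open>cs ! i\<close> is missing from all outputs of branch i and
  present in all outputs of branch j. The disjointness of I and P ensures that I does not contribute
  this element.\<close>

lemma enumerates_ideals:
  assumes "enumerates r P I Js" "finite_poset r P" "I \<inter> P = {}"
  shows "distinct Js \<and> set Js = (\<union>) I ` ideals P r"
  using assms
proof (induction rule: enumerates.induct)
  case (visit I)
  have "ideals {} r = {{}}" by (auto simp: ideals_def)
  then show ?case by simp
next
  case (branch P cs Jss I)
  interpret finite_poset r P by fact
  interpret poset_chain r P cs
    using branch.hyps by unfold_locales (simp add: longest_chain_def)
  let ?S = "\<lambda>i. (\<union>) (down_part r P cs i) ` ideals (sub_poset r P cs i) r"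
  have IH: "distinct (Jss ! i)" "set (Jss ! i) = (\<union>) I ` ?S i" if i: "i \<le> length cs" for i
  proof -
    have "(I \<union> down_part r P cs i) \<inter> sub_poset r P cs i = {}"
      using branch.prems(2) by (auto simp: down_part_def sub_poset_def)
    then have *: "distinct (Jss ! i) \<and>
        set (Jss ! i) = (\<union>) (I \<union> down_part r P cs i) ` ideals (sub_poset r P cs i) r"
      using branch.IH[OF i] finite_poset_subset[of "sub_poset r P cs i"] by (auto simp: sub_poset_def)
    then show "distinct (Jss ! i)" by simp
    show "set (Jss ! i) = (\<union>) I ` ?S i" using * by (simp add: image_image Un_assoc)
  qed
  have "set (Jss ! i) \<inter> set (Jss ! j) = {}" if ij: "i < j" "j < length Jss" for i j
  proof -
    have "i < length cs" using ij branch.hyps by simp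
    then have "cs ! i \<notin> J" if "J \<in> set (Jss ! i)" for J
      using that IH(2)[of i] chain_mem_split[of _ i i] chain_mem[of i] branch.prems by auto
    moreover have "cs ! i \<in> J" if "J \<in> set (Jss ! j)" for J
      using that IH(2)[of j] chain_mem_split[of _ j i] ij branch.hyps by auto
    ultimately show ?thesis by blast
  qed
  then have "distinct (concat Jss)"
    using IH(1) branch.hyps by (intro distinct_concat_nth) auto
  moreover have "set Jss = (!) Jss ` {..length cs}"
    using branch.hyps by (auto simp: set_conv_nth less_Suc_eq_le)
  then have "set (concat Jss) = (\<Union>i\<le>length cs. set (Jss ! i))" by simp
  ultimately show ?case using IH(2) by (auto simp: ideals_split)
qed

section \<open>Relabeling\<close>

lemma below_chain_relabel: "below_chain r (map g cs) i (g u) \<longleftrightarrow> below_chain (inv_image r g) cs i u"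
  by (auto simp: below_chain_def)

lemma above_chain_relabel: "above_chain r (map g cs) i (g u) \<longleftrightarrow> above_chain (inv_image r g) cs i u"
  by (auto simp: above_chain_def)

lemma sub_poset_relabel: "sub_poset r (g ` P) (map g cs) i = g ` sub_poset (inv_image r g) P cs i"
  by (auto simp: sub_poset_def below_chain_relabel above_chain_relabel)

lemma down_part_relabel: "down_part r (g ` P) (map g cs) i = g ` down_part (inv_image r g) P cs i"
  by (auto simp: down_part_def below_chain_relabel)

lemma chain_in_relabel:
  assumes "inj_on g P" "set cs \<subseteq> P"
  shows "chain_in r (g ` P) (map g cs) \<longleftrightarrow> chain_in (inv_image r g) P cs"
proof -
  have "sorted_wrt (\<lambda>u v. (g u, g v) \<in> r \<and> g u \<noteq> g v) cs
      \<longleftrightarrow> sorted_wrt (\<lambda>u v. (g u, g v) \<in> r \<and> u \<noteq> v) cs"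
    using assms inj_on_eq_iff[OF assms(1)] by (simp add: sorted_wrt_iff_nth_less subset_iff)
  then show ?thesis using assms by (auto simp: chain_in_def sorted_wrt_map)
qed

text \<open>The machine finds a chain for the new names, while the specification speaks of the old
  ones. A longer chain of old names would pull back along the inverse of g.\<close>

lemma longest_chain_relabel:
  assumes "inj_on g P" "longest_chain (inv_image r g) P cs"
  shows "longest_chain r (g ` P) (map g cs)"
proof -
  have "length ds \<le> length cs" if ds: "chain_in r (g ` P) ds" for ds
  proof -
    define es where "es = map (inv_into P g) ds"
    have *: "set ds \<subseteq> g ` P" using ds by (simp add: chain_in_def)
    then have "ds = map g es" unfolding es_def by (auto simp: f_inv_into_f subset_iff intro!: nth_equalityI)
    moreover have "set es \<subseteq> P" using * unfolding es_def by (auto intro: inv_into_into)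
    ultimately show ?thesis
      using ds assms chain_in_relabel[of g P es r] by (simp add: longest_chain_def)
  qed
  moreover have "chain_in r (g ` P) (map g cs)"
    using assms chain_in_relabel[of g P cs r] by (simp add: longest_chain_def chain_in_def)
  ultimately show ?thesis by (simp add: longest_chain_def)
qed

lemma card_incomparable_pairs_relabel:
  assumes "inj_on g P"
  shows "card (incomparable_pairs P (inv_image r g)) = card (incomparable_pairs (g ` P) r)"
proof -
  have "incomparable_pairs (g ` P) r = (`) g ` incomparable_pairs P (inv_image r g)"
  proof (intro equalityI subsetI)
    fix X assume "X \<in> incomparable_pairs (g ` P) r"
    then obtain u v where "X = g ` {u, v}" "{u, v} \<in> incomparable_pairs P (inv_image r g)"
      by (auto simp: incomparable_pairs_def)
    then show "X \<in> (`) g ` incomparable_pairs P (inv_image r g)" by (rule image_eqI)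
  qed (auto simp: incomparable_pairs_def)
  moreover have "inj_on ((`) g) (incomparable_pairs P (inv_image r g))"
    by (rule inj_on_subset[OF inj_on_image_Pow[OF assms]]) (auto simp: incomparable_pairs_def)
  ultimately show ?thesis by (simp add: card_image)
qed

section \<open>Weakest preconditions\<close>

lemma machine_sel_tick [simp]:
  "regs (tick k s) = regs s" "mem (tick k s) = mem s" "clock (tick k s) = clock s + k"
  "visited (tick k s) = visited s" "depth (tick k s) = depth s" "peak (tick k s) = peak s"
  by (simp_all add: tick_def)

lemma machine_sel_set_reg [simp]:
  "regs (set_reg x v s) = (regs s)(x := v)" "mem (set_reg x v s) = mem s"
  "clock (set_reg x v s) = clock s" "visited (set_reg x v s) = visited s"
  "depth (set_reg x v s) = depth s" "peak (set_reg x v s) = peak s"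
  by (simp_all add: set_reg_def)

lemma machine_sel_set_array [simp]:
  "regs (set_array a xs s) = regs s" "mem (set_array a xs s) = (mem s)(a := xs)"
  "clock (set_array a xs s) = clock s" "visited (set_array a xs s) = visited s"
  "depth (set_array a xs s) = depth s" "peak (set_array a xs s) = peak s"
  by (simp_all add: set_array_def)

lemma machine_sel_record_space [simp]:
  "regs (record_space s) = regs s" "mem (record_space s) = mem s"
  "clock (record_space s) = clock s" "visited (record_space s) = visited s"
  "depth (record_space s) = depth s" "peak (record_space s) = max (peak s) (space s)"
  by (simp_all add: record_space_def)

lemma machine_sel_output_set [simp]:
  "regs (output_set J s) = regs s" "mem (output_set J s) = mem s" "clock (output_set J s) = clock s"
  "visited (output_set J s) = visited s @ [(clock s, J)]"
  "depth (output_set J s) = depth s" "peak (output_set J s) = peak s"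
  by (simp_all add: output_set_def)

lemma machine_sel_leave_call [simp]:
  "regs (leave_call s t) = regs s" "mem (leave_call s t) = mem t" "clock (leave_call s t) = clock t"
  "visited (leave_call s t) = visited t" "depth (leave_call s t) = depth s" "peak (leave_call s t) = peak t"
  by (simp_all add: leave_call_def)

text \<open>The existential quantifier makes this total correctness: it asserts that a terminating
  run exists, and by determinism of \<open>exec\<close> there is no other outcome.\<close>

definition wp :: "('r::finite, 'a::finite) com \<Rightarrow> ('r, 'a) com \<Rightarrow> (('r, 'a) machine \<Rightarrow> bool) \<Rightarrow>
    ('r, 'a) machine \<Rightarrow> bool" where
  "wp B c Q s \<longleftrightarrow> (\<exists>t. exec B c s t \<and> Q t)"

lemma wp_Skip [simp]: "wp B Skip Q s \<longleftrightarrow> Q (tick 1 s)"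
  unfolding wp_def by (metis exec.Skip exec_SkipE One_nat_def)

lemma wp_Assign [simp]: "wp B (x ::= e) Q s \<longleftrightarrow> Q (tick (1 + acost e) (set_reg x (aval e (regs s)) s))"
  unfolding wp_def using exec.Assign[of B x e s] by (auto elim: exec_AssignE)

lemma wp_Load [simp]: "wp B (x ::= a\<lbrakk>e\<rbrakk>) Q s \<longleftrightarrow> aval e (regs s) < length (mem s a) \<and>
    Q (tick (1 + acost e) (set_reg x (mem s a ! aval e (regs s)) s))"
  unfolding wp_def using exec.Load[of e s a B x] by (auto elim: exec_LoadE)

lemma wp_Store [simp]: "wp B (a\<lbrakk>e\<rbrakk> ::= f) Q s \<longleftrightarrow> aval e (regs s) < length (mem s a) \<and>
    Q (tick (1 + acost e + acost f) (set_array a ((mem s a)[aval e (regs s) := aval f (regs s)]) s))"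
  unfolding wp_def using exec.Store[of e s a B f] by (auto elim: exec_StoreE)

lemma wp_Alloc [simp]: "wp B (Alloc a e) Q s \<longleftrightarrow>
    Q (record_space (tick (1 + acost e + aval e (regs s)) (set_array a (replicate (aval e (regs s)) 0) s)))"
  unfolding wp_def using exec.Alloc[of B a e s] by (auto elim: exec_AllocE)

lemma wp_Visit [simp]: "wp B (Visit a e) Q s \<longleftrightarrow> aval e (regs s) \<le> length (mem s a) \<and>
    Q (output_set (set (take (aval e (regs s)) (mem s a))) (tick (1 + acost e) s))"
  unfolding wp_def using exec.Visit[of e s a B] by (auto elim: exec_VisitE)

lemma wp_Seq [simp]: "wp B (c1 ;; c2) Q s \<longleftrightarrow> wp B c1 (wp B c2 Q) s"
  unfolding wp_def by (metis exec.Seq exec_SeqE)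

lemma wp_Cond [simp]: "wp B (IF b THEN c1 ELSE c2) Q s \<longleftrightarrow>
    (bval b (regs s) \<longrightarrow> wp B c1 Q (tick (1 + bcost b) s)) \<and>
    (\<not> bval b (regs s) \<longrightarrow> wp B c2 Q (tick (1 + bcost b) s))"
  unfolding wp_def using exec.IfTrue[of b s B c1] exec.IfFalse[of b s B c2] by (fastforce elim: exec_IfE)

lemma wp_Call: "wp B (Call args) Q s \<longleftrightarrow> wp B B (\<lambda>t. Q (leave_call s t))
    (enter_call args (tick (1 + 2 * card (UNIV :: 'r set) + sum_list (map (\<lambda>(x, e). acost e) args)) s))"
  for B :: "('r::finite, 'a::finite) com"
  unfolding wp_def using exec.Call[of B args s] by (auto elim: exec_CallE)

lemma wp_mono: "wp B c Q s \<Longrightarrow> (\<And>t. Q t \<Longrightarrow> R t) \<Longrightarrow> wp B c R s"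
  by (auto simp: wp_def)

text \<open>The invariant carries the variant as its index, so ghost data and termination measure
  can be chosen together, depending on the state.\<close>

lemma wp_While:
  fixes I :: "nat \<Rightarrow> ('r::finite, 'a::finite) machine \<Rightarrow> bool"
  assumes "I m s"
    and step: "\<And>m t. I m t \<Longrightarrow> bval b (regs t) \<Longrightarrow> wp B c (\<lambda>u. \<exists>m'<m. I m' u) (tick (1 + bcost b) t)"
    and post: "\<And>m t. I m t \<Longrightarrow> \<not> bval b (regs t) \<Longrightarrow> Q (tick (1 + bcost b) t)"
  shows "wp B (WHILE b DO c) Q s"
  using assms(1)
proof (induction m arbitrary: s rule: less_induct)
  case (less m)
  show ?case
  proof (cases "bval b (regs s)")
    case True
    then obtain t m' where t: "exec B c (tick (1 + bcost b) s) t" "m' < m" "I m' t"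
      using step[OF less.prems] unfolding wp_def by blast
    then obtain u where "exec B (WHILE b DO c) t u" "Q u"
      using less.IH unfolding wp_def by blast
    then show ?thesis using exec.WhileTrue[OF True t(1)] unfolding wp_def by blast
  next
    case False
    then show ?thesis using post[OF less.prems] exec.WhileFalse by (force simp: wp_def)
  qed
qed

text \<open>The ticks are exact: 2 for the initial assignment, \<open>3 + acost e\<close> for each
  test, 4 for the increment. The bound e is evaluated anew in every test, hence the condition that
  the invariant fixes its value.\<close>

lemma wp_for:
  fixes I :: "nat \<Rightarrow> (register, array) machine \<Rightarrow> bool"
  assumes "I 0 (tick 2 (set_reg x 0 s))"
    and range: "\<And>i t. I i t \<Longrightarrow> i \<le> m \<and> regs t x = i \<and> aval e (regs t) = m"
    and step: "\<And>i t. I i t \<Longrightarrow> i < m \<Longrightarrow>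
      wp B c (\<lambda>u. regs u x = i \<and> I (Suc i) (tick 4 (set_reg x (Suc i) u))) (tick (3 + acost e) t)"
    and post: "\<And>t. I m t \<Longrightarrow> Q (tick (3 + acost e) t)"
  shows "wp B (FOR x < e DO c) Q s"
proof -
  have "wp B (WHILE V x \<lhd> e DO (c ;; x ::= V x \<oplus> N 1)) Q (tick 2 (set_reg x 0 s))"
  proof (rule wp_While[where I = "\<lambda>k t. \<exists>i. I i t \<and> k = m - i"])
    show "\<exists>i. I i (tick 2 (set_reg x 0 s)) \<and> m = m - i" using assms(1) by (intro exI[of _ 0]) simp
  next
    fix k t assume "\<exists>i. I i t \<and> k = m - i" and b: "bval (V x \<lhd> e) (regs t)"
    then obtain i where i: "I i t" "k = m - i" by auto
    then have "i < m" using range[OF i(1)] b by simp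
    show "wp B (c ;; x ::= V x \<oplus> N 1) (\<lambda>u. \<exists>m'<k. \<exists>i. I i u \<and> m' = m - i) (tick (1 + bcost (V x \<lhd> e)) t)"
      unfolding wp_Seq
    proof (rule wp_mono)
      show "wp B c (\<lambda>u. regs u x = i \<and> I (Suc i) (tick 4 (set_reg x (Suc i) u))) (tick (1 + bcost (V x \<lhd> e)) t)"
        using step[OF i(1) \<open>i < m\<close>] by (simp add: numeral_3_eq_3)
    next
      fix u assume "regs u x = i \<and> I (Suc i) (tick 4 (set_reg x (Suc i) u))"
      then have "I (Suc i) (tick (1 + acost (V x \<oplus> N 1)) (set_reg x (aval (V x \<oplus> N 1) (regs u)) u))"
        by (simp add: eval_nat_numeral)
      then show "wp B (x ::= V x \<oplus> N 1) (\<lambda>u. \<exists>m'<k. \<exists>i. I i u \<and> m' = m - i) u"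
        unfolding wp_Assign using \<open>i < m\<close> i(2) by (intro exI[of _ "m - Suc i"] conjI exI[of _ "Suc i"]) auto
    qed
  next
    fix k t assume "\<exists>i. I i t \<and> k = m - i" and b: "\<not> bval (V x \<lhd> e) (regs t)"
    then obtain i where i: "I i t" "k = m - i" by auto
    then have "i = m" using range[OF i(1)] b by simp
    then show "Q (tick (1 + bcost (V x \<lhd> e)) t)" using post i by (simp add: numeral_3_eq_3)
  qed
  then show ?thesis by (simp add: for_upto_def numeral_2_eq_2)
qed

section \<open>Framing: what a phase of the program leaves untouched\<close>

definition frame :: "'r set \<Rightarrow> 'a set \<Rightarrow> ('r, 'a) machine \<Rightarrow> ('r, 'a) machine \<Rightarrow> bool" where
  "frame X A s t \<longleftrightarrow> (\<forall>x. x \<notin> X \<longrightarrow> regs t x = regs s x) \<and> (\<forall>a. a \<notin> A \<longrightarrow> mem t a = mem s a)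
     \<and> (\<forall>a. length (mem t a) = length (mem s a))
     \<and> visited t = visited s \<and> depth t = depth s \<and> peak t = peak s"

lemma frame_refl [simp]: "frame X A s s"
  by (simp add: frame_def)

lemma frame_tick [simp]: "frame X A s (tick k t) \<longleftrightarrow> frame X A s t"
  by (simp add: frame_def)

lemma frame_set_reg [simp]: "frame X A s t \<Longrightarrow> x \<in> X \<Longrightarrow> frame X A s (set_reg x v t)"
  by (auto simp: frame_def)

lemma frame_set_array [simp]:
  "frame X A s t \<Longrightarrow> a \<in> A \<Longrightarrow> length xs = length (mem t a) \<Longrightarrow> frame X A s (set_array a xs t)"
  by (auto simp: frame_def)

lemma frame_tick_left [simp]: "frame X A (tick k s) t \<longleftrightarrow> frame X A s t"
  by (simp add: frame_def)

lemma frame_trans: "frame X A s t \<Longrightarrow> frame Y B t u \<Longrightarrow> X \<subseteq> Z \<Longrightarrow> Y \<subseteq> Z \<Longrightarrow> A \<subseteq> C \<Longrightarrow> B \<subseteq> C \<Longrightarrow>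
    frame Z C s u"
  unfolding frame_def by (metis (no_types, lifting) in_mono)

lemma frame_mono: "frame X A s t \<Longrightarrow> X \<subseteq> Z \<Longrightarrow> A \<subseteq> C \<Longrightarrow> frame Z C s t"
  by (auto simp: frame_def)

section \<open>Linked lists\<close>

primrec linked :: "(nat \<Rightarrow> nat) \<Rightarrow> nat \<Rightarrow> nat \<Rightarrow> nat list \<Rightarrow> bool" where
  "linked nx e h [] \<longleftrightarrow> h = e"
| "linked nx e h (x # xs) \<longleftrightarrow> h = x \<and> linked nx e (nx x) xs"

lemma linked_cong: "(\<And>x. x \<in> set xs \<Longrightarrow> nx x = nx' x) \<Longrightarrow> linked nx e h xs = linked nx' e h xs"
  by (induction xs arbitrary: h) auto

section \<open>The state of a procedure call\<close>

text \<open>A child poset lacks at least one chain element, so nested calls, including the one on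
  the empty poset, occupy at most n + 1 frames.\<close>

definition frame_space :: "nat \<Rightarrow> nat" where
  "frame_space n = (n + 1) * (n + 2)"

fun array_length :: "nat \<Rightarrow> array \<Rightarrow> nat" where
  "array_length n Matrix = n * n"
| "array_length n Count = n"
| "array_length n Label = n"
| "array_length n Leq = n * n"
| "array_length n Elems = frame_space n"
| "array_length n Chain = frame_space n"
| "array_length n Upper = frame_space n"
| "array_length n Bucket = frame_space n"
| "array_length n BucketNext = frame_space n"
| "array_length n Level = n + 1"
| "array_length n LevelNext = n"
| "array_length n Pred = n"
| "array_length n Temp = n"
| "array_length n Ideal = n"

lemma matrix_index_less: "u < n \<Longrightarrow> v < n \<Longrightarrow> u * n + v < n * (n::nat)"
proof -
  assume "u < n" "v < n"
  then have "u * n + v < Suc u * n" "Suc u * n \<le> n * n" by (simp, intro mult_le_mono) auto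
  then show ?thesis by linarith
qed

text \<open>\<open>le\<close> is the order after the relabeling, of which the order of the names is a linear extension.\<close>

locale relabeled_poset =
  fixes n :: nat and r :: "nat rel" and L :: "nat list"
  fixes le :: "nat rel"
  defines "le \<equiv> inv_image r ((!) L)"
  assumes poset: "finite_poset le {..<n}"
    and extension: "u < n \<Longrightarrow> v < n \<Longrightarrow> (u, v) \<in> le \<Longrightarrow> u \<le> v"
    and inj_label: "inj_on ((!) L) {..<n}"
begin

definition ready :: "(register, array) machine \<Rightarrow> bool" where
  "ready s \<longleftrightarrow> (\<forall>a. length (mem s a) = array_length n a) \<and> regs s rn = n \<and> regs s rw = n + 2
     \<and> mem s Label = L \<and> (\<forall>u<n. \<forall>v<n. mem s Leq ! (u * n + v) = of_bool ((u, v) \<in> le))"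

lemma readyD:
  assumes "ready s"
  shows "length (mem s a) = array_length n a" "regs s rn = n" "regs s rw = n + 2" "mem s Label = L"
    "u < n \<Longrightarrow> v < n \<Longrightarrow> mem s Leq ! (u * n + v) = of_bool ((u, v) \<in> le)"
  using assms by (auto simp: ready_def)

lemma ready_frame:
  "ready s \<Longrightarrow> frame X A s t \<Longrightarrow> X \<inter> {rn, rw} = {} \<Longrightarrow> A \<inter> {Label, Leq} = {} \<Longrightarrow> ready t"
  by (auto simp: ready_def frame_def disjoint_iff)

definition node :: "nat \<Rightarrow> nat list \<Rightarrow> (register, array) machine \<Rightarrow> bool" where
  "node fp es s \<longleftrightarrow> ready s \<and> regs s rfp = fp \<and> regs s rm = length es \<and> (\<forall>t<length es. mem s Elems ! (fp + t) = es ! t)"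

end

text \<open>The elements \<open>es\<close> of a poset, which are stored in the frame at \<open>fp\<close>.\<close>

locale node_data = relabeled_poset +
  fixes fp :: nat and es :: "nat list"
  assumes sorted_es: "sorted_wrt (<) es"
    and es_less: "u \<in> set es \<Longrightarrow> u < n"
    and room: "fp + (length es + 1) * (n + 2) \<le> frame_space n"
begin

lemma distinct_es: "distinct es"
  using sorted_es by (simp add: strict_sorted_iff)

lemma nth_es_less: "t < length es \<Longrightarrow> es ! t < n"
  by (simp add: es_less)

lemma length_es_le: "length es \<le> n"
proof -
  have "(length es + 1) * (n + 2) \<le> (n + 1) * (n + 2)" using room unfolding frame_space_def by linarith
  then show ?thesis unfolding mult_le_cancel2 by simp
qed

text \<open>A poset of size m owns m + 1 frames from \<open>fp\<close> on: the current one and, if m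
  > 0, at least the one handed to a child.\<close>

lemma room1: "i < n + 2 \<Longrightarrow> fp + i < frame_space n"
  using room by (simp add: algebra_simps)

lemma room2: "i < n + 2 \<Longrightarrow> es \<noteq> [] \<Longrightarrow> fp + (n + 2) + i < frame_space n"
  using room by (cases es) (simp_all add: algebra_simps)

lemma finite_poset_es: "finite_poset le (set es)"
  using finite_poset.finite_poset_subset[OF poset] es_less by auto

text \<open>The largest possible number of unsuccessful comparisons when element t is put on a
  level; summed over t it is bounded by the number of incomparable pairs.\<close>

definition skipped :: "nat \<Rightarrow> nat" where
  "skipped t = card {v \<in> set (take t es). (v, es ! t) \<notin> le}"

end

section \<open>The antichain decomposition\<close>

context node_data
begin

text \<open>\<open>lv\<close>, \<open>nx\<close> and \<open>pr\<close> are the contents of \<open>Level\<close>, \<open>LevelNext\<close> and \<open>Pred\<close>.\<close>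

definition levels :: "nat list \<Rightarrow> nat \<Rightarrow> (nat \<Rightarrow> nat) \<Rightarrow> nat list \<Rightarrow> nat list \<Rightarrow> nat list \<Rightarrow> bool" where
  "levels ps h f lv nx pr \<longleftrightarrow>
     (\<forall>u\<in>set ps. 1 \<le> f u \<and> f u \<le> h) \<and> {1..h} \<subseteq> f ` set ps \<and>
     (\<forall>j. 1 \<le> j \<longrightarrow> j \<le> h \<longrightarrow> linked ((!) nx) n (lv ! j) (rev (filter (\<lambda>u. f u = j) ps))) \<and>
     (\<forall>u\<in>set ps. 2 \<le> f u \<longrightarrow> pr ! u \<in> set ps \<and> Suc (f (pr ! u)) = f u \<and> (pr ! u, u) \<in> le) \<and>
     (\<forall>u\<in>set ps. \<forall>v\<in>set ps. (u, v) \<in> le \<longrightarrow> u \<noteq> v \<longrightarrow> f u < f v)"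

definition predecessor_step :: "(register, array) com" where
  "predecessor_step =
     IF V rv \<doteq> V rn
     THEN (rj ::= V rj \<ominus> N 1 ;; rv ::= Level\<lbrakk>V rj\<rbrakk>)
     ELSE (
       rx ::= Leq\<lbrakk>V rv \<otimes> V rn \<oplus> V ru\<rbrakk> ;;
       IF V rx \<doteq> N 0 THEN rv ::= LevelNext\<lbrakk>V rv\<rbrakk> ELSE Skip)"

definition insert_level :: "(register, array) com" where
  "insert_level =
     Pred\<lbrakk>V ru\<rbrakk> ::= V rv ;;
     IF V rj \<doteq> V rh
     THEN (rh ::= V rh \<oplus> N 1 ;; Level\<lbrakk>V rh\<rbrakk> ::= V rn)
     ELSE Skip ;;
     rx ::= Level\<lbrakk>V rj \<oplus> N 1\<rbrakk> ;;
     LevelNext\<lbrakk>V ru\<rbrakk> ::= V rx ;;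
     Level\<lbrakk>V rj \<oplus> N 1\<rbrakk> ::= V ru"

definition antichain_step :: "(register, array) com" where
  "antichain_step =
     ru ::= Elems\<lbrakk>V rfp \<oplus> V rt\<rbrakk> ;;
     rj ::= V rh ;;
     rv ::= Level\<lbrakk>V rj\<rbrakk> ;;
     rx ::= N 0 ;;
     (WHILE V rx \<doteq> N 0 AND N 0 \<lhd> V rj DO predecessor_step) ;;
     insert_level"

lemma antichain_decomposition_eq:
  "antichain_decomposition = (rh ::= N 0 ;; FOR rt < V rm DO antichain_step)"
  by (simp add: antichain_decomposition_def antichain_step_def insert_level_def predecessor_step_def)

text \<open>An iteration either rejects an element not below u or moves to the next lower level.
  Level changes are as cheap as rejections: every level passed is nonempty and consists of rejected
  elements, whence the factor 2 in front of \<open>skipped t\<close>.\<close>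

lemma predecessor_search:
  assumes s: "ready s" and t: "t < length es" and ps: "ps = take t es" and u: "u = es ! t"
    and levels: "levels ps h f (mem s Level) (mem s LevelNext) pr" and h: "h \<le> t"
    and regs: "regs s ru = u" "regs s rj = h" "regs s rv = mem s Level ! h" "regs s rx = 0"
  shows "wp B (WHILE V rx \<doteq> N 0 AND N 0 \<lhd> V rj DO predecessor_step) (\<lambda>z. frame {rj, rv, rx} {} s z \<and> regs z rj \<le> h \<and>
      (\<forall>w\<in>set ps. regs z rj < f w \<longrightarrow> (w, u) \<notin> le) \<and>
      (0 < regs z rj \<longrightarrow> regs z rv \<in> set ps \<and> f (regs z rv) = regs z rj \<and> (regs z rv, u) \<in> le) \<and>
      clock z \<le> clock s + 50 * (2 + 2 * skipped t)) s" (is "wp B _ ?Q s")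
proof -
  note lev = levels[unfolded levels_def]
  let ?b = "V rx \<doteq> N 0 AND N 0 \<lhd> V rj :: register bexp"
  let ?L = "\<lambda>j. rev (filter (\<lambda>u. f u = j) ps)"
  let ?hi = "\<lambda>j. {w \<in> set ps. j < f w}"
  \<comment> \<open>\<open>J\<close> is the state during the search, with ys the rejected and xs the
    remaining part of the current level; \<open>K\<close> is the state after success. The variant
    weights a level with n + 2, more than the length of any list. No list is claimed for level 0,
    whose head is read but has no meaning.\<close>
  define J where "J m z ys xs \<longleftrightarrow> frame {rj, rv, rx} {} s z \<and> regs z rj \<le> h \<and> regs z rx = 0 \<and>
      (\<forall>w\<in>?hi (regs z rj). (w, u) \<notin> le) \<and> ?L (regs z rj) = ys @ xs \<and>
      (0 < regs z rj \<longrightarrow> linked ((!) (mem s LevelNext)) n (regs z rv) xs) \<and>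
      (\<forall>w\<in>set ys. (w, u) \<notin> le) \<and> m = 1 + regs z rj * (n + 2) + length xs \<and>
      clock z \<le> clock s + 50 * (card (?hi (regs z rj)) + length ys + (h - regs z rj))" for m :: nat and z ys xs
  define K where "K m z \<longleftrightarrow> frame {rj, rv, rx} {} s z \<and> regs z rj \<le> h \<and> regs z rx \<noteq> 0 \<and>
      (\<forall>w\<in>?hi (regs z rj). (w, u) \<notin> le) \<and> 0 < regs z rj \<and> regs z rv \<in> set ps \<and>
      f (regs z rv) = regs z rj \<and> (regs z rv, u) \<in> le \<and> m = 0 \<and>
      clock z \<le> clock s + 50 * (1 + 2 * skipped t)" for m :: nat and z
  define I where "I m z \<longleftrightarrow> (\<exists>ys xs. J m z ys xs) \<or> K m z" for m z
  have ps_less: "w < n" if "w \<in> set ps" for w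
    using that es_less by (auto simp: ps dest: in_set_takeD)
  have dist: "distinct ps" using distinct_es by (simp add: ps)
  have len: "length ps \<le> n" using length_es_le t by (simp add: ps)
  have un: "u < n" using nth_es_less[OF t] by (simp add: u)
  \<comment> \<open>Levels above j are nonempty, so there are no more of them than rejected elements
    above level j.\<close>
  have upper_levels: "h - j \<le> card (?hi j)" for j
  proof -
    have "{Suc j..h} \<subseteq> f ` ?hi j"
    proof
      fix i assume i: "i \<in> {Suc j..h}"
      then have "i \<in> {1..h}" by simp
      then have "i \<in> f ` set ps" using lev by blast
      with i show "i \<in> f ` ?hi j" by auto
    qed
    then have "card {Suc j..h} \<le> card (?hi j)" by (intro surj_card_le) auto
    then show ?thesis by simp
  qed
  have skip_bound: "card (?hi j) + length ys \<le> skipped t"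
    if "?L j = ys @ xs" "\<forall>w\<in>?hi j. (w, u) \<notin> le" "\<forall>w\<in>set ys. (w, u) \<notin> le" for j ys xs
  proof -
    have "distinct (ys @ xs)" using dist by (simp flip: that(1))
    then have "length ys = card (set ys)" by (simp add: distinct_card)
    have ys: "set ys \<subseteq> {w \<in> set ps. f w = j}" using arg_cong[OF that(1), of set] by auto
    then have "card (?hi j) + card (set ys) = card (?hi j \<union> set ys)"
      by (intro card_Un_disjoint[symmetric]) auto
    also have "\<dots> \<le> skipped t"
      unfolding skipped_def using ys that by (intro card_mono) (auto simp: ps u)
    finally show ?thesis using \<open>length ys = card (set ys)\<close> by simp
  qed
  show ?thesis
  proof (rule wp_While[where I = I])
    show "I (1 + h * (n + 2) + length (?L h)) s"
      unfolding I_def J_def using regs lev by (intro disjI1 exI[of _ "[]"] exI[of _ "?L h"]) auto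
  next
    fix m z assume I: "I m z" and "bval ?b (regs z)"
    then have rx: "regs z rx = 0" and j: "0 < regs z rj" by auto
    then obtain ys xs where "J m z ys xs" using I by (auto simp: I_def K_def)
    define j where "j = regs z rj"
    note * = \<open>J m z ys xs\<close>[unfolded J_def, folded j_def]
    have *: "frame {rj, rv, rx} {} s z" "j \<le> h" "\<forall>w\<in>?hi j. (w, u) \<notin> le" "?L j = ys @ xs"
        "linked ((!) (mem s LevelNext)) n (regs z rv) xs" "\<forall>w\<in>set ys. (w, u) \<notin> le"
        "m = 1 + j * (n + 2) + length xs" "clock z \<le> clock s + 50 * (card (?hi j) + length ys + (h - j))"
      using * j by (auto simp: j_def)
    have z: "ready z" using ready_frame[OF s *(1)] by simp
    note zD = readyD[OF z]
    have zr: "regs z ru = u" "mem z = mem s" using *(1) regs by (auto simp: frame_def fun_eq_iff)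
    have xs: "set xs \<subseteq> set ps" using arg_cong[OF *(4), of set] by auto
    show "wp B predecessor_step (\<lambda>u. \<exists>m'<m. I m' u) (tick (1 + bcost ?b) z)"
    proof (cases xs)
      case Nil
      then have rv: "regs z rv = n" using * by simp
      have ys: "ys = ?L j" using * Nil by simp
      obtain j' where j': "j = Suc j'" using j by (cases j) (auto simp: j_def)
      have hi_j': "?hi j' = ?hi j \<union> set ys" by (auto simp: ys j')
      have c1: "card (?hi j') = card (?hi j) + length ys"
      proof -
        have "distinct ys" using dist by (simp add: ys)
        then have "length ys = card (set ys)" by (rule distinct_card[symmetric])
        moreover have "?hi j \<inter> set ys = {}" by (auto simp: ys)
        ultimately show ?thesis by (simp add: hi_j' card_Un_disjoint)
      qed
      have c2: "h - j' = Suc (h - j)" using *(2) by (simp add: j')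
      have clk: "clock z + 50 \<le> clock s + 50 * (card (?hi j') + (h - j'))"
        unfolding c1 c2 using *(8) by (simp only: add_mult_distrib2 mult_Suc_right)
      have hi': "\<forall>w\<in>?hi j'. (w, u) \<notin> le" using *(3,6) by (simp add: hi_j' ball_Un)
      have "linked ((!) (mem s LevelNext)) n (mem s Level ! j') (?L j')" if "0 < j'"
        using that lev *(2) by (simp add: j')
      moreover have "j' < length (mem z Level)" using *(2) h t length_es_le zD by (simp add: j')
      ultimately have "wp B predecessor_step (\<lambda>u. J (1 + j' * (n + 2) + length (?L j')) u [] (?L j')) (tick (1 + bcost ?b) z)"
        unfolding predecessor_step_def J_def
        using *(1,2) rx hi' clk by (simp add: rv zr zD j_def[symmetric] j')
      moreover have "1 + j' * (n + 2) + length (?L j') < m"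
        using len *(7) le_trans[OF length_filter_le len, of "\<lambda>u. f u = j'"] by (simp add: j')
      ultimately show ?thesis by (elim wp_mono) (unfold I_def, blast)
    next
      case (Cons v xs')
      then have rv: "regs z rv = v" "linked ((!) (mem s LevelNext)) n (mem s LevelNext ! v) xs'" using * by auto
      have v: "v \<in> set ps" "f v = j" using arg_cong[OF *(4), of set] Cons by auto
      then have vn: "v < n" by (simp add: ps_less)
      have sb: "card (?hi j) + length ys \<le> skipped t" using skip_bound * by blast
      obtain d where d: "h = j + d" using *(2) le_Suc_ex by blast
      have "wp B predecessor_step (\<lambda>u. J (1 + j * (n + 2) + length xs') u (ys @ [v]) xs' \<or> K 0 u) (tick (1 + bcost ?b) z)"
        unfolding predecessor_step_def J_def K_def
        using vn un rx v * rv j upper_levels[of j] sb Cons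
        by (simp add: zr vn un zD[unfolded zr] zD rx matrix_index_less j_def[symmetric] less_imp_neq[OF vn] d)
      moreover have "1 + j * (n + 2) + length xs' < m" "0 < m" using * Cons by auto
      ultimately show ?thesis by (elim wp_mono) (unfold I_def, blast)
    qed
  next
    fix m z assume I: "I m z" and b: "\<not> bval ?b (regs z)"
    have "clock z \<le> clock s + 50 * (1 + 2 * skipped t)"
    proof (cases "K m z")
      case False
      then obtain ys xs where J: "J m z ys xs" using I by (auto simp: I_def)
      then have "regs z rj = 0" using b by (auto simp: J_def)
      then show ?thesis using J skip_bound[of "regs z rj" ys xs] upper_levels[of "regs z rj"] by (auto simp: J_def)
    qed (simp add: K_def)
    then show "?Q (tick (1 + bcost ?b) z)"
      using I b by (auto simp: I_def J_def K_def)
  qed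
qed

lemma levels_height_le: "levels ps h f lv nx pr \<Longrightarrow> h \<le> length ps"
proof -
  assume "levels ps h f lv nx pr"
  then have "card {1..h} \<le> card (set ps)" by (intro surj_card_le) (auto simp: levels_def)
  then show ?thesis using card_length[of ps] by simp
qed

text \<open>j is the highest level with an element below u, so everything below u has level at most
  j and u fits on level j + 1. Nothing earlier lies above u. For j = 0 the recorded predecessor v is
  arbitrary, in accordance with the condition \<open>2 \<le> f u\<close> in
  \<open>levels\<close>.\<close>

lemma levels_step:
  assumes levels: "levels ps h f lv nx pr"
    and u: "u \<notin> set ps" "u < length nx" "u < length pr" and h: "Suc h < length lv"
    and j: "j \<le> h" "\<forall>w\<in>set ps. j < f w \<longrightarrow> (w, u) \<notin> le" "0 < j \<longrightarrow> v \<in> set ps \<and> f v = j \<and> (v, u) \<in> le"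
    and above: "\<forall>w\<in>set ps. (u, w) \<notin> le"
    and lv': "lv' = (if j = h then lv[Suc h := n] else lv)"
  shows "levels (ps @ [u]) (if j = h then Suc h else h) (f(u := Suc j))
    (lv'[Suc j := u]) (nx[u := lv' ! Suc j]) (pr[u := v])"
proof -
  note lev = levels[unfolded levels_def]
  let ?h = "if j = h then Suc h else h" and ?f = "f(u := Suc j)"
  have f: "?f w = f w" if "w \<in> set ps" for w using that u by auto
  have "{1..?h} \<subseteq> ?f ` set (ps @ [u])"
  proof
    fix i assume i: "i \<in> {1..?h}"
    show "i \<in> ?f ` set (ps @ [u])"
    proof (cases "i \<le> h")
      case True
      then have "i \<in> f ` set ps" using lev i by (meson atLeastAtMost_iff subsetD)
      then show ?thesis using f by force
    qed (use i in \<open>auto split: if_splits\<close>)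
  qed
  moreover have "\<forall>i. 1 \<le> i \<longrightarrow> i \<le> ?h \<longrightarrow>
      linked ((!) (nx[u := lv' ! Suc j])) n (lv'[Suc j := u] ! i) (rev (filter (\<lambda>w. ?f w = i) (ps @ [u])))"
  proof (intro allI impI)
    fix i assume i: "1 \<le> i" "i \<le> ?h"
    have eq: "filter (\<lambda>w. ?f w = i) ps = filter (\<lambda>w. f w = i) ps"
      using f by (intro filter_cong) auto
    have old: "linked ((!) (nx[u := lv' ! Suc j])) n a (rev (filter (\<lambda>w. f w = i) ps))
        = linked ((!) nx) n a (rev (filter (\<lambda>w. f w = i) ps))" for a
      using u by (intro linked_cong) (auto simp: nth_list_update)
    have "linked ((!) nx) n (lv' ! i) (rev (filter (\<lambda>w. f w = i) ps))"
    proof (cases "i \<le> h")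
      case True
      then show ?thesis using lev i by (auto simp: lv')
    next
      case False
      then have "filter (\<lambda>w. f w = i) ps = []" using lev by (auto simp: filter_empty_conv)
      with False show ?thesis using i h by (auto simp: lv' le_Suc_eq split: if_splits)
    qed
    then show "linked ((!) (nx[u := lv' ! Suc j])) n (lv'[Suc j := u] ! i) (rev (filter (\<lambda>w. ?f w = i) (ps @ [u])))"
      using old i h j u eq by (auto simp: nth_list_update lv')
  qed
  moreover have "\<forall>w\<in>set (ps @ [u]). 2 \<le> ?f w \<longrightarrow> pr[u := v] ! w \<in> set (ps @ [u]) \<and>
      Suc (?f (pr[u := v] ! w)) = ?f w \<and> (pr[u := v] ! w, w) \<in> le"
  proof (intro ballI impI)
    fix w assume w: "w \<in> set (ps @ [u])" "2 \<le> ?f w"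
    show "pr[u := v] ! w \<in> set (ps @ [u]) \<and> Suc (?f (pr[u := v] ! w)) = ?f w \<and> (pr[u := v] ! w, w) \<in> le"
    proof (cases "w = u")
      case True
      then show ?thesis using w j u by auto
    next
      case False
      then have "w \<in> set ps" "2 \<le> f w" using w by auto
      then have "pr ! w \<in> set ps \<and> Suc (f (pr ! w)) = f w \<and> (pr ! w, w) \<in> le" using lev by blast
      then show ?thesis using False u by auto
    qed
  qed
  moreover have "\<forall>a\<in>set (ps @ [u]). \<forall>b\<in>set (ps @ [u]). (a, b) \<in> le \<longrightarrow> a \<noteq> b \<longrightarrow> ?f a < ?f b"
    using lev j above u by (auto simp: less_Suc_eq_le not_less[symmetric])
  moreover have "\<forall>w\<in>set (ps @ [u]). 1 \<le> ?f w \<and> ?f w \<le> ?h"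
    using lev j u by (auto simp: le_Suc_eq)
  ultimately show ?thesis unfolding levels_def by blast
qed

lemma antichain_decomposition:
  assumes s: "node fp es s"
  shows "wp B antichain_decomposition (\<lambda>z. frame {rh, rt, ru, rj, rv, rx} {Level, LevelNext, Pred} s z \<and>
      (\<exists>f. levels es (regs z rh) f (mem z Level) (mem z LevelNext) (mem z Pred)) \<and>
      clock z \<le> clock s + 20 + 200 * length es + 100 * (\<Sum>t<length es. skipped t)) s" (is "wp B _ ?Q s")
proof -
  have rs: "ready s" "regs s rfp = fp" "regs s rm = length es" "\<forall>t<length es. mem s Elems ! (fp + t) = es ! t"
    using s by (auto simp: node_def)
  let ?F = "frame {rh, rt, ru, rj, rv, rx} {Level, LevelNext, Pred}"
  define I where "I t z \<longleftrightarrow> ?F s z \<and> t \<le> length es \<and> regs z rt = t \<and>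
    (\<exists>f. levels (take t es) (regs z rh) f (mem z Level) (mem z LevelNext) (mem z Pred)) \<and>
    clock z \<le> clock s + 10 + 200 * t + 100 * (\<Sum>i<t. skipped i)" for t z
  show ?thesis
    unfolding antichain_decomposition_eq wp_Seq
  proof (subst wp_Assign, rule wp_for[where I = I])
    show "I 0 (tick 2 (set_reg rt 0 (tick (1 + acost (N 0)) (set_reg rh (aval (N 0) (regs s)) s))))"
      by (auto simp: I_def levels_def)
  next
    fix t z assume "I t z"
    then show "t \<le> length es \<and> regs z rt = t \<and> aval (V rm) (regs z) = length es"
      using rs by (auto simp: I_def frame_def)
  next
    fix z assume "I (length es) z"
    then show "?Q (tick (3 + acost (V rm)) z)" by (auto simp: I_def)
  next
    fix t z assume I: "I t z" and t: "t < length es"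
    define h where "h = regs z rh"
    define u where "u = es ! t"
    have fr: "?F s z" "regs z rt = t" "clock z \<le> clock s + 10 + 200 * t + 100 * (\<Sum>i<t. skipped i)"
      using I by (auto simp: I_def)
    obtain f where f: "levels (take t es) h f (mem z Level) (mem z LevelNext) (mem z Pred)"
      using I by (auto simp: I_def h_def)
    have h: "h \<le> t" using levels_height_le[OF f] by simp
    have un: "u < n" using nth_es_less[OF t] by (simp add: u_def)
    have z: "ready z" using ready_frame[OF rs(1) fr(1)] by simp
    note zD = readyD[OF z]
    have zr: "regs z rfp = fp" "\<forall>t<length es. mem z Elems ! (fp + t) = es ! t"
      using fr rs by (auto simp: frame_def)
    have tn: "t < n" using t length_es_le by simp
    have ft: "fp + t < frame_space n" using room1 tn by simp
    have insert: "wp B insert_level (\<lambda>u. regs u rt = t \<and> I (Suc t) (tick 4 (set_reg rt (Suc t) u))) s2"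
      if s2: "frame {ru, rj, rv, rx} {} z s2" and u2: "regs s2 ru = u" and j: "regs s2 rj \<le> h"
        "\<forall>w\<in>set (take t es). regs s2 rj < f w \<longrightarrow> (w, u) \<notin> le"
        "0 < regs s2 rj \<longrightarrow> regs s2 rv \<in> set (take t es) \<and> f (regs s2 rv) = regs s2 rj \<and> (regs s2 rv, u) \<in> le"
        and c2: "clock s2 \<le> clock z + 140 + 100 * skipped t" for s2
    proof -
      define j' where "j' = regs s2 rj"
      define lv' where "lv' = (if j' = h then (mem z Level)[Suc h := n] else mem z Level)"
      have "levels (take t es @ [u]) (if j' = h then Suc h else h) (f(u := Suc j'))
          (lv'[Suc j' := u]) ((mem z LevelNext)[u := lv' ! Suc j']) ((mem z Pred)[u := regs s2 rv])"
      proof (rule levels_step[OF f])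
        show "u \<notin> set (take t es)" 
          using distinct_es t by (auto simp: u_def in_set_conv_nth distinct_conv_nth)
        \<comment> \<open>Earlier elements have smaller names, and the names form a linear
          extension.\<close>
        show "\<forall>w\<in>set (take t es). (u, w) \<notin> le"
        proof
          fix w assume "w \<in> set (take t es)"
          then have "w < u" "w < n"
            using sorted_es t nth_es_less by (auto simp: u_def in_set_conv_nth sorted_wrt_iff_nth_less)
          then show "(u, w) \<notin> le" using extension[OF un] by (auto dest: leD)
        qed
      qed (use zD un h tn j in \<open>auto simp: j'_def lv'_def\<close>)
      then have lev: "levels (take (Suc t) es) (if j' = h then Suc h else h) (f(u := Suc j'))
          (lv'[Suc j' := u]) ((mem z LevelNext)[u := lv' ! Suc j']) ((mem z Pred)[u := regs s2 rv])"
        using t by (simp add: take_Suc_conv_app_nth u_def)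
      have s2r: "mem s2 = mem z" "regs s2 rn = n" "regs s2 rh = h" "regs s2 rt = t"
        using s2 zD fr by (auto simp: frame_def fun_eq_iff h_def)
      have "?F s s2" using frame_trans[OF fr(1) s2] by auto
      then show ?thesis
        using lev t j(1) h tn un c2 fr(3) unfolding insert_level_def I_def lv'_def
        by (cases "j' = h") (simp_all add: s2r zD u2 j'_def[symmetric], blast+)
    qed
    have search: "wp B (WHILE V rx \<doteq> N 0 AND N 0 \<lhd> V rj DO predecessor_step)
        (wp B insert_level (\<lambda>u. regs u rt = t \<and> I (Suc t) (tick 4 (set_reg rt (Suc t) u)))) s1"
      if s1: "frame {ru, rj, rv, rx} {} z s1" "regs s1 ru = u" "regs s1 rj = h" "regs s1 rv = mem z Level ! h"
        "regs s1 rx = 0" and c1: "clock s1 \<le> clock z + 40" for s1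
    proof (rule wp_mono[OF predecessor_search])
      show "ready s1" using ready_frame[OF z s1(1)] by simp
      have m: "mem s1 = mem z" using s1(1) by (auto simp: frame_def fun_eq_iff)
      show "levels (take t es) h f (mem s1 Level) (mem s1 LevelNext) (mem z Pred)"
        using f by (simp add: m)
      show "regs s1 rv = mem s1 Level ! h" using s1 m by simp
    next
      fix s2
      assume *: "frame {rj, rv, rx} {} s1 s2 \<and> regs s2 rj \<le> h \<and>
        (\<forall>w\<in>set (take t es). regs s2 rj < f w \<longrightarrow> (w, u) \<notin> le) \<and>
        (0 < regs s2 rj \<longrightarrow> regs s2 rv \<in> set (take t es) \<and> f (regs s2 rv) = regs s2 rj \<and> (regs s2 rv, u) \<in> le) \<and>
        clock s2 \<le> clock s1 + 50 * (2 + 2 * skipped t)"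
      show "wp B insert_level (\<lambda>u. regs u rt = t \<and> I (Suc t) (tick 4 (set_reg rt (Suc t) u))) s2"
      proof (rule insert)
        show "frame {ru, rj, rv, rx} {} z s2" using frame_trans[OF s1(1) conjunct1[OF *]] by auto
        show "regs s2 ru = u" using * s1 by (simp add: frame_def)
      qed (use * c1 in auto)
    qed (use t h s1 u_def in auto)
    show "wp B antichain_step
        (\<lambda>u. regs u rt = t \<and> I (Suc t) (tick 4 (set_reg rt (Suc t) u))) (tick (3 + acost (V rm)) z)"
      unfolding antichain_step_def
      using ft fr(2) h tn t zr
      by (simp add: zD h_def[symmetric] u_def[symmetric] search)
  qed
qed

section \<open>The longest chain\<close>

text \<open>Each predecessor lies exactly one level lower, so the walk from level h to level 1
  produces a chain of length h. As no level exceeds h, the levels themselves certify that it is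
  longest.\<close>

lemma extract_chain:
  assumes s: "node fp es s" and levels: "levels es (regs s rh) f (mem s Level) (mem s LevelNext) (mem s Pred)"
  shows "wp B extract_chain (\<lambda>z. frame {rk, rj, rv} {Chain} s z \<and> (\<forall>p<fp. mem z Chain ! p = mem s Chain ! p) \<and>
      (\<exists>cs. leveled_chain le (set es) cs f \<and> length cs = regs z rk \<and>
        (\<forall>j<length cs. mem z Chain ! (fp + Suc j) = cs ! j)) \<and>
      clock z \<le> clock s + 20 + 50 * length es) s" (is "wp B _ ?Q s")
proof -
  define h where "h = regs s rh"
  note lev = levels[folded h_def, unfolded levels_def]
  have rs: "ready s" "regs s rfp = fp" using s by (auto simp: node_def)
  note sD = readyD[OF rs(1)]
  have h: "h \<le> length es" using levels_height_le[OF levels] by (simp add: h_def)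
  then have hn: "h \<le> n" using length_es_le by simp
  let ?F = "frame {rk, rj, rv} {Chain}"
  define I where "I m z \<longleftrightarrow> ?F s z \<and> (\<forall>p<fp. mem z Chain ! p = mem s Chain ! p) \<and>
      regs z rk = h \<and> regs z rj = m \<and> m \<le> h \<and> (0 < m \<longrightarrow> regs z rv \<in> set es \<and> f (regs z rv) = m) \<and>
      (\<forall>i. m < i \<longrightarrow> i \<le> h \<longrightarrow> mem z Chain ! (fp + i) \<in> set es \<and> f (mem z Chain ! (fp + i)) = i) \<and>
      (\<forall>i. m < i \<longrightarrow> i < h \<longrightarrow> (mem z Chain ! (fp + i), mem z Chain ! (fp + Suc i)) \<in> le) \<and>
      (0 < m \<longrightarrow> m < h \<longrightarrow> (regs z rv, mem z Chain ! (fp + Suc m)) \<in> le) \<and>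
      clock z \<le> clock s + 10 + 50 * (h - m)" for m z
  have loop: "wp B (WHILE N 0 \<lhd> V rj DO
      (Chain\<lbrakk>V rfp \<oplus> V rj\<rbrakk> ::= V rv ;; rv ::= Pred\<lbrakk>V rv\<rbrakk> ;; rj ::= V rj \<ominus> N 1)) ?Q s1"
    if I: "I h s1" for s1
  proof (rule wp_While[where I = I and m = h])
    show "I h s1" by fact
  next
    fix m z assume I: "I m z" and "bval (N 0 \<lhd> V rj) (regs z)"
    then obtain m' where m: "m = Suc m'" by (cases m) (auto simp: I_def)
    have fr: "?F s z" using I by (simp add: I_def)
    have z: "ready z" using ready_frame[OF rs(1) fr] by simp
    note zD = readyD[OF z]
    have zr: "regs z rfp = fp" "mem z Pred = mem s Pred" using fr rs by (auto simp: frame_def)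
    have v: "regs z rv \<in> set es" "f (regs z rv) = m" "regs z rv < n" "m \<le> h" using I es_less by (auto simp: I_def m)
    have fm: "fp + m < frame_space n" using room1 v hn by simp
    obtain d where d: "h = m + d" using v(4) le_Suc_ex by blast
    have pr: "mem s Pred ! regs z rv \<in> set es \<and> f (mem s Pred ! regs z rv) = m' \<and> (mem s Pred ! regs z rv, regs z rv) \<in> le"
      if "0 < m'"
      using lev v(1,2) that by (auto simp: m)
    show "wp B (Chain\<lbrakk>V rfp \<oplus> V rj\<rbrakk> ::= V rv ;; rv ::= Pred\<lbrakk>V rv\<rbrakk> ;; rj ::= V rj \<ominus> N 1) (\<lambda>u. \<exists>m'<m. I m' u)
        (tick (1 + bcost (N 0 \<lhd> V rj)) z)"
    proof (rule wp_mono)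
      show "wp B (Chain\<lbrakk>V rfp \<oplus> V rj\<rbrakk> ::= V rv ;; rv ::= Pred\<lbrakk>V rv\<rbrakk> ;; rj ::= V rj \<ominus> N 1) (\<lambda>u. I m' u)
        (tick (1 + bcost (N 0 \<lhd> V rj)) z)"
        using I fm v pr unfolding I_def by (auto simp: zr zD sD m d nth_list_update)
    qed (use m in auto)
  next
    fix m z assume I: "I m z" and b: "\<not> bval (N 0 \<lhd> V rj) (regs z)"
    then have m: "m = 0" by (auto simp: I_def)
    define cs where "cs = map (\<lambda>i. mem z Chain ! (fp + Suc i)) [0..<h]"
    have len: "length cs = h" by (simp add: cs_def)
    interpret finite_poset le "set es" by (rule finite_poset_es)
    have fcs: "cs ! i \<in> set es" "f (cs ! i) = Suc i" if "i < h" for i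
      using I that unfolding I_def m by (simp_all add: cs_def del: add_Suc_right)
    have "sorted_wrt (\<lambda>u v. (u, v) \<in> le) cs"
    proof (subst sorted_wrt_iff_nth_Suc_transp)
      show "transp (\<lambda>u v. (u, v) \<in> le)" using trans_r by (auto simp: transp_def trans_def)
      show "\<forall>i. Suc i < length cs \<longrightarrow> (cs ! i, cs ! Suc i) \<in> le"
        using I unfolding I_def m by (simp add: cs_def del: add_Suc_right)
    qed
    moreover have "cs ! i \<noteq> cs ! j" if "i < j" "j < h" for i j
      using fcs(2)[of i] fcs(2)[of j] that by auto
    ultimately have "chain_in le (set es) cs"
      using fcs(1) by (auto simp: chain_in_def sorted_wrt_iff_nth_less len in_set_conv_nth)
    then have "leveled_chain le (set es) cs f"
      using lev by unfold_locales (auto simp: len)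
    then show "?Q (tick (1 + bcost (N 0 \<lhd> V rj)) z)"
      using I h by (auto simp: I_def m cs_def intro!: exI[of _ cs])
  qed
  \<comment> \<open>The top level is nonempty, so its list head is a genuine element rather than the
    end marker n.\<close>
  have "mem s Level ! h \<in> set es \<and> f (mem s Level ! h) = h" if "0 < h"
  proof -
    have "h \<in> f ` set es" using lev that by (auto simp: subset_iff)
    then have "filter (\<lambda>u. f u = h) es \<noteq> []" by (auto simp: filter_empty_conv)
    moreover have "linked ((!) (mem s LevelNext)) n (mem s Level ! h) (rev (filter (\<lambda>u. f u = h) es))"
      using lev that by auto
    ultimately have "mem s Level ! h \<in> set (rev (filter (\<lambda>u. f u = h) es))"
      by (cases "rev (filter (\<lambda>u. f u = h) es)") auto
    then show ?thesis by simp
  qed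
  then show ?thesis
    unfolding extract_chain_def using hn
    by (simp add: sD h_def[symmetric] del: One_nat_def add_Suc_right) (rule loop, simp add: I_def rs)
qed

end

section \<open>Classification of the elements\<close>

locale node_chain = node_data +
  fixes cs :: "nat list" and f :: "nat \<Rightarrow> nat"
  assumes leveled: "leveled_chain le (set es) cs f"
begin

sublocale leveled_chain le "set es" cs f
  by (rule leveled)

definition chained :: "(register, array) machine \<Rightarrow> bool" where
  "chained s \<longleftrightarrow> node fp es s \<and> regs s rk = length cs \<and> (\<forall>j<length cs. mem s Chain ! (fp + Suc j) = cs ! j)"

lemma chainedD:
  assumes "chained s"
  shows "ready s" "regs s rfp = fp" "regs s rm = length es" "regs s rk = length cs"
    "t < length es \<Longrightarrow> mem s Elems ! (fp + t) = es ! t"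
    "j < length cs \<Longrightarrow> mem s Chain ! (fp + Suc j) = cs ! j"
  using assms by (auto simp: chained_def node_def)

lemma chained_frame:
  "chained s \<Longrightarrow> frame X A s t \<Longrightarrow> X \<inter> {rn, rw, rfp, rm, rk} = {} \<Longrightarrow> A \<inter> {Label, Leq, Elems, Chain} = {} \<Longrightarrow> chained t"
  using ready_frame[of s X A t] by (auto simp: chained_def node_def frame_def disjoint_iff)

lemma chain_nth_less: "i < length cs \<Longrightarrow> cs ! i < n"
  using chain_mem es_less by blast

lemma chain_nat_less: "i < j \<Longrightarrow> j < length cs \<Longrightarrow> cs ! i < cs ! j"
  using chain_less[of i j] extension[of "cs ! i" "cs ! j"] chain_nth_less[of i] chain_nth_less[of j]
  by fastforce

lemma length_chain_le: "length cs \<le> length es"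
proof -
  have "card (set cs) \<le> card (set es)" using set_chain by (intro card_mono) auto
  then show ?thesis using distinct_chain distinct_es by (simp add: distinct_card)
qed

section \<open>The two searches along the chain\<close>

definition upper_search :: "(register, array) com" where
  "upper_search =
     (WHILE V rx \<doteq> N 0 AND V rj \<lhd> V rk \<oplus> N 1 DO (
        rv ::= Chain\<lbrakk>V rfp \<oplus> V rj\<rbrakk> ;;
        rx ::= Leq\<lbrakk>V ru \<otimes> V rn \<oplus> V rv\<rbrakk> ;;
        IF V rx \<doteq> N 0 THEN rj ::= V rj \<oplus> N 1 ELSE Skip))"

definition lower_search :: "(register, array) com" where
  "lower_search =
     (WHILE V rx \<doteq> N 0 AND N 0 \<lhd> V rj DO (
        rv ::= Chain\<lbrakk>V rfp \<oplus> V rj\<rbrakk> ;;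
        rx ::= Leq\<lbrakk>V rv \<otimes> V rn \<oplus> V ru\<rbrakk> ;;
        IF V rx \<doteq> N 0 THEN rj ::= V rj \<ominus> N 1 ELSE Skip))"

text \<open>The position never passes \<open>hi u\<close>. An unsuccessful search stops at k + 1,
  which is \<open>hi u\<close> for the virtual upper element, so both exits give the same result. A
  success sets the variant to 0.\<close>

lemma upper_search:
  assumes s: "chained s" and u: "regs s ru = u" "u < n"
    and j: "regs s rj = j" "1 \<le> j" "j \<le> hi u" "regs s rx = 0"
  shows "wp B upper_search (\<lambda>z. frame {rv, rx, rj} {} s z \<and> regs z rj = hi u \<and>
      clock z \<le> clock s + 50 * (1 + hi u - j)) s" (is "wp B _ ?Q s")
proof -
  note sD = chainedD[OF s]
  define I where "I m z \<longleftrightarrow> frame {rv, rx, rj} {} s z \<and> regs z rj \<le> hi u \<and> j \<le> regs z rj \<and>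
      (if regs z rx = 0 then m = 1 + hi u - regs z rj \<and> clock z \<le> clock s + 50 * (regs z rj - j)
       else m = 0 \<and> regs z rj = hi u \<and> clock z \<le> clock s + 50 * (hi u - j) + 40)" for m z
  show ?thesis
    unfolding upper_search_def
  proof (rule wp_While[where I = I])
    show "I (1 + hi u - j) s" using u j by (simp add: I_def)
  next
    fix m z assume I: "I m z" and "bval (V rx \<doteq> N 0 AND V rj \<lhd> V rk \<oplus> N 1) (regs z)"
    then have x: "regs z rx = 0" and jk: "regs z rj < Suc (regs z rk)" by auto
    have fr: "frame {rv, rx, rj} {} s z" using I by (simp add: I_def)
    have z: "chained z" using chained_frame[OF s fr] by simp
    note zD = chainedD[OF z] readyD[OF chainedD(1)[OF z]]
    obtain i where i: "regs z rj = Suc i" using I j by (cases "regs z rj") (auto simp: I_def)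
    then have ik: "i < length cs" using jk zD by simp
    have ji: "j \<le> Suc i" "Suc i \<le> hi u" using I i by (auto simp: I_def)
    have zu: "regs z ru = u" using fr u by (simp add: frame_def)
    note iff = upper_index_le_iff[OF ik, of u]
    have "fp + Suc i < frame_space n" using ik length_chain_le length_es_le by (intro room1) simp
    then show "wp B (rv ::= Chain\<lbrakk>V rfp \<oplus> V rj\<rbrakk> ;; rx ::= Leq\<lbrakk>V ru \<otimes> V rn \<oplus> V rv\<rbrakk> ;;
        IF V rx \<doteq> N 0 THEN rj ::= V rj \<oplus> N 1 ELSE Skip) (\<lambda>u. \<exists>m'<m. I m' u)
        (tick (1 + bcost (V rx \<doteq> N 0 AND V rj \<lhd> V rk \<oplus> N 1)) z)"
      using I i ik iff ji fr x chain_nth_less[OF ik] u(2) unfolding I_def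
      by (auto simp: zD zu matrix_index_less simp del: add_Suc_right)
  next
    fix m z assume I: "I m z" and b: "\<not> bval (V rx \<doteq> N 0 AND V rj \<lhd> V rk \<oplus> N 1) (regs z)"
    have "regs z rk = length cs" using I sD by (auto simp: I_def frame_def)
    then show "?Q (tick (1 + bcost (V rx \<doteq> N 0 AND V rj \<lhd> V rk \<oplus> N 1)) z)"
      using I b upper_index_bounds[of u] by (auto simp: I_def split: if_splits)
  qed
qed

lemma lower_search:
  assumes s: "chained s" and u: "regs s ru = u" "u < n"
    and j: "regs s rj = j" "j \<le> length cs" "lo u \<le> j" "regs s rx = 0"
  shows "wp B lower_search (\<lambda>z. frame {rv, rx, rj} {} s z \<and> regs z rj = lo u \<and>
      clock z \<le> clock s + 50 * (1 + j - lo u)) s" (is "wp B _ ?Q s")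
proof -
  note sD = chainedD[OF s]
  define I where "I m z \<longleftrightarrow> frame {rv, rx, rj} {} s z \<and> lo u \<le> regs z rj \<and> regs z rj \<le> j \<and>
      (if regs z rx = 0 then m = 1 + regs z rj \<and> clock z \<le> clock s + 50 * (j - regs z rj)
       else m = 0 \<and> regs z rj = lo u \<and> clock z \<le> clock s + 50 * (j - lo u) + 40)" for m z
  show ?thesis
    unfolding lower_search_def
  proof (rule wp_While[where I = I])
    show "I (1 + j) s" using u j by (simp add: I_def)
  next
    fix m z assume I: "I m z" and "bval (V rx \<doteq> N 0 AND N 0 \<lhd> V rj) (regs z)"
    then have x: "regs z rx = 0" and jk: "0 < regs z rj" by auto
    have fr: "frame {rv, rx, rj} {} s z" using I by (simp add: I_def)
    have z: "chained z" using chained_frame[OF s fr] by simp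
    note zD = chainedD[OF z] readyD[OF chainedD(1)[OF z]]
    obtain i where i: "regs z rj = Suc i" using jk by (cases "regs z rj") auto
    have ji: "Suc i \<le> j" "lo u \<le> Suc i" using I i by (auto simp: I_def)
    then have ik: "i < length cs" using j by simp
    have zu: "regs z ru = u" using fr u by (simp add: frame_def)
    note iff = less_lower_index_iff[OF ik, of u]
    have "fp + Suc i < frame_space n" using ik length_chain_le length_es_le by (intro room1) simp
    then show "wp B (rv ::= Chain\<lbrakk>V rfp \<oplus> V rj\<rbrakk> ;; rx ::= Leq\<lbrakk>V rv \<otimes> V rn \<oplus> V ru\<rbrakk> ;;
        IF V rx \<doteq> N 0 THEN rj ::= V rj \<ominus> N 1 ELSE Skip) (\<lambda>u. \<exists>m'<m. I m' u)
        (tick (1 + bcost (V rx \<doteq> N 0 AND N 0 \<lhd> V rj)) z)"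
      using I i ik iff ji fr x chain_nth_less[OF ik] u(2) unfolding I_def
      by (auto simp: zD zu matrix_index_less simp del: add_Suc_right)
  next
    fix m z assume I: "I m z" and b: "\<not> bval (V rx \<doteq> N 0 AND N 0 \<lhd> V rj) (regs z)"
    then show "?Q (tick (1 + bcost (V rx \<doteq> N 0 AND N 0 \<lhd> V rj)) z)"
      using j by (auto simp: I_def split: if_splits)
  qed
qed

text \<open>Positions below \<open>fp\<close> hold the data of the suspended outer calls.\<close>

definition kept :: "array set \<Rightarrow> (register, array) machine \<Rightarrow> (register, array) machine \<Rightarrow> bool" where
  "kept A s t \<longleftrightarrow> (\<forall>a\<in>A. \<forall>p<fp. mem t a ! p = mem s a ! p)"

text \<open>The elements are processed from the end of \<open>es\<close>, so t is the number of
  elements still to come and the finished part is a suffix.\<close>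

definition classified :: "nat \<Rightarrow> (register, array) machine \<Rightarrow> bool" where
  "classified t s \<longleftrightarrow> (\<forall>u\<in>set (drop t es) - set cs. mem s Upper ! (fp + u) = hi u) \<and>
     (\<forall>i\<le>length cs. linked (\<lambda>u. mem s BucketNext ! (fp + u)) n (mem s Bucket ! (fp + i))
       (filter (\<lambda>u. u \<notin> set cs \<and> lo u = i) (drop t es)))"

definition push_bucket :: "(register, array) com" where
  "push_bucket =
     rx ::= Bucket\<lbrakk>V rfp \<oplus> V rj\<rbrakk> ;;
     BucketNext\<lbrakk>V rfp \<oplus> V ru\<rbrakk> ::= V rx ;;
     Bucket\<lbrakk>V rfp \<oplus> V rj\<rbrakk> ::= V ru"

definition classify_element :: "(register, array) com" where
  "classify_element =
     rj ::= V rs \<oplus> N 1 ;; rx ::= N 0 ;; upper_search ;; Upper\<lbrakk>V rfp \<oplus> V ru\<rbrakk> ::= V rj ;;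
     rj ::= V rs ;; rx ::= N 0 ;; lower_search ;; push_bucket"

definition classify_step :: "(register, array) com" where
  "classify_step =
     rt ::= V rt \<ominus> N 1 ;; ru ::= Elems\<lbrakk>V rfp \<oplus> V rt\<rbrakk> ;; rv ::= V rn ;;
     IF N 0 \<lhd> V rs THEN rv ::= Chain\<lbrakk>V rfp \<oplus> V rs\<rbrakk> ELSE Skip ;;
     IF V ru \<doteq> V rv THEN rs ::= V rs \<ominus> N 1 ELSE classify_element"

lemma classify_elements_eq:
  "classify_elements = (FOR rt < V rk \<oplus> N 1 DO Bucket\<lbrakk>V rfp \<oplus> V rt\<rbrakk> ::= V rn) ;;
     rs ::= V rk ;; rt ::= V rm ;; WHILE N 0 \<lhd> V rt DO classify_step"
  by (simp add: classify_elements_def classify_step_def classify_element_def push_bucket_def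
      upper_search_def lower_search_def)

definition chain_before :: "nat \<Rightarrow> nat \<Rightarrow> bool" where
  "chain_before q t \<longleftrightarrow> q \<le> length cs \<and> (\<forall>i<length cs. i < q \<longleftrightarrow> cs ! i \<in> set (take t es))"

text \<open>By the linear extension, a chain element that precedes u in \<open>es\<close> cannot be
  above u, and one that follows cannot be below u. So upward from q + 1 and downward from q, the
  searches pass only chain elements incomparable to u.\<close>

lemma chain_before_index:
  assumes q: "chain_before q t" and t: "t < length es" "u = es ! t" "u \<notin> set cs"
  shows "lo u \<le> q" "Suc q \<le> hi u"
proof -
  have un: "u < n" using t nth_es_less by simp
  have lt: "cs ! i < u" if "i < q" "i < length cs" for i
  proof -
    have "cs ! i \<in> set (take t es)" using q that by (simp add: chain_before_def)
    then obtain k where "k < t" "cs ! i = es ! k" by (auto simp: in_set_conv_nth)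
    then show ?thesis using sorted_es t by (simp add: sorted_wrt_iff_nth_less)
  qed
  have gt: "u < cs ! i" if "q \<le> i" "i < length cs" for i
  proof -
    have "cs ! i \<notin> set (take t es)" using q that by (auto simp: chain_before_def)
    moreover have "set es = set (take t es) \<union> set (drop t es)"
      by (metis append_take_drop_id set_append)
    ultimately have "cs ! i \<in> set (drop t es)" using chain_mem[OF that(2)] by blast
    then obtain k where k: "t + k < length es" "es ! (t + k) = cs ! i"
      by (auto simp: in_set_conv_nth less_diff_conv add.commute)
    moreover have "k \<noteq> 0"
    proof
      assume "k = 0"
      then have "u = cs ! i" using k t by simp
      then show False using t(3) nth_mem[OF that(2)] by simp
    qed
    ultimately show ?thesis
      using sorted_es t sorted_wrt_nth_less[of "(<)" es t "t + k"] by simp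
  qed
  show "lo u \<le> q"
  proof (cases "q < length cs")
    case True
    then have "(cs ! q, u) \<notin> le" using gt[of q] extension[of "cs ! q" u] chain_nth_less un by fastforce
    then show ?thesis using less_lower_index_iff[OF True, of u] by simp
  next
    case False then show ?thesis using lower_index_le[of u] by simp
  qed
  show "Suc q \<le> hi u"
  proof (cases q)
    case 0 then show ?thesis using upper_index_bounds[of u] by simp
  next
    case (Suc i)
    then have i: "i < length cs" "i < q" using q by (auto simp: chain_before_def)
    then have "(u, cs ! i) \<notin> le" using lt[of i] extension[of u "cs ! i"] chain_nth_less un by fastforce
    then show ?thesis using upper_index_le_iff[OF i(1), of u] Suc by simp
  qed
qed

lemma classified_step:
  assumes c: "classified (Suc t) s" and t: "t < length es" "u = es ! t" "u \<notin> set cs"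
    and up: "mem z Upper = (mem s Upper)[fp + u := hi u]"
    and bn: "mem z BucketNext = (mem s BucketNext)[fp + u := mem s Bucket ! (fp + lo u)]"
    and b: "mem z Bucket = (mem s Bucket)[fp + lo u := u]"
    and s: "ready s"
  shows "classified t z"
proof -
  have drop: "drop t es = u # drop (Suc t) es" using t by (simp add: Cons_nth_drop_Suc)
  then have u: "u \<notin> set (drop (Suc t) es)"
    using distinct_es by (metis distinct.simps(2) distinct_drop)
  have un: "u < n" "lo u \<le> n" using t nth_es_less lower_index_le[of u] length_chain_le length_es_le by simp_all
  note sD = readyD[OF s]
  have room: "fp + u < frame_space n" "fp + lo u < frame_space n" using un room1 by simp_all
  have "linked (\<lambda>u. mem z BucketNext ! (fp + u)) n (mem z Bucket ! (fp + i))
       (filter (\<lambda>u. u \<notin> set cs \<and> lo u = i) (drop t es))" if i: "i \<le> length cs" for i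
  proof -
    have "linked (\<lambda>w. mem z BucketNext ! (fp + w)) n a (filter (\<lambda>u. u \<notin> set cs \<and> lo u = i) (drop (Suc t) es))
      = linked (\<lambda>w. mem s BucketNext ! (fp + w)) n a (filter (\<lambda>u. u \<notin> set cs \<and> lo u = i) (drop (Suc t) es))" for a
    proof (rule linked_cong)
      fix w assume "w \<in> set (filter (\<lambda>u. u \<notin> set cs \<and> lo u = i) (drop (Suc t) es))"
      then have "w \<noteq> u" using u by auto
      then show "mem z BucketNext ! (fp + w) = mem s BucketNext ! (fp + w)" by (simp add: bn)
    qed
    moreover have "linked (\<lambda>w. mem s BucketNext ! (fp + w)) n (mem s Bucket ! (fp + i))
        (filter (\<lambda>u. u \<notin> set cs \<and> lo u = i) (drop (Suc t) es))"
      using c i by (simp add: classified_def)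
    ultimately show ?thesis using t room by (auto simp: drop b bn sD nth_list_update)
  qed
  moreover have "mem z Upper ! (fp + w) = hi w" if "w \<in> set (drop t es) - set cs" for w
    using that c room by (auto simp: drop up sD nth_list_update classified_def)
  ultimately show ?thesis by (simp add: classified_def)
qed

text \<open>The searches start at q + 1 and q, and their lengths (\<open>hi u\<close> - q) and (q +
  1 - \<open>lo u\<close>) add up to a bound without q.\<close>

lemma classify_element:
  assumes s: "chained s" and t: "t < length es" "u = es ! t" "u \<notin> set cs"
    and regs: "regs s ru = u" "regs s rs = q" and q: "chain_before q t" and c: "classified (Suc t) s"
  shows "wp B classify_element (\<lambda>z. frame {rv, rx, rj} {Upper, Bucket, BucketNext} s z \<and>
      kept {Upper, Bucket, BucketNext} s z \<and> classified t z \<and>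
      clock z \<le> clock s + 150 + 50 * (hi u - lo u)) s" (is "wp B _ ?Q s")
proof -
  note sD = chainedD[OF s]
  have un: "u < n" "lo u \<le> n" using t nth_es_less lower_index_le[of u] length_chain_le length_es_le by simp_all
  have room: "fp + u < frame_space n" "fp + lo u < frame_space n" using un room1 by simp_all
  note idx = chain_before_index[OF q t]
  have ql: "q \<le> length cs" using q by (simp add: chain_before_def)
  have push: "wp B push_bucket ?Q s2"
    if s2: "frame {rv, rx, rj} {Upper} s s2" "regs s2 rj = lo u" "mem s2 Upper = (mem s Upper)[fp + u := hi u]"
      and c2: "clock s2 \<le> clock s + 130 + 50 * (hi u - lo u)" for s2
  proof -
    have rz: "ready s2" using ready_frame[OF sD(1) s2(1)] by simp
    have r2: "regs s2 rfp = fp" "regs s2 ru = u" "mem s2 Bucket = mem s Bucket" "mem s2 BucketNext = mem s BucketNext"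
      using s2(1) sD regs by (auto simp: frame_def)
    have fr: "frame {rv, rx, rj} {Upper, Bucket, BucketNext} s s2" using frame_mono[OF s2(1)] by auto
    have cl: "classified t z" if "mem z Upper = (mem s Upper)[fp + u := hi u]" 
       "mem z BucketNext = (mem s BucketNext)[fp + u := mem s Bucket ! (fp + lo u)]"
       "mem z Bucket = (mem s Bucket)[fp + lo u := u]" for z
      by (rule classified_step[OF c t that sD(1)])
    show ?thesis
      unfolding push_bucket_def using room fr c2
      by (simp add: r2 s2 readyD[OF rz] readyD[OF sD(1)] cl kept_def)
  qed
  have low: "wp B lower_search (wp B push_bucket ?Q) s1"
    if s1: "frame {rv, rx, rj} {Upper} s s1" "regs s1 rj = q" "regs s1 rx = 0" "mem s1 Upper = (mem s Upper)[fp + u := hi u]"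
      and c1: "clock s1 \<le> clock s + 80 + 50 * (hi u - Suc q)" for s1
  proof (rule wp_mono[OF lower_search])
    show "chained s1" using chained_frame[OF s s1(1)] by simp
    show "regs s1 ru = u" using s1 regs by (simp add: frame_def)
    fix z assume *: "frame {rv, rx, rj} {} s1 z \<and> regs z rj = lo u \<and> clock z \<le> clock s1 + 50 * (1 + q - lo u)"
    show "wp B push_bucket ?Q z"
    proof (rule push)
      show "frame {rv, rx, rj} {Upper} s z" using frame_trans[OF s1(1) conjunct1[OF *]] by auto
      show "mem z Upper = (mem s Upper)[fp + u := hi u]" using s1 * by (auto simp: frame_def)
      show "clock z \<le> clock s + 130 + 50 * (hi u - lo u)" using * c1 idx by linarith
    qed (use * in simp)
  qed (use un ql idx s1 in auto)
  have up: "wp B upper_search (wp B (Upper\<lbrakk>V rfp \<oplus> V ru\<rbrakk> ::= V rj ;;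
     rj ::= V rs ;; rx ::= N 0 ;; lower_search ;; push_bucket) ?Q) s1"
    if s1: "frame {rv, rx, rj} {} s s1" "regs s1 rj = Suc q" "regs s1 rx = 0" and c1: "clock s1 \<le> clock s + 10" for s1
  proof (rule wp_mono[OF upper_search])
    show "chained s1" using chained_frame[OF s s1(1)] by simp
    show "regs s1 ru = u" using s1 regs by (simp add: frame_def)
    fix z assume *: "frame {rv, rx, rj} {} s1 z \<and> regs z rj = hi u \<and> clock z \<le> clock s1 + 50 * (1 + hi u - Suc q)"
    have fr: "frame {rv, rx, rj} {} s z" using frame_trans[OF s1(1) conjunct1[OF *]] by auto
    then have fr': "frame {rv, rx, rj} {Upper} s z" by (rule frame_mono) auto
    have z: "regs z ru = u" "regs z rs = q" "regs z rfp = fp" "mem z = mem s" using fr regs sD by (auto simp: frame_def fun_eq_iff)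
    show "wp B (Upper\<lbrakk>V rfp \<oplus> V ru\<rbrakk> ::= V rj ;;
     rj ::= V rs ;; rx ::= N 0 ;; lower_search ;; push_bucket) ?Q z"
      unfolding wp_Seq wp_Store wp_Assign
    proof (intro conjI low)
      show "aval (V rfp \<oplus> V ru) (regs z) < length (mem z Upper)"
        using room by (simp add: z readyD[OF sD(1)])
    qed (use * c1 fr' idx in \<open>auto simp: z\<close>)
  qed (use un ql idx s1 in auto)
  show ?thesis
    unfolding classify_element_def wp_Seq wp_Assign
    by (rule up[unfolded wp_Seq wp_Assign]) (auto simp: regs)
qed

lemma chain_before_step:
  assumes q: "chain_before q (Suc t)" and t: "t < length es"
  shows "es ! t \<notin> set cs \<Longrightarrow> chain_before q t"
    and "es ! t \<in> set cs \<Longrightarrow> 0 < q \<and> es ! t = cs ! (q - 1) \<and> chain_before (q - 1) t"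
proof -
  have take: "set (take (Suc t) es) = insert (es ! t) (set (take t es))"
    using t by (simp add: take_Suc_conv_app_nth)
  have fresh: "es ! t \<notin> set (take t es)"
    using distinct_es t by (auto simp: in_set_conv_nth distinct_conv_nth)
  {
    assume "es ! t \<notin> set cs"
    then have "cs ! i \<noteq> es ! t" if "i < length cs" for i using nth_mem[OF that] by auto
    then show "chain_before q t" using q by (auto simp: chain_before_def take)
  next
    assume "es ! t \<in> set cs"
    then obtain i where i: "i < length cs" "cs ! i = es ! t" by (auto simp: in_set_conv_nth)
    then have iq: "i < q" using q by (auto simp: chain_before_def take)
    \<comment> \<open>Otherwise the last counted chain element would have a larger name than
      \<open>es ! t\<close> and yet precede it in the sorted list.\<close>
    have "\<not> i < q - 1"
    proof
      assume *: "i < q - 1"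
      then have lt: "cs ! i < cs ! (q - 1)" using q by (intro chain_nat_less) (auto simp: chain_before_def)
      have "q - 1 < length cs" "q - 1 < q" using q iq by (auto simp: chain_before_def)
      then have "cs ! (q - 1) \<in> set (take (Suc t) es)" using q unfolding chain_before_def by blast
      then have "cs ! (q - 1) \<in> set (take t es)" using lt i by (auto simp: take)
      then obtain k where "k < t" "cs ! (q - 1) = es ! k" by (auto simp: in_set_conv_nth)
      then show False using lt i sorted_es t by (auto simp: sorted_wrt_iff_nth_less dest: less_asym)
    qed
    then have q1: "i = q - 1" using iq by simp
    have "j < q - 1 \<longleftrightarrow> cs ! j \<in> set (take t es)" if j: "j < length cs" for j
    proof -
      have "cs ! j = cs ! i \<longleftrightarrow> j = i" using i(1) j distinct_chain nth_eq_iff_index_eq by blast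
      moreover have "j < q \<longleftrightarrow> cs ! j \<in> set (take (Suc t) es)" using q j by (simp add: chain_before_def)
      ultimately show ?thesis using fresh i q1 iq by (cases "j = i") (auto simp: take)
    qed
    then show "0 < q \<and> es ! t = cs ! (q - 1) \<and> chain_before (q - 1) t"
      using i iq q1 q by (auto simp: chain_before_def)
  }
qed

lemma classify_step:
  assumes s: "chained s" and t: "t < length es"
    and regs: "regs s rt = Suc t" "regs s rs = q" and q: "chain_before q (Suc t)" and c: "classified (Suc t) s"
  shows "wp B classify_step (\<lambda>z. frame {rt, ru, rv, rs, rx, rj} {Upper, Bucket, BucketNext} s z \<and>
      kept {Upper, Bucket, BucketNext} s z \<and> regs z rt = t \<and> chain_before (regs z rs) t \<and> classified t z \<and>
      clock z \<le> clock s + 190 + 50 * (if es ! t \<in> set cs then 0 else hi (es ! t) - lo (es ! t))) s"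
    (is "wp B _ ?Q s")
proof -
  note sD = chainedD[OF s] readyD[OF chainedD(1)[OF s]]
  define u where "u = es ! t"
  have un: "u < n" using t nth_es_less by (simp add: u_def)
  have qk: "q \<le> length cs" using q by (simp add: chain_before_def)
  have drop: "drop t es = u # drop (Suc t) es" using t by (simp add: Cons_nth_drop_Suc u_def)
  note before = chain_before_step[OF q t, folded u_def]
  let ?F = "frame {rt, ru, rv, rs, rx, rj} {Upper, Bucket, BucketNext}"
  define Q where "Q = ?Q"
  have elem: "wp B classify_element Q s1"
    if s1: "frame {rt, ru, rv} {} s s1" "regs s1 rt = t" "regs s1 ru = u" and c1: "clock s1 \<le> clock s + 30"
      and u: "u \<notin> set cs" for s1
  proof (rule wp_mono[OF classify_element])
    show ch: "chained s1" using chained_frame[OF s s1(1)] by simp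
    have m: "mem s1 = mem s" "regs s1 rs = q" using s1 regs by (auto simp: frame_def fun_eq_iff)
    show "regs s1 rs = q" by (rule m)
    show "classified (Suc t) s1" using c by (simp add: classified_def m)
    show "chain_before q t" using before(1)[OF u] .
    fix z assume *: "frame {rv, rx, rj} {Upper, Bucket, BucketNext} s1 z \<and>
      kept {Upper, Bucket, BucketNext} s1 z \<and> classified t z \<and> clock z \<le> clock s1 + 150 + 50 * (hi u - lo u)"
    have "?F s z" using frame_trans[OF s1(1) conjunct1[OF *]] by auto
    moreover have "regs z rt = t" "regs z rs = q" using * s1 m by (auto simp: frame_def)
    ultimately show "Q z" using * m before(1)[OF u] c1 u by (auto simp: Q_def kept_def u_def)
  qed (use t u s1 u_def in auto)
  have keep: "classified t z" if "mem z = mem s" "u \<in> set cs" for z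
    using c that by (auto simp: classified_def drop)
  \<comment> \<open>For q = 0 the register holds n, which differs from every element, so a single
    comparison recognizes chain elements.\<close>
  have test: "u = (if 0 < q then cs ! (q - 1) else n) \<longleftrightarrow> u \<in> set cs"
    using before(2) un qk by (auto split: if_splits)
  have ft: "fp + t < frame_space n" using t length_es_le room1 by simp
  have "wp B classify_step Q s"
  proof (cases q)
    case 0
    then have "u \<notin> set cs" using before(2) by auto
    then show ?thesis
      unfolding classify_step_def using ft un regs t
      by (simp add: sD 0 u_def[symmetric] elem)
  next
    case (Suc i)
    have "fp + Suc i < frame_space n" using Suc qk length_chain_le length_es_le by (intro room1) simp
    then show ?thesis
      unfolding classify_step_def using ft un regs t test qk before(2)
      by (simp add: sD Suc u_def[symmetric] elem del: add_Suc_right)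
        (simp add: Q_def keep kept_def u_def)
  qed
  then show ?thesis by (simp only: Q_def)
qed

lemma classify_elements:
  assumes s: "chained s"
  shows "wp B classify_elements (\<lambda>z. frame {rt, ru, rv, rs, rx, rj} {Upper, Bucket, BucketNext} s z \<and>
      kept {Upper, Bucket, BucketNext} s z \<and> classified 0 z \<and>
      clock z \<le> clock s + 50 + 250 * length es + 50 * (\<Sum>u\<in>set es - set cs. hi u - lo u)) s"
    (is "wp B _ ?Q s")
proof -
  note sD = chainedD[OF s] readyD[OF chainedD(1)[OF s]]
  let ?F = "frame {rt, ru, rv, rs, rx, rj} {Upper, Bucket, BucketNext}"
  define I where "I m z \<longleftrightarrow> ?F s z \<and> kept {Upper, Bucket, BucketNext} s z \<and> regs z rt = m \<and> m \<le> length es \<and>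
    chain_before (regs z rs) m \<and> classified m z \<and>
    clock z \<le> clock s + 40 + 20 * length es + 200 * (length es - m) + 50 * (\<Sum>u\<in>set (drop m es) - set cs. hi u - lo u)" for m z
  have loop: "wp B (WHILE N 0 \<lhd> V rt DO classify_step) ?Q s2" if "I (length es) s2" for s2
  proof (rule wp_While[where I = I])
    show "I (length es) s2" by fact
  next
    fix m z assume I: "I m z" and "bval (N 0 \<lhd> V rt) (regs z)"
    then obtain t where m: "m = Suc t" by (cases m) (auto simp: I_def)
    have t: "t < length es" using I by (auto simp: I_def m)
    have fr: "?F s z" using I by (simp add: I_def)
    have z: "chained z" using chained_frame[OF s fr] by simp
    have drop: "drop t es = es ! t # drop (Suc t) es" using t by (simp add: Cons_nth_drop_Suc)
    then have "es ! t \<notin> set (drop (Suc t) es)"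
      using distinct_es by (metis distinct.simps(2) distinct_drop)
    then have sum: "(\<Sum>u\<in>set (drop t es) - set cs. hi u - lo u) = (if es ! t \<in> set cs then 0 else hi (es ! t) - lo (es ! t))
        + (\<Sum>u\<in>set (drop m es) - set cs. hi u - lo u)"
      by (auto simp: drop m insert_Diff_if)
    show "wp B classify_step (\<lambda>u. \<exists>m'<m. I m' u) (tick (1 + bcost (N 0 \<lhd> V rt)) z)"
    proof (rule wp_mono[OF classify_step[where t = t and q = "regs z rs"]])
      show "chained (tick (1 + bcost (N 0 \<lhd> V rt)) z)" using chained_frame[OF z, of "{}" "{}"] by simp
      fix w assume w: "frame {rt, ru, rv, rs, rx, rj} {Upper, Bucket, BucketNext} (tick (1 + bcost (N 0 \<lhd> V rt)) z) w \<and>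
        kept {Upper, Bucket, BucketNext} (tick (1 + bcost (N 0 \<lhd> V rt)) z) w \<and> regs w rt = t \<and>
        chain_before (regs w rs) t \<and> classified t w \<and>
        clock w \<le> clock (tick (1 + bcost (N 0 \<lhd> V rt)) z) + 190 +
          50 * (if es ! t \<in> set cs then 0 else hi (es ! t) - lo (es ! t))"
      then have "?F s w" using frame_trans[OF fr, of _ _ w] by auto
      obtain d where d: "length es = Suc t + d" using t le_Suc_ex[of "Suc t" "length es"] by auto
      have "I t w" using w I \<open>?F s w\<close> sum by (auto simp: I_def kept_def m d)
      then show "\<exists>m'<m. I m' w" using m by auto
    qed (use I t in \<open>auto simp: I_def m classified_def\<close>)
  next
    fix m z assume I: "I m z" and b: "\<not> bval (N 0 \<lhd> V rt) (regs z)"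
    then have "m = 0" by (simp add: I_def)
    then show "?Q (tick (1 + bcost (N 0 \<lhd> V rt)) z)"
      using I by (auto simp: I_def classified_def kept_def)
  qed
  define J where "J i z \<longleftrightarrow> ?F s z \<and> kept {Upper, Bucket, BucketNext} s z \<and> regs z rt = i \<and> i \<le> length cs + 1 \<and>
    (\<forall>j<i. mem z Bucket ! (fp + j) = n) \<and> clock z \<le> clock s + 10 + 20 * i" for i z
  show ?thesis
    unfolding classify_elements_eq wp_Seq
  proof (rule wp_for[where I = J and m = "length cs + 1"])
    show "J 0 (tick 2 (set_reg rt 0 s))" by (simp add: J_def kept_def)
  next
    fix i z assume "J i z"
    then show "i \<le> length cs + 1 \<and> regs z rt = i \<and> aval (V rk \<oplus> N 1) (regs z) = length cs + 1"
      using sD by (auto simp: J_def frame_def)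
  next
    fix i z assume J: "J i z" and i: "i < length cs + 1"
    have fr: "?F s z" using J by (simp add: J_def)
    have z: "chained z" using chained_frame[OF s fr] by simp
    note zD = chainedD[OF z] readyD[OF chainedD(1)[OF z]]
    have "fp + i < frame_space n" using i length_chain_le length_es_le by (intro room1) simp
    then show "wp B (Bucket\<lbrakk>V rfp \<oplus> V rt\<rbrakk> ::= V rn) (\<lambda>u. regs u rt = i \<and> J (Suc i) (tick 4 (set_reg rt (Suc i) u)))
        (tick (3 + acost (V rk \<oplus> N 1)) z)"
      using J i by (auto simp: J_def zD kept_def nth_list_update)
  next
    fix z assume J: "J (length cs + 1) z"
    have fr: "?F s z" using J by (simp add: J_def)
    have z: "chained z" using chained_frame[OF s fr] by simp
    note zD = chainedD[OF z] readyD[OF chainedD(1)[OF z]]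
    have "chain_before (length cs) (length es)" using chain_mem by (auto simp: chain_before_def)
    then show "wp B (rs ::= V rk) (wp B (rt ::= V rm) (wp B (WHILE N 0 \<lhd> V rt DO classify_step) ?Q))
        (tick (3 + acost (V rk \<oplus> N 1)) z)"
      using J length_chain_le
      by (simp del: One_nat_def, intro loop) (auto simp: I_def J_def zD classified_def kept_def)
  qed
qed

end

section \<open>The incremental updates\<close>

fun merge :: "nat list \<Rightarrow> nat list \<Rightarrow> nat list" where
  "merge [] ys = ys"
| "merge xs [] = xs"
| "merge (x # xs) (y # ys) = (if y < x then y # merge (x # xs) ys else x # merge xs (y # ys))"

lemma merge_Nil2 [simp]: "merge xs [] = xs"
  by (cases xs) auto

lemma set_merge [simp]: "set (merge xs ys) = set xs \<union> set ys"
  by (induction xs ys rule: merge.induct) auto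

lemma length_merge [simp]: "length (merge xs ys) = length xs + length ys"
  by (induction xs ys rule: merge.induct) auto

lemma sorted_merge:
  "sorted_wrt (<) xs \<Longrightarrow> sorted_wrt (<) ys \<Longrightarrow> set xs \<inter> set ys = {} \<Longrightarrow> sorted_wrt (<) (merge xs ys)"
proof (induction xs ys rule: merge.induct)
  case (3 x xs y ys)
  show ?case
  proof (cases "y < x")
    case True then show ?thesis using 3 by auto
  next
    case False
    then have "x < y" using "3.prems"(3) by auto
    then show ?thesis using 3 by auto
  qed
qed auto

lemma take_Suc_update: "q < length xs \<Longrightarrow> take (Suc q) (xs[q := x]) = take q xs @ [x]"
  by (simp add: take_Suc_conv_app_nth)

context node_chain
begin

text \<open>
  The elements of $P_i$ and $P_{i-1}$ (where $P_{-1}$ is empty), those that are in both, and those that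
  are new in $P_i$.
\<close>

definition part :: "nat \<Rightarrow> nat list" where
  "part i = filter (\<lambda>u. lo u \<le> i \<and> i < hi u) es"

definition part_before :: "nat \<Rightarrow> nat list" where
  "part_before i = filter (\<lambda>u. lo u < i \<and> i \<le> hi u) es"

definition part_common :: "nat \<Rightarrow> nat list" where
  "part_common i = filter (\<lambda>u. lo u < i \<and> i < hi u) es"

definition part_new :: "nat \<Rightarrow> nat list" where
  "part_new i = filter (\<lambda>u. u \<notin> set cs \<and> lo u = i) es"

lemma part_before_Suc: "part_before (Suc i) = part i"
  by (simp add: part_before_def part_def less_Suc_eq_le Suc_le_eq)

lemma part_before_0: "part_before 0 = []"
  by (simp add: part_before_def)

lemma set_part: "i \<le> length cs \<Longrightarrow> set (part i) = sub_poset le (set es) cs i"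
  by (auto simp: part_def sub_poset_iff)

lemma part_common_eq: "part_common i = filter (\<lambda>u. hi u \<noteq> i) (part_before i)"
  by (auto simp: part_common_def part_before_def intro: filter_cong)

text \<open>Strictly sorted lists with equal sets are equal. A bucket element needs no test
  \<open>i < hi u\<close>, because an element off the chain has \<open>lo u < hi u\<close>.\<close>

lemma part_eq: "part i = merge (part_common i) (part_new i)"
proof (rule strict_sorted_equal)
  have sorted: "sorted_wrt (<) (filter p es)" for p using sorted_es by (rule sorted_wrt_filter)
  show "sorted_wrt (<) (part i)" unfolding part_def by (rule sorted)
  show "sorted_wrt (<) (merge (part_common i) (part_new i))"
    using sorted by (intro sorted_merge) (auto simp: part_common_def part_new_def)
  show "set (part i) = set (merge (part_common i) (part_new i))"
    using in_chain_iff chain_index_less by (fastforce simp: part_common_def part_new_def part_def)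
qed

lemma length_part_le: "length (part i) \<le> n" "length (part_before i) \<le> n"
  using length_es_le by (auto simp: part_def part_before_def intro: le_trans[OF length_filter_le])

text \<open>The elements of $D_i \setminus D_{i-1}$, in the order in which they are appended.\<close>

definition appended :: "nat \<Rightarrow> nat list" where
  "appended i = filter (\<lambda>u. hi u = i) (part_before i) @ (if 0 < i then [cs ! (i - 1)] else [])"

text \<open>An element with upper index i > 0 has its lower index below i, and was then in the
  previous part, or it is c_i itself, stored at position i - 1.\<close>

lemma set_appended: "i \<le> length cs \<Longrightarrow> set (appended i) = {u \<in> set es. hi u = i}"
proof (cases i)
  case 0
  then show ?thesis using upper_index_bounds(1) by (auto simp: appended_def part_before_def Suc_le_eq)
next
  case (Suc k)
  assume i: "i \<le> length cs"
  have "u = cs ! k" if u: "u \<in> set es" "hi u = i" "\<not> lo u < i" for u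
  proof -
    have "u \<in> set cs" using u chain_index_less[of u] by auto
    then obtain j where "j < length cs" "u = cs ! j" by (auto simp: in_set_conv_nth)
    then show ?thesis using u index_chain[of j] Suc by simp
  qed
  moreover have "set (appended i) = {u \<in> set es. lo u < i \<and> hi u = i} \<union> {cs ! k}"
    by (auto simp: appended_def part_before_def Suc)
  moreover have "cs ! k \<in> set es" "hi (cs ! k) = i"
    using i Suc chain_mem[of k] index_chain(2)[of k] by auto
  ultimately show ?thesis by blast
qed

lemma distinct_appended: "i \<le> length cs \<Longrightarrow> distinct (appended i)"
  using distinct_es index_chain[of "i - 1"] by (auto simp: appended_def part_before_def)

section \<open>Incremental update of the ideal and of the poset\<close>

definition ideal_step :: "(register, array) com" where
  "ideal_step =
     ru ::= Elems\<lbrakk>V rfp \<oplus> V rw \<oplus> V rt\<rbrakk> ;;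
     rx ::= Upper\<lbrakk>V rfp \<oplus> V ru\<rbrakk> ;;
     IF V rx \<doteq> V ri
     THEN (rx ::= Label\<lbrakk>V ru\<rbrakk> ;; Ideal\<lbrakk>V rlen\<rbrakk> ::= V rx ;; rlen ::= V rlen \<oplus> N 1)
     ELSE (Temp\<lbrakk>V rs\<rbrakk> ::= V ru ;; rs ::= V rs \<oplus> N 1)"

definition append_chain_element :: "(register, array) com" where
  "append_chain_element =
     IF N 0 \<lhd> V ri
     THEN (
       ru ::= Chain\<lbrakk>V rfp \<oplus> V ri\<rbrakk> ;;
       rx ::= Label\<lbrakk>V ru\<rbrakk> ;;
       Ideal\<lbrakk>V rlen\<rbrakk> ::= V rx ;;
       rlen ::= V rlen \<oplus> N 1)
     ELSE Skip"

lemma update_ideal_eq: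
  "update_ideal = (rs ::= N 0 ;; (FOR rt < V rr DO ideal_step) ;; append_chain_element)"
  by (simp add: update_ideal_def ideal_step_def append_chain_element_def)

lemma update_ideal:
  assumes s: "chained s" and c: "classified 0 s" and ne: "es \<noteq> []" and i: "regs s ri = i" "i \<le> length cs"
    and rr: "regs s rr = length (part_before i)"
    and elems: "\<forall>t<length (part_before i). mem s Elems ! (fp + (n + 2) + t) = part_before i ! t"
    and len: "regs s rlen = l" "l + length (appended i) \<le> n"
  shows "wp B update_ideal (\<lambda>z. frame {rs, rt, ru, rx, rlen} {Ideal, Temp} s z \<and>
      regs z rs = length (part_common i) \<and> take (length (part_common i)) (mem z Temp) = part_common i \<and>
      regs z rlen = l + length (appended i) \<and>
      take (l + length (appended i)) (mem z Ideal) = take l (mem s Ideal) @ map ((!) L) (appended i) \<and>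
      clock z \<le> clock s + 50 + 60 * length (part_before i)) s" (is "wp B _ ?Q s")
proof -
  note sD = chainedD[OF s] readyD[OF chainedD(1)[OF s]]
  have Ln: "length L = n" using readyD(1)[OF chainedD(1)[OF s], of Label] readyD(4)[OF chainedD(1)[OF s]] by simp
  let ?F = "frame {rs, rt, ru, rx, rlen} {Ideal, Temp}"
  let ?es = "part_before i"
  define X where "X t = filter (\<lambda>u. hi u = i) (take t ?es)" for t
  define Y where "Y t = filter (\<lambda>u. hi u \<noteq> i) (take t ?es)" for t
  define I where "I t z \<longleftrightarrow> ?F s z \<and> t \<le> length ?es \<and> regs z rt = t \<and>
    regs z rs = length (Y t) \<and> take (length (Y t)) (mem z Temp) = Y t \<and>
    regs z rlen = l + length (X t) \<and> take (l + length (X t)) (mem z Ideal) = take l (mem s Ideal) @ map ((!) L) (X t) \<and>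
    clock z \<le> clock s + 10 + 60 * t" for t z
  have X_end: "appended i = X (length ?es) @ (if 0 < i then [cs ! (i - 1)] else [])"
    by (simp add: appended_def X_def)
  have X_le: "length (X t) \<le> length (X (length ?es))" for t
    unfolding X_def by (metis append_take_drop_id filter_append le_add1 length_append take_all_iff order_refl)
  have es_mem: "?es ! t \<in> set es - set cs" if "t < length ?es" for t
  proof -
    have "?es ! t \<in> set ?es" using that by simp
    then show ?thesis using in_chain_iff[of "?es ! t"] by (auto simp: part_before_def)
  qed
  show ?thesis
    unfolding update_ideal_eq wp_Seq wp_Assign
  proof (rule wp_for[where I = I and m = "length ?es"])
    show "I 0 (tick 2 (set_reg rt 0 (tick (1 + acost (N 0)) (set_reg rs (aval (N 0) (regs s)) s))))"
      using len by (simp add: I_def X_def Y_def)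
  next
    fix t z assume "I t z"
    then show "t \<le> length ?es \<and> regs z rt = t \<and> aval (V rr) (regs z) = length ?es"
      using rr by (auto simp: I_def frame_def)
  next
    fix t z assume I: "I t z" and t: "t < length ?es"
    have fr: "?F s z" using I by (simp add: I_def)
    have z: "chained z" using chained_frame[OF s fr] by simp
    note zD = chainedD[OF z] readyD[OF chainedD(1)[OF z]]
    have zr: "mem z Elems = mem s Elems" "mem z Upper = mem s Upper" "regs z ri = i"
      using fr i by (auto simp: frame_def)
    define u where "u = ?es ! t"
    have u: "u \<in> set es - set cs" using es_mem[OF t] by (simp add: u_def)
    have un: "u < n" using u es_less by simp
    have up: "mem s Upper ! (fp + u) = hi u" using c u by (simp add: classified_def)
    have tn: "t < n" using t length_part_le(2)[of i] by simp
    have room: "fp + (n + 2) + t < frame_space n" "fp + u < frame_space n"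
      using room1[of u] room2[of t] un tn ne by auto
    have e: "mem s Elems ! (fp + (n + 2) + t) = u" using elems t by (simp add: u_def)
    have X: "X (Suc t) = X t @ (if hi u = i then [u] else [])"
      and Y: "Y (Suc t) = Y t @ (if hi u = i then [] else [u])"
      using t by (simp_all add: X_def Y_def take_Suc_conv_app_nth u_def)
    have "length (Y t) \<le> t" unfolding Y_def by (rule le_trans[OF length_filter_le]) simp
    then have Yn: "length (Y t) < n" using tn by simp
    \<comment> \<open>The elements moved so far form a prefix of \<open>appended i\<close>, so
      \<open>Ideal\<close> has room for the next one.\<close>
    have Xn: "l + length (X t) < n" if "hi u = i"
      using X_le[of "Suc t"] X that len by (simp add: X_end)
    show "wp B ideal_step (\<lambda>u. regs u rt = t \<and> I (Suc t) (tick 4 (set_reg rt (Suc t) u))) (tick (3 + acost (V rr)) z)"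
      using I t room Yn Xn un e up unfolding ideal_step_def I_def
      by (auto simp: zD zr sD Ln X Y take_Suc_update)
  next
    fix z assume I: "I (length ?es) z"
    have fr: "?F s z" using I by (simp add: I_def)
    have z: "chained z" using chained_frame[OF s fr] by simp
    note zD = chainedD[OF z] readyD[OF chainedD(1)[OF z]]
    have zi: "regs z ri = i" using fr i by (simp add: frame_def)
    have Y: "Y (length ?es) = part_common i" by (simp add: Y_def part_common_eq)
    show "wp B append_chain_element ?Q (tick (3 + acost (V rr)) z)"
    proof (cases i)
      case 0
      then show ?thesis
        using I zi X_end Y unfolding append_chain_element_def I_def by simp
    next
      case (Suc k)
      then have k: "k < length cs" using i by simp
      have "fp + Suc k < frame_space n" using k length_chain_le length_es_le by (intro room1) simp
      moreover have "l + length (X (length ?es)) < n" using len Suc X_end by simp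
      ultimately show ?thesis
        using I zi Suc chain_nth_less[OF k] k X_end Y unfolding append_chain_element_def I_def
        by (simp add: zD Ln del: add_Suc_right) (simp add: zD take_Suc_update)
    qed
  qed
qed

definition poset_step :: "(register, array) com" where
  "poset_step =
     IF V rt \<lhd> V rs THEN ru ::= Temp\<lbrakk>V rt\<rbrakk> ELSE ru ::= V rn ;;
     IF V rv \<lhd> V ru
     THEN (Elems\<lbrakk>V rfp \<oplus> V rw \<oplus> V rr\<rbrakk> ::= V rv ;; rv ::= BucketNext\<lbrakk>V rfp \<oplus> V rv\<rbrakk>)
     ELSE (Elems\<lbrakk>V rfp \<oplus> V rw \<oplus> V rr\<rbrakk> ::= V ru ;; rt ::= V rt \<oplus> N 1) ;;
     rr ::= V rr \<oplus> N 1"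

lemma update_poset_eq:
  "update_poset = (rt ::= N 0 ;; rr ::= N 0 ;; rv ::= Bucket\<lbrakk>V rfp \<oplus> V ri\<rbrakk> ;;
     WHILE V rt \<lhd> V rs OR V rv \<lhd> V rn DO poset_step)"
  by (simp add: update_poset_def poset_step_def)

lemma update_poset:
  assumes s: "chained s" and c: "classified 0 s" and ne: "es \<noteq> []" and i: "regs s ri = i" "i \<le> length cs"
    and rs: "regs s rs = length (part_common i)" "take (length (part_common i)) (mem s Temp) = part_common i"
  shows "wp B update_poset (\<lambda>z. frame {rt, rr, rv, ru} {Elems} s z \<and>
      regs z rr = length (part i) \<and> (\<forall>t<length (part i). mem z Elems ! (fp + (n + 2) + t) = part i ! t) \<and>
      (\<forall>p<fp + (n + 2). mem z Elems ! p = mem s Elems ! p) \<and>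
      clock z \<le> clock s + 50 + 60 * length (part i)) s" (is "wp B _ ?Q s")
proof -
  note sD = chainedD[OF s] readyD[OF chainedD(1)[OF s]]
  let ?F = "frame {rt, rr, rv, ru} {Elems}"
  let ?nx = "\<lambda>u. mem s BucketNext ! (fp + u)"
  let ?b = "V rt \<lhd> V rs OR V rv \<lhd> V rn :: register bexp"
  \<comment> \<open>zs is the part already written, ys the rest of the bucket. On both sides n
    signals exhaustion, which makes one comparison enough: a real element is always smaller.\<close>
  define J where "J m z t ys zs \<longleftrightarrow> ?F s z \<and> regs z rt = t \<and> t \<le> length (part_common i) \<and>
    regs z rr = length zs \<and> linked ?nx n (regs z rv) ys \<and> set ys \<subseteq> {..<n} \<and>
    part i = zs @ merge (drop t (part_common i)) ys \<and> (\<forall>j<length zs. mem z Elems ! (fp + (n + 2) + j) = zs ! j) \<and>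
    (\<forall>p<fp + (n + 2). mem z Elems ! p = mem s Elems ! p) \<and>
    m = length (part i) - length zs \<and> clock z \<le> clock s + 30 + 60 * length zs" for m :: nat and z t ys zs
  have temp: "mem s Temp ! t = part_common i ! t" if "t < length (part_common i)" for t
    using that by (metis nth_take rs(2))
  have loop: "wp B (WHILE ?b DO poset_step) ?Q s1" if "J (length (part i)) s1 0 (part_new i) []" for s1
  proof (rule wp_While[where I = "\<lambda>m z. \<exists>t ys zs. J m z t ys zs"])
    show "\<exists>t ys zs. J (length (part i)) s1 t ys zs" using that by blast
  next
    fix m z assume "\<exists>t ys zs. J m z t ys zs" and b: "bval ?b (regs z)"
    then obtain t ys zs where J: "J m z t ys zs" by blast
    have fr: "?F s z" using J by (simp add: J_def)
    have zr: "regs z rfp = fp" "mem z Temp = mem s Temp" "mem z BucketNext = mem s BucketNext"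
        "regs z rs = length (part_common i)" "regs z rt = t" "regs z rr = length zs"
      using fr rs sD J by (auto simp: frame_def J_def)
    have z: "ready z" using ready_frame[OF chainedD(1)[OF s] fr] by simp
    note zD = readyD[OF z]
    define xs where "xs = drop t (part_common i)"
    have t_iff: "t < length (part_common i) \<longleftrightarrow> xs \<noteq> []" by (auto simp: xs_def)
    have xs: "xs = part_common i ! t # drop (Suc t) (part_common i)" "part_common i ! t < n"
      "mem s Temp ! t = part_common i ! t" "t < n" "Suc t \<le> length (part_common i)" if "xs \<noteq> []"
    proof -
      have t: "t < length (part_common i)" using that t_iff by simp
      show "xs = part_common i ! t # drop (Suc t) (part_common i)" using t by (simp add: xs_def Cons_nth_drop_Suc)
      have "part_common i ! t \<in> set es" using nth_mem[OF t] by (auto simp: part_common_def)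
      then show "part_common i ! t < n" by (rule es_less)
      show "mem s Temp ! t = part_common i ! t" by (rule temp[OF t])
      have "length (part_common i) \<le> n"
        unfolding part_common_def using length_es_le by (rule le_trans[OF length_filter_le])
      then show "t < n" using t by simp
      show "Suc t \<le> length (part_common i)" using t by simp
    qed
    have ys: "regs z rv < n \<longleftrightarrow> ys \<noteq> []" using J by (cases ys) (auto simp: J_def)
    have ne': "xs \<noteq> [] \<or> ys \<noteq> []" using b t_iff ys zr zD by auto
    have part: "part i = zs @ merge xs ys" using J by (simp add: J_def xs_def)
    have less: "length zs < length (part i)" using ne' by (auto simp: part)
    have room: "fp + (n + 2) + length zs < frame_space n"
      using less length_part_le(1)[of i] ne by (intro room2) auto
    have el: "(\<forall>j<length (zs @ [v]). (mem z Elems)[fp + (n + 2) + length zs := v] ! (fp + (n + 2) + j) = (zs @ [v]) ! j) \<and>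
        (\<forall>p<fp + (n + 2). (mem z Elems)[fp + (n + 2) + length zs := v] ! p = mem s Elems ! p)" for v
      using J room by (auto simp: J_def nth_list_update nth_append less_Suc_eq zD)
    have nx: "fp + regs z rv < frame_space n" if "ys \<noteq> []" using ys that by (intro room1) simp
    have m: "length (part i) - Suc (length zs) < m" using J less by (simp add: J_def)
    note J' = J[unfolded J_def, folded xs_def]
    consider (x) "xs \<noteq> []" "ys \<noteq> [] \<Longrightarrow> part_common i ! t \<le> regs z rv" | (y) "ys \<noteq> []" "xs \<noteq> [] \<Longrightarrow> regs z rv < part_common i ! t"
      using ne' by fastforce
    then show "wp B poset_step (\<lambda>u. \<exists>m'<m. \<exists>t ys zs. J m' u t ys zs) (tick (1 + bcost ?b) z)"
    proof cases
      case x
      have "wp B poset_step (\<lambda>u. J (length (part i) - Suc (length zs)) u (Suc t) ys (zs @ [part_common i ! t])) (tick (1 + bcost ?b) z)"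
        using J' x xs[OF x(1)] room el[of "part_common i ! t"]
        unfolding poset_step_def J_def
        by (cases ys) (simp_all add: zr zD sD)
      then show ?thesis by (rule wp_mono) (use m in blast)
    next
      case y
      then obtain ys' where ys': "ys = regs z rv # ys'" using J by (cases ys) (auto simp: J_def)
      have "wp B poset_step (\<lambda>u. J (length (part i) - Suc (length zs)) u t ys' (zs @ [regs z rv])) (tick (1 + bcost ?b) z)"
        using J' y xs room nx[OF y(1)] el[of "regs z rv"] ys'
        unfolding poset_step_def J_def
        by (cases xs) (simp_all add: zr zD sD t_iff xs_def[symmetric])
      then show ?thesis by (rule wp_mono) (use m in blast)
    qed
  next
    fix m z assume "\<exists>t ys zs. J m z t ys zs" and b: "\<not> bval ?b (regs z)"
    then obtain t ys zs where J: "J m z t ys zs" by blast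
    have "regs z rn = n" "regs z rs = length (part_common i)" using J sD rs by (auto simp: J_def frame_def)
    moreover have "ys = []" using J b calculation by (cases ys) (auto simp: J_def)
    ultimately have "part i = zs" using J b by (auto simp: J_def)
    then show "?Q (tick (1 + bcost ?b) z)" using J by (auto simp: J_def)
  qed
  have "fp + i < frame_space n" using i length_chain_le length_es_le by (intro room1) simp
  moreover have "linked ?nx n (mem s Bucket ! (fp + i)) (part_new i)"
    using c i by (simp add: classified_def part_new_def)
  moreover have "set (part_new i) \<subseteq> {..<n}" using es_less by (auto simp: part_new_def)
  ultimately show ?thesis
    unfolding update_poset_eq wp_Seq wp_Assign wp_Load
    by (intro conjI loop) (simp_all add: J_def part_eq sD i)
qed

end

section \<open>The recursion on the machine\<close>

definition enumerate_round :: "(register, array) com" where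
  "enumerate_round = update_ideal ;; update_poset ;; enumerate_call (V rfp \<oplus> V rw) (V rr) (V rlen)"

lemma card_register: "card (UNIV :: register set) = 15"
proof -
  have eq: "(UNIV :: register set) = {rn, rw, rfp, rm, rlen, rh, rk, ri, rj, rt, rs, rr, ru, rv, rx}"
    by (auto intro: register.exhaust)
  show ?thesis unfolding eq by simp
qed

context relabeled_poset
begin

section \<open>The contract of a recursive call\<close>

definition pair_count :: nat where
  "pair_count = card (incomparable_pairs {..<n} le)"

text \<open>A bound for the local work of any single call, uniform over all calls, needed for the
  time of each individual output.\<close>

definition local_bound :: nat where
  "local_bound = 1000 * (1 + n + pair_count)"

definition max_space :: nat where
  "max_space = (\<Sum>a\<in>UNIV. array_length n a) + (n + 2) * (card (UNIV :: register set) + 1)"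

text \<open>\<open>depth s + length es\<close> never grows, since every nested call loses an
  element; this bounds the call stack and hence the peak. The main call enters with depth 1 and n
  elements. \<open>l + length es \<le> n\<close> keeps the ideal within its array.\<close>

definition call_pre :: "nat \<Rightarrow> nat list \<Rightarrow> nat \<Rightarrow> (register, array) machine \<Rightarrow> bool" where
  "call_pre fp es l s \<longleftrightarrow> node fp es s \<and> regs s rlen = l \<and> l + length es \<le> n \<and>
     depth s + length es \<le> n + 1 \<and> peak s \<le> max_space"

text \<open>\<open>Elems\<close> is protected one frame further than the other arrays: the frame of
  the callee must still hold P_i on return, since the caller derives P_{i+1} from it. The other
  arrays of that frame are scratch.\<close>

definition preserved :: "nat \<Rightarrow> nat \<Rightarrow> (register, array) machine \<Rightarrow> (register, array) machine \<Rightarrow> bool" where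
  "preserved fp l s t \<longleftrightarrow> (\<forall>a. length (mem t a) = length (mem s a)) \<and> (\<forall>a\<in>{Label, Leq}. mem t a = mem s a) \<and>
     (\<forall>p<fp + (n + 2). mem t Elems ! p = mem s Elems ! p) \<and>
     (\<forall>a\<in>{Chain, Upper, Bucket, BucketNext}. \<forall>p<fp. mem t a ! p = mem s a ! p) \<and>
     take l (mem t Ideal) = take l (mem s Ideal)"

text \<open>Two separate time bounds. The total is amortized through the potential. A single output
  may precede the end of the calls that enclose it, so its bound adds one \<open>local_bound\<close>
  for each nonempty active call, of which there are at most \<open>length es\<close>.\<close>

definition call_result :: "nat \<Rightarrow> nat list \<Rightarrow> nat \<Rightarrow> (register, array) machine \<Rightarrow> (register, array) machine \<Rightarrow>
    nat list \<Rightarrow> nat set list \<Rightarrow> bool" where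
  "call_result fp es l s t ts Js \<longleftrightarrow> preserved fp l s t \<and> peak t \<le> max_space \<and>
     visited t = visited s @ zip ts Js \<and> length ts = length Js \<and>
     enumerates r ((!) L ` set es) (set (take l (mem s Ideal))) Js \<and>
     clock t + 113000 * potential le (set es) \<le> clock s + 500000 * length Js \<and>
     (\<forall>k<length Js. ts ! k \<le> clock s + 500000 * (k + 1) + length es * local_bound)"

end

context node_data
begin

section \<open>Local work bounded by incomparable pairs\<close>

lemma finite_incomparable_pairs: "finite A \<Longrightarrow> finite (incomparable_pairs A R)"
  by (rule finite_subset[of _ "Pow A"]) (auto simp: incomparable_pairs_def)

lemma incomparable_pairs_le: "card (incomparable_pairs (set es) le) \<le> pair_count"
  unfolding pair_count_def
  by (intro card_mono finite_incomparable_pairs) (use es_less in \<open>auto simp: incomparable_pairs_def\<close>)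

text \<open>A failed comparison of v with \<open>es ! t\<close> is an incomparable pair, because the
  reverse relation contradicts the order of names. Since v has the smaller name, the pair determines
  both members and is counted once.\<close>

lemma skipped_le: "(\<Sum>t<length es. skipped t) \<le> card (incomparable_pairs (set es) le)"
proof -
  let ?S = "Sigma {..<length es} (\<lambda>t. {v \<in> set (take t es). (v, es ! t) \<notin> le})"
  have less: "v < es ! t" if v: "t < length es" "v \<in> set (take t es)" for t v
  proof -
    obtain k where "k < t" "es ! k = v" using v by (auto simp: in_set_conv_nth)
    then show ?thesis using sorted_wrt_nth_less[OF sorted_es, of k t] v by simp
  qed
  have "(\<Sum>t<length es. skipped t) = card ?S"
    by (simp add: skipped_def card_SigmaI)
  also have "\<dots> = card ((\<lambda>(t, v). {v, es ! t}) ` ?S)"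
  proof (rule card_image[symmetric], rule inj_onI, clarify)
    fix t v t' v' assume *: "t < length es" "v \<in> set (take t es)" "t' < length es" "v' \<in> set (take t' es)"
      "{v, es ! t} = {v', es ! t'}"
    then have "v = v' \<and> es ! t = es ! t'"
      using less[of t v] less[of t' v'] by (auto simp: doubleton_eq_iff)
    then show "t = t' \<and> v = v'" using * distinct_es nth_eq_iff_index_eq by blast
  qed
  also have "\<dots> \<le> card (incomparable_pairs (set es) le)"
  proof (intro card_mono finite_incomparable_pairs)
    show "(\<lambda>(t, v). {v, es ! t}) ` ?S \<subseteq> incomparable_pairs (set es) le"
    proof clarify
      fix t v assume *: "t < length es" "v \<in> set (take t es)" "(v, es ! t) \<notin> le"
      then have "v < es ! t" "v \<in> set es" using less by (auto dest: in_set_takeD)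
      then have "(es ! t, v) \<notin> le" using extension[of "es ! t" v] es_less nth_es_less *(1) by fastforce
      then show "{v, es ! t} \<in> incomparable_pairs (set es) le"
        using * \<open>v \<in> set es\<close> nth_mem[OF *(1)] unfolding incomparable_pairs_def by blast
    qed
  qed simp
  finally show ?thesis .
qed

end

context node_chain
begin

text \<open>\<open>hi u - lo u\<close> is one more than the number of chain elements incomparable to
  u. Exactly one member of such a pair is on the chain, so the pair determines u and the chain
  element.\<close>

lemma chain_pairs_le: "(\<Sum>u\<in>set es - set cs. hi u - lo u) \<le> length es + card (incomparable_pairs (set es) le)"
proof -
  let ?T = "set es - set cs"
  let ?S = "Sigma ?T (\<lambda>u. {lo u..<hi u - 1})"
  have idx: "i < length cs \<and> (u, cs ! i) \<notin> le \<and> (cs ! i, u) \<notin> le" if "u \<in> ?T" "i \<in> {lo u..<hi u - 1}" for u i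
  proof -
    have i: "i < length cs" using that upper_index_bounds[of u] by auto
    then show ?thesis using that less_lower_index_iff[OF i, of u] upper_index_le_iff[OF i, of u] by auto
  qed
  have "(\<Sum>u\<in>?T. hi u - lo u) = (\<Sum>u\<in>?T. 1 + (hi u - 1 - lo u))"
    using chain_index_less by (intro sum.cong) fastforce+
  also have "\<dots> = card ?T + card ?S" by (subst sum.distrib) (simp add: card_SigmaI)
  also have "card ?S = card ((\<lambda>(u, i). {u, cs ! i}) ` ?S)"
  proof (rule card_image[symmetric], rule inj_onI, clarify)
    fix u i v j assume *: "u \<in> set es" "u \<notin> set cs" "i \<in> {lo u..<hi u - 1}" "v \<in> set es" "v \<notin> set cs"
      "j \<in> {lo v..<hi v - 1}" "{u, cs ! i} = {v, cs ! j}"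
    then have "i < length cs" "j < length cs" using idx by auto
    moreover from this have "u \<noteq> cs ! j" "v \<noteq> cs ! i" using * by auto
    ultimately show "u = v \<and> i = j"
      using *(7) distinct_chain nth_eq_iff_index_eq[of cs i j] by (auto simp: doubleton_eq_iff)
  qed
  also have "\<dots> \<le> card (incomparable_pairs (set es) le)"
  proof (intro card_mono finite_incomparable_pairs)
    show "(\<lambda>(u, i). {u, cs ! i}) ` ?S \<subseteq> incomparable_pairs (set es) le"
    proof clarify
      fix u i assume *: "u \<in> set es" "u \<notin> set cs" "i \<in> {lo u..<hi u - 1}"
      then have "i < length cs \<and> (u, cs ! i) \<notin> le \<and> (cs ! i, u) \<notin> le" using idx by blast
      then show "{u, cs ! i} \<in> incomparable_pairs (set es) le"
        using *(1) chain_mem unfolding incomparable_pairs_def by blast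
    qed
  qed simp
  also have "card ?T \<le> card (set es)" by (intro card_mono) auto
  also have "card (set es) \<le> length es" by (rule card_length)
  finally show ?thesis by simp
qed

text \<open>Double counting of memberships. Together with the preceding bound, all child posets of a
  call have total size linear in its elements and incomparable pairs, which makes explicit copies
  affordable.\<close>

lemma sum_parts: "(\<Sum>i\<le>length cs. length (part i)) = (\<Sum>u\<in>set es - set cs. hi u - lo u)"
proof -
  have "(\<Sum>i\<le>length cs. length (part i)) = (\<Sum>i\<le>length cs. card (set (part i)))"
    using distinct_es by (intro sum.cong refl distinct_card[symmetric]) (simp add: part_def)
  also have "\<dots> = (\<Sum>i\<le>length cs. \<Sum>u\<in>set es - set cs. if lo u \<le> i \<and> i < hi u then 1 else 0)"
  proof (intro sum.cong refl)
    fix i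
    have "set (part i) = {u \<in> set es - set cs. lo u \<le> i \<and> i < hi u}"
      using in_chain_iff by (auto simp: part_def)
    then show "card (set (part i)) = (\<Sum>u\<in>set es - set cs. if lo u \<le> i \<and> i < hi u then 1 else 0)"
      by (simp add: sum.If_cases Int_def)
  qed
  also have "\<dots> = (\<Sum>u\<in>set es - set cs. \<Sum>i\<le>length cs. if lo u \<le> i \<and> i < hi u then 1 else 0)"
    by (rule sum.swap)
  also have "\<dots> = (\<Sum>u\<in>set es - set cs. hi u - lo u)"
  proof (intro sum.cong refl)
    fix u
    have "{i. i \<le> length cs \<and> lo u \<le> i \<and> i < hi u} = {lo u..<hi u}"
      using upper_index_bounds[of u] by auto
    then show "(\<Sum>i\<le>length cs. if lo u \<le> i \<and> i < hi u then 1 else 0) = hi u - lo u"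
      by (simp add: sum.If_cases Int_def)
  qed
  finally show ?thesis .
qed

definition round_cost :: "nat \<Rightarrow> nat" where
  "round_cost i = 170 + 60 * (length (part_before i) + length (part i))"

lemma round_cost_le: "(\<Sum>i\<le>length cs. round_cost i)
    \<le> 170 + 290 * length es + 120 * card (incomparable_pairs (set es) le)"
proof -
  have "(\<Sum>i\<le>length cs. length (part_before i)) = (\<Sum>i<length cs. length (part i))"
    by (subst sum.atMost_shift) (simp add: part_before_0 part_before_Suc)
  also have "\<dots> \<le> (\<Sum>i\<le>length cs. length (part i))" by (intro sum_mono2) auto
  finally show ?thesis
    using chain_pairs_le sum_parts length_chain_le
    by (simp add: round_cost_def sum.distrib sum_distrib_left[symmetric])
qed

text \<open>What the caller relies on after a child returns. The next frame is left out on purpose: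
  its elements change in every round and are tracked separately.\<close>

definition same_frame :: "(register, array) machine \<Rightarrow> (register, array) machine \<Rightarrow> bool" where
  "same_frame s t \<longleftrightarrow> (\<forall>a. length (mem t a) = length (mem s a)) \<and> (\<forall>a\<in>{Label, Leq}. mem t a = mem s a) \<and>
     (\<forall>a\<in>{Elems, Chain, Upper, Bucket, BucketNext}. \<forall>p<fp + (n + 2). mem t a ! p = mem s a ! p) \<and>
     (\<forall>x\<in>{rn, rw, rfp, rm, rk}. regs t x = regs s x)"

lemma same_frame_trans: "same_frame s t \<Longrightarrow> same_frame t u \<Longrightarrow> same_frame s u"
  unfolding same_frame_def by simp

lemma same_frame_chained:
  assumes "same_frame s t" "chained s" shows "chained t"
proof -
  have "fp + i < fp + (n + 2)" if "i < length es" for i using that length_es_le by simp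
  moreover have "fp + Suc i < fp + (n + 2)" if "i < length cs" for i
    using that length_es_le length_chain_le by simp
  ultimately show ?thesis
    using assms by (auto simp: same_frame_def chained_def node_def ready_def simp del: add_Suc_right)
qed

lemma same_frame_classified:
  assumes f: "same_frame s t" and c: "classified 0 s" shows "classified 0 t"
proof -
  have less: "fp + u < fp + (n + 2)" if "u \<in> set es" for u using that es_less[of u] by simp
  have idx: "fp + i < fp + (n + 2)" if "i \<le> length cs" for i
    using that length_es_le length_chain_le by simp
  have "mem t Upper ! (fp + u) = hi u" if "u \<in> set es - set cs" for u
    using that f c less[of u] by (simp add: same_frame_def classified_def)
  moreover have "linked (\<lambda>u. mem t BucketNext ! (fp + u)) n (mem t Bucket ! (fp + i))
       (filter (\<lambda>u. u \<notin> set cs \<and> lo u = i) es)" if i: "i \<le> length cs" for i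
  proof -
    have "linked (\<lambda>u. mem t BucketNext ! (fp + u)) n a (filter (\<lambda>u. u \<notin> set cs \<and> lo u = i) es)
        = linked (\<lambda>u. mem s BucketNext ! (fp + u)) n a (filter (\<lambda>u. u \<notin> set cs \<and> lo u = i) es)" for a
      using f less by (intro linked_cong) (auto simp: same_frame_def)
    then show ?thesis using f c i idx[OF i] by (simp add: same_frame_def classified_def)
  qed
  ultimately show ?thesis by (simp add: classified_def)
qed

definition ideal_prefix :: "nat \<Rightarrow> nat list" where
  "ideal_prefix i = concat (map appended [0..<i])"

lemma ideal_prefix_Suc: "ideal_prefix (Suc i) = ideal_prefix i @ appended i"
  by (simp add: ideal_prefix_def)

lemma set_ideal_prefix: "i \<le> length cs \<Longrightarrow> set (ideal_prefix (Suc i)) = down_part le (set es) cs i"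
proof (induction i)
  case 0
  then show ?case by (auto simp: ideal_prefix_def set_appended down_part_iff)
next
  case (Suc i)
  then show ?case
    by (subst ideal_prefix_Suc) (auto simp: set_appended down_part_iff)
qed

text \<open>D_i and P_i are disjoint subsets of P, and the prefix lists D_i without
  repetition.\<close>

lemma ideal_prefix_room:
  assumes i: "i \<le> length cs"
  shows "length (ideal_prefix (Suc i)) + length (part i) \<le> length es"
proof -
  have "distinct (ideal_prefix (Suc i))"
    using i
  proof (induction i)
    case 0
    then show ?case using distinct_appended[of 0] by (simp add: ideal_prefix_def)
  next
    case (Suc i)
    then have "set (ideal_prefix (Suc i)) \<inter> set (appended (Suc i)) = {}"
      using set_ideal_prefix[of i] set_appended[of "Suc i"] by (auto simp: down_part_iff)
    then show ?case using Suc distinct_appended[of "Suc i"] by (subst ideal_prefix_Suc) auto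
  qed
  moreover have "distinct (part i)" using distinct_es by (simp add: part_def)
  moreover have "set (ideal_prefix (Suc i)) \<inter> set (part i) = {}"
    using i by (auto simp: set_ideal_prefix set_part down_part_iff sub_poset_iff)
  ultimately have "distinct (ideal_prefix (Suc i) @ part i)" by simp
  moreover have "set (ideal_prefix (Suc i) @ part i) \<subseteq> set es"
    using i by (auto simp: set_ideal_prefix set_part down_part_iff sub_poset_iff)
  then have "card (set (ideal_prefix (Suc i) @ part i)) \<le> card (set es)" by (intro card_mono) auto
  ultimately show ?thesis using distinct_es by (simp only: distinct_card length_append)
qed

text \<open>The chain of a nonempty poset is nonempty and disjoint from every P_i, so the child is
  strictly smaller and one frame less suffices.\<close>

lemma node_data_part:
  "es \<noteq> [] \<Longrightarrow> i \<le> length cs \<Longrightarrow> node_data n r L (fp + (n + 2)) (part i)"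
  "es \<noteq> [] \<Longrightarrow> i \<le> length cs \<Longrightarrow> length (part i) < length es"
proof -
  assume ne: "es \<noteq> []" and i: "i \<le> length cs"
  have "u \<notin> set (part i)" if "u \<in> set cs" for u
    using that in_chain_iff[of u] set_chain by (auto simp: part_def)
  moreover obtain c where "c \<in> set cs"
  proof -
    obtain u where "u \<in> set es" using ne by (cases es) auto
    then have "cs \<noteq> []" using level_pos[of u] level_le[of u] by auto
    then show ?thesis using that by (cases cs) auto
  qed
  moreover have "set (part i) \<subseteq> set es" by (auto simp: part_def)
  ultimately have "set (part i) \<subset> set es" using set_chain by blast
  then have "card (set (part i)) < card (set es)" by (intro psubset_card_mono) auto
  moreover have "distinct (part i)" using distinct_es by (simp add: part_def)
  ultimately have less: "Suc (length (part i)) \<le> length es"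
    using distinct_es by (simp only: distinct_card Suc_le_eq)
  then have "(Suc (length (part i)) + 1) * (n + 2) \<le> (length es + 1) * (n + 2)"
    by (intro mult_le_mono1) simp
  moreover have "(Suc (length (part i)) + 1) * (n + 2) = (length (part i) + 1) * (n + 2) + (n + 2)" by simp
  ultimately have "fp + (n + 2) + (length (part i) + 1) * (n + 2) \<le> frame_space n" using room by linarith
  then show "node_data n r L (fp + (n + 2)) (part i)" "length (part i) < length es"
    using relabeled_poset_axioms sorted_es es_less less
    by (auto simp: node_data_def node_data_axioms_def part_def sorted_wrt_filter)
qed

text \<open>The extra 10 in both time bounds is reserved for the surrounding loop, 6 for its test
  and 4 for its increment.\<close>

definition round_result :: "nat \<Rightarrow> nat \<Rightarrow> (register, array) machine \<Rightarrow> (register, array) machine \<Rightarrow>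
    nat list \<Rightarrow> nat set list \<Rightarrow> bool" where
  "round_result i l z u ts Js \<longleftrightarrow> same_frame z u \<and> regs u ri = i \<and> regs u rr = length (part i) \<and>
     (\<forall>t<length (part i). mem u Elems ! (fp + (n + 2) + t) = part i ! t) \<and>
     regs u rlen = l + length (appended i) \<and>
     take (l + length (appended i)) (mem u Ideal) = take l (mem z Ideal) @ map ((!) L) (appended i) \<and>
     depth u = depth z \<and> peak u \<le> max_space \<and>
     visited u = visited z @ zip ts Js \<and> length ts = length Js \<and>
     enumerates r ((!) L ` set (part i)) (set (take l (mem z Ideal)) \<union> (!) L ` set (appended i)) Js \<and>
     clock u + 113000 * potential le (set (part i)) + 10 \<le> clock z + round_cost i + 500000 * length Js \<and>
     (\<forall>k<length Js. ts ! k + 10 \<le> clock z + round_cost i + 500000 * (k + 1) + (length es - 1) * local_bound)"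

lemma enumerate_round:
  assumes z: "chained z" "classified 0 z" and ne: "es \<noteq> []" and i: "regs z ri = i" "i \<le> length cs"
    and rr: "regs z rr = length (part_before i)"
    and elems: "\<forall>t<length (part_before i). mem z Elems ! (fp + (n + 2) + t) = part_before i ! t"
    and len: "regs z rlen = l" "l + length (appended i) + length (part i) \<le> n"
    and sp: "depth z + length es \<le> n + 1" "peak z \<le> max_space"
    and IH: "\<And>s' l'. call_pre (fp + (n + 2)) (part i) l' s' \<Longrightarrow>
      wp B B (\<lambda>t. \<exists>ts Js. call_result (fp + (n + 2)) (part i) l' s' t ts Js) s'"
  shows "wp B enumerate_round (\<lambda>u. \<exists>ts Js. round_result i l z u ts Js) z"
proof -
  let ?Q = "\<lambda>u. \<exists>ts Js. round_result i l z u ts Js"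
  let ?args = "[(rfp, V rfp \<oplus> V rw), (rm, V rr), (rlen, V rlen)]"
  define l' where "l' = l + length (appended i)"
  have call: "wp B (Call ?args) ?Q z3"
    if same: "same_frame z z3" and r3: "regs z3 ri = i" "regs z3 rr = length (part i)" "regs z3 rlen = l'"
      and e3: "\<forall>t<length (part i). mem z3 Elems ! (fp + (n + 2) + t) = part i ! t"
      and I3: "take l' (mem z3 Ideal) = take l (mem z Ideal) @ map ((!) L) (appended i)"
      and m3: "depth z3 = depth z" "peak z3 = peak z" "visited z3 = visited z"
      and c3: "clock z3 \<le> clock z + 100 + 60 * (length (part_before i) + length (part i))" for z3
  proof -
    define w where "w = enter_call ?args
      (tick (1 + 2 * card (UNIV :: register set) + sum_list (map (\<lambda>(x, e). acost e) ?args)) z3)"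
    note z3D = chainedD[OF same_frame_chained[OF same z(1)]]
    note z3R = readyD[OF z3D(1)]
    \<comment> \<open>The call overhead is 36 = 1 + 2 * 15 for the registers plus 5 for the three
      argument expressions.\<close>
    have s: "regs w = (regs z3)(rfp := fp + (n + 2), rm := length (part i), rlen := l')" "mem w = mem z3"
        "depth w = depth z + 1" "visited w = visited z" "clock w = clock z3 + 36"
      using z3D z3R r3 m3 by (auto simp: w_def enter_call_def card_register fun_eq_iff)
    have "space w = (\<Sum>a\<in>UNIV. array_length n a) + (depth z + 2) * (card (UNIV :: register set) + 1)"
      using z3R by (simp add: space_def s)
    moreover have "(depth z + 2) * (card (UNIV :: register set) + 1) \<le> (n + 2) * (card (UNIV :: register set) + 1)"
      using sp ne by (intro mult_le_mono1) (cases es, auto)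
    moreover have "peak w = max (peak z) (space w)"
      using m3 by (simp add: w_def enter_call_def space_def)
    ultimately have pk: "peak w \<le> max_space" using sp by (simp add: max_space_def)
    have "ready w" using z3D(1) by (simp add: ready_def s)
    then have pre: "call_pre (fp + (n + 2)) (part i) l' w"
      using pk e3 len(2) sp node_data_part(2)[OF ne i(2)] by (simp add: call_pre_def node_def s l'_def)
    show ?thesis
      unfolding wp_Call w_def[symmetric]
    proof (rule wp_mono[OF IH[OF pre]])
      fix t assume "\<exists>ts Js. call_result (fp + (n + 2)) (part i) l' w t ts Js"
      then obtain ts Js where t: "call_result (fp + (n + 2)) (part i) l' w t ts Js" by blast
      note t = t[unfolded call_result_def preserved_def s]
      have "same_frame z3 (leave_call z3 t)"
        using t unfolding same_frame_def by auto
      then have same': "same_frame z (leave_call z3 t)" using same same_frame_trans by blast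
      have "fp + (n + 2) + j < fp + (n + 2) + (n + 2)" if "j < length (part i)" for j
        using that length_part_le(1)[of i] by simp
      then have "\<forall>t'<length (part i). mem t Elems ! (fp + (n + 2) + t') = part i ! t'"
        using t e3 by simp
      moreover have "clock t + 113000 * potential le (set (part i)) + 10 \<le> clock z + round_cost i + 500000 * length Js"
        using t c3 by (auto simp: round_cost_def)
      moreover have "ts ! k + 10 \<le> clock z + round_cost i + 500000 * (k + 1) + (length es - 1) * local_bound"
        if "k < length Js" for k
      proof -
        have "length (part i) * local_bound \<le> (length es - 1) * local_bound"
          using node_data_part(2)[OF ne i(2)] by (intro mult_le_mono1) simp
        moreover have "ts ! k \<le> clock z3 + 36 + 500000 * (k + 1) + length (part i) * local_bound"
          using t that by blast
        ultimately show ?thesis using c3 unfolding round_cost_def by linarith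
      qed
      ultimately have "round_result i l z (leave_call z3 t) ts Js"
        unfolding round_result_def l'_def[symmetric]
        using t same' r3 m3 I3 by simp
      then show "?Q (leave_call z3 t)" by blast
    qed
  qed
  have poset: "wp B update_poset (wp B (Call ?args) ?Q) z2"
    if z2: "frame {rs, rt, ru, rx, rlen} {Ideal, Temp} z z2" "regs z2 rs = length (part_common i)"
      "take (length (part_common i)) (mem z2 Temp) = part_common i" "regs z2 rlen = l'"
      "take l' (mem z2 Ideal) = take l (mem z Ideal) @ map ((!) L) (appended i)"
      "clock z2 \<le> clock z + 50 + 60 * length (part_before i)" for z2
  proof (rule wp_mono[OF update_poset])
    have same: "same_frame z z2" using z2(1) by (auto simp: same_frame_def frame_def)
    show "chained z2" by (rule same_frame_chained[OF same z(1)])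
    show "classified 0 z2" by (rule same_frame_classified[OF same z(2)])
    show "regs z2 ri = i" using z2(1) i by (simp add: frame_def)
    fix z3 assume *: "frame {rt, rr, rv, ru} {Elems} z2 z3 \<and> regs z3 rr = length (part i) \<and>
      (\<forall>t<length (part i). mem z3 Elems ! (fp + (n + 2) + t) = part i ! t) \<and>
      (\<forall>p<fp + (n + 2). mem z3 Elems ! p = mem z2 Elems ! p) \<and>
      clock z3 \<le> clock z2 + 50 + 60 * length (part i)"
    then have "same_frame z2 z3" by (auto simp: same_frame_def frame_def)
    then have "same_frame z z3" using same same_frame_trans by blast
    then show "wp B (Call ?args) ?Q z3"
      using * z2 i by (intro call) (auto simp: frame_def)
  qed (use ne i z2 in auto)
  show ?thesis
    unfolding enumerate_round_def enumerate_call_def wp_Seq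
  proof (rule wp_mono[OF update_ideal[OF z ne i rr elems len(1)]])
    show "l + length (appended i) \<le> n" using len by simp
  qed (use poset l'_def in auto)
qed

section \<open>All rounds of one call\<close>

definition rounds_result :: "nat \<Rightarrow> (register, array) machine \<Rightarrow> (register, array) machine \<Rightarrow>
    nat list \<Rightarrow> nat set list \<Rightarrow> bool" where
  "rounds_result l s t ts Js \<longleftrightarrow> same_frame s t \<and> take l (mem t Ideal) = take l (mem s Ideal) \<and>
     peak t \<le> max_space \<and> visited t = visited s @ zip ts Js \<and> length ts = length Js \<and>
     enumerates r ((!) L ` set es) (set (take l (mem s Ideal))) Js \<and>
     clock t + 113000 * (\<Sum>i\<le>length cs. potential le (sub_poset le (set es) cs i))
       \<le> clock s + 30 + (\<Sum>i\<le>length cs. round_cost i) + 500000 * length Js \<and>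
     (\<forall>k<length Js. ts ! k \<le> clock s + 30 + (\<Sum>i\<le>length cs. round_cost i) + 500000 * (k + 1) +
       (length es - 1) * local_bound)"

lemma rounds:
  assumes s: "chained s" "classified 0 s" and ne: "es \<noteq> []" and len: "regs s rlen = l" "l + length es \<le> n"
    and sp: "depth s + length es \<le> n + 1" "peak s \<le> max_space"
    and IH: "\<And>i s' l'. i \<le> length cs \<Longrightarrow> call_pre (fp + (n + 2)) (part i) l' s' \<Longrightarrow>
      wp B B (\<lambda>t. \<exists>ts Js. call_result (fp + (n + 2)) (part i) l' s' t ts Js) s'"
  shows "wp B (rr ::= N 0 ;; FOR ri < V rk \<oplus> N 1 DO enumerate_round) (\<lambda>t. \<exists>ts Js. rounds_result l s t ts Js) s"
proof -
  let ?P = "\<lambda>i. sub_poset le (set es) cs i"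
  let ?I = "set (take l (mem s Ideal))"
  note sD = chainedD[OF s(1)] readyD[OF chainedD(1)[OF s(1)]]
  define J where "J i z ts Jss \<longleftrightarrow> same_frame s z \<and> regs z ri = i \<and> i \<le> length cs + 1 \<and>
    regs z rr = length (part_before i) \<and>
    (\<forall>t<length (part_before i). mem z Elems ! (fp + (n + 2) + t) = part_before i ! t) \<and>
    regs z rlen = l + length (ideal_prefix i) \<and>
    take (l + length (ideal_prefix i)) (mem z Ideal) = take l (mem s Ideal) @ map ((!) L) (ideal_prefix i) \<and>
    depth z = depth s \<and> peak z \<le> max_space \<and> length Jss = i \<and>
    (\<forall>j<i. enumerates r ((!) L ` ?P j) (?I \<union> (!) L ` down_part le (set es) cs j) (Jss ! j)) \<and>
    length ts = length (concat Jss) \<and> visited z = visited s @ zip ts (concat Jss) \<and>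
    clock z + 113000 * (\<Sum>j<i. potential le (?P j)) \<le> clock s + 10 + (\<Sum>j<i. round_cost j) + 500000 * length ts \<and>
    (\<forall>k<length ts. ts ! k \<le> clock s + 10 + (\<Sum>j<i. round_cost j) + 500000 * (k + 1) + (length es - 1) * local_bound)"
    for i z ts and Jss :: "nat set list list"
  show ?thesis
    unfolding wp_Seq wp_Assign
  proof (rule wp_for[where I = "\<lambda>i z. \<exists>ts Jss. J i z ts Jss" and m = "length cs + 1"])
    show "\<exists>ts Jss. J 0 (tick 2 (set_reg ri 0 (tick (1 + acost (N 0)) (set_reg rr (aval (N 0) (regs s)) s)))) ts Jss"
      using sp len by (intro exI[of _ "[]"]) (simp add: J_def same_frame_def part_before_0 ideal_prefix_def)
  next
    fix i z assume "\<exists>ts Jss. J i z ts Jss"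
    then show "i \<le> length cs + 1 \<and> regs z ri = i \<and> aval (V rk \<oplus> N 1) (regs z) = length cs + 1"
      using sD by (auto simp: J_def same_frame_def)
  next
    fix i z assume "\<exists>ts Jss. J i z ts Jss" and "i < length cs + 1"
    then obtain ts Jss where J: "J i z ts Jss" and i: "i \<le> length cs" by auto
    define l' where "l' = l + length (ideal_prefix i)"
    note J' = J[unfolded J_def, folded l'_def]
    define z1 where "z1 = tick (3 + acost (V rk \<oplus> N 1)) z"
    have same: "same_frame s z1" using J' by (simp add: z1_def same_frame_def)
    have z1: "regs z1 = regs z" "mem z1 = mem z" "depth z1 = depth z" "peak z1 = peak z" "visited z1 = visited z"
      "clock z1 = clock z + 6" by (simp_all add: z1_def)
    show "wp B enumerate_round (\<lambda>u. regs u ri = i \<and> (\<exists>ts Jss. J (Suc i) (tick 4 (set_reg ri (Suc i) u)) ts Jss))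
        (tick (3 + acost (V rk \<oplus> N 1)) z)"
      unfolding z1_def[symmetric]
    proof (rule wp_mono[OF enumerate_round[where i = i and l = l']])
      show "chained z1" by (rule same_frame_chained[OF same s(1)])
      show "classified 0 z1" by (rule same_frame_classified[OF same s(2)])
      show "l' + length (appended i) + length (part i) \<le> n"
        using ideal_prefix_room[OF i] len(2) by (simp add: l'_def ideal_prefix_Suc)
      fix u assume "\<exists>ts' Js. round_result i l' z1 u ts' Js"
      then obtain ts' Js where u: "round_result i l' z1 u ts' Js" by blast
      note u' = u[unfolded round_result_def z1]
      have sub: "?P i = set (part i)" using i by (simp add: set_part)
      have "same_frame s u" using u' same same_frame_trans by blast
      then have same': "same_frame s (tick 4 (set_reg ri (Suc i) u))" by (simp add: same_frame_def)
      have "?I \<union> (!) L ` down_part le (set es) cs i = set (take l' (mem z Ideal)) \<union> (!) L ` set (appended i)"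
        using J' i by (auto simp: set_ideal_prefix[symmetric] ideal_prefix_Suc)
      then have enum: "\<forall>j<Suc i. enumerates r ((!) L ` ?P j) (?I \<union> (!) L ` down_part le (set es) cs j) ((Jss @ [Js]) ! j)"
        using J' u' sub by (auto simp: nth_append less_Suc_eq)
      have times: "(ts @ ts') ! k \<le> clock s + 10 + (\<Sum>j<Suc i. round_cost j) + 500000 * (k + 1) + (length es - 1) * local_bound"
        if k: "k < length (ts @ ts')" for k
      proof (cases "k < length ts")
        case True
        then have "ts ! k \<le> clock s + 10 + (\<Sum>j<i. round_cost j) + 500000 * (k + 1) + (length es - 1) * local_bound"
          using J' by blast
        then show ?thesis using True by (simp add: nth_append)
      next
        case False
        \<comment> \<open>The earlier rounds are complete, so their time is bounded by 500000 per
          output, with the potential term dropped; k' is the position of the output within the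
          current round.\<close>
        define k' where "k' = k - length ts"
        have k': "k = length ts + k'" "k' < length Js" using False k u' by (auto simp: k'_def)
        then have "ts' ! k' + 10 \<le> clock z + 6 + round_cost i + 500000 * (k' + 1) + (length es - 1) * local_bound"
          using u' by blast
        moreover have "clock z \<le> clock s + 10 + (\<Sum>j<i. round_cost j) + 500000 * length ts" using J' by linarith
        ultimately show ?thesis using False k' by (simp add: nth_append)
      qed
      have "clock z + 113000 * (\<Sum>j<i. potential le (?P j)) \<le> clock s + 10 + (\<Sum>j<i. round_cost j) + 500000 * length ts"
        "clock u + 113000 * potential le (set (part i)) + 10 \<le> clock z + 6 + round_cost i + 500000 * length Js"
        "length ts' = length Js"
        using J' u' by simp_all
      then have clk: "clock u + 4 + 113000 * (\<Sum>j<Suc i. potential le (?P j)) \<le>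
          clock s + 10 + (\<Sum>j<Suc i. round_cost j) + 500000 * length (ts @ ts')"
        by (simp add: sub)
      have "J (Suc i) (tick 4 (set_reg ri (Suc i) u)) (ts @ ts') (Jss @ [Js])"
        unfolding J_def
        using J' u' i same' enum times clk
        by (simp add: part_before_Suc ideal_prefix_Suc l'_def add.assoc)
      then show "regs u ri = i \<and> (\<exists>ts Jss. J (Suc i) (tick 4 (set_reg ri (Suc i) u)) ts Jss)"
        using u' by blast
    qed (use J' i ne sp IH z1 in auto)
  next
    fix z assume "\<exists>ts Jss. J (length cs + 1) z ts Jss"
    then obtain ts Jss where J: "J (length cs + 1) z ts Jss" by blast
    note J' = J[unfolded J_def]
    have inj: "inj_on ((!) L) (set es)" by (rule inj_on_subset[OF inj_label]) (use es_less in auto)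
    have "enumerates r ((!) L ` set es) ?I (concat Jss)"
    \<comment> \<open>One output list per round is what the branch rule requires; chain, subposets
      and lower parts are carried over to the original names.\<close>
    proof (rule enumerates.branch)
      show "longest_chain r ((!) L ` set es) (map ((!) L) cs)"
        using longest by (intro longest_chain_relabel inj) (simp add: le_def)
      show "length Jss = length (map ((!) L) cs) + 1" using J' by simp
      fix i assume "i \<le> length (map ((!) L) cs)"
      then show "enumerates r (sub_poset r ((!) L ` set es) (map ((!) L) cs) i)
          (?I \<union> down_part r ((!) L ` set es) (map ((!) L) cs) i) (Jss ! i)"
        using J' by (simp add: sub_poset_relabel down_part_relabel le_def)
    qed (use ne in simp)
    moreover have "take l (mem z Ideal) = take l (mem s Ideal)"
    proof -
      have "take l (mem z Ideal) = take l (take (l + length (ideal_prefix (length cs + 1))) (mem z Ideal))" by simp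
      also have "\<dots> = take l (take l (mem s Ideal) @ map ((!) L) (ideal_prefix (length cs + 1)))" using J' by simp
      also have "\<dots> = take l (mem s Ideal)" using len sD by simp
      finally show ?thesis .
    qed
    moreover have "same_frame s (tick (3 + acost (V rk \<oplus> N 1)) z)" using J' by (simp add: same_frame_def)
    moreover have "ts ! k \<le> clock s + 30 + (\<Sum>i\<le>length cs. round_cost i) + 500000 * (k + 1) + (length es - 1) * local_bound"
      if "k < length (concat Jss)" for k
    proof -
      have "ts ! k \<le> clock s + 10 + (\<Sum>j<length cs + 1. round_cost j) + 500000 * (k + 1) + (length es - 1) * local_bound"
        using J' that by metis
      then show ?thesis by (simp add: lessThan_Suc_atMost)
    qed
    ultimately have "rounds_result l s (tick (3 + acost (V rk \<oplus> N 1)) z) ts (concat Jss)"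
      unfolding rounds_result_def using J' by (simp add: lessThan_Suc_atMost)
    then show "\<exists>ts Js. rounds_result l s (tick (3 + acost (V rk \<oplus> N 1)) z) ts Js" by blast
  qed
qed

end

context node_chain
begin

lemma classify_and_rounds:
  assumes s: "chained s" and ne: "es \<noteq> []" and len: "regs s rlen = l" "l + length es \<le> n"
    and sp: "depth s + length es \<le> n + 1" "peak s \<le> max_space"
    and s0: "preserved fp l s0 s" "visited s = visited s0"
    and clk: "clock s \<le> clock s0 + 60 + 250 * length es + 100 * (\<Sum>t<length es. skipped t)"
    and IH: "\<And>i s' l'. i \<le> length cs \<Longrightarrow> call_pre (fp + (n + 2)) (part i) l' s' \<Longrightarrow>
      wp B B (\<lambda>t. \<exists>ts Js. call_result (fp + (n + 2)) (part i) l' s' t ts Js) s'"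
  shows "wp B (classify_elements ;; rr ::= N 0 ;; FOR ri < V rk \<oplus> N 1 DO enumerate_round)
    (\<lambda>t. \<exists>ts Js. call_result fp es l s0 t ts Js) s"
  unfolding wp_Seq[of B classify_elements]
proof (rule wp_mono[OF classify_elements[OF s]])
  fix z assume z: "frame {rt, ru, rv, rs, rx, rj} {Upper, Bucket, BucketNext} s z \<and>
    kept {Upper, Bucket, BucketNext} s z \<and> classified 0 z \<and>
    clock z \<le> clock s + 50 + 250 * length es + 50 * (\<Sum>u\<in>set es - set cs. hi u - lo u)"
  let ?q = "card (incomparable_pairs (set es) le)"
  have ch: "chained z" using chained_frame[OF s conjunct1[OF z]] by simp
  have zs: "regs z rlen = l" "depth z = depth s" "peak z = peak s" "visited z = visited s" "mem z Ideal = mem s Ideal"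
    using z len by (auto simp: frame_def)
  have ps: "preserved fp l s0 z" using s0(1) z by (auto simp: preserved_def frame_def kept_def)
  then have I0: "take l (mem z Ideal) = take l (mem s0 Ideal)" by (simp add: preserved_def)
  have cz: "clock z \<le> clock s0 + 110 + 550 * length es + 150 * ?q"
    using z clk skipped_le chain_pairs_le by linarith
  show "wp B (rr ::= N 0 ;; FOR ri < V rk \<oplus> N 1 DO enumerate_round) (\<lambda>t. \<exists>ts Js. call_result fp es l s0 t ts Js) z"
  proof (rule wp_mono[OF rounds[where l = l]])
    fix t assume "\<exists>ts Js. rounds_result l z t ts Js"
    then obtain ts Js where t: "rounds_result l z t ts Js" by blast
    note t' = t[unfolded rounds_result_def]
    have pt: "preserved fp l s0 t"
    proof -
      have sf: "same_frame z t" "take l (mem t Ideal) = take l (mem z Ideal)" using t' by blast+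
      have "mem t a ! p = mem s0 a ! p" if "a \<in> {Chain, Upper, Bucket, BucketNext}" "p < fp" for a p
      proof -
        have "p < fp + (n + 2)" using that by simp
        then have "mem t a ! p = mem z a ! p" using sf(1) that(1) unfolding same_frame_def by blast
        also have "\<dots> = mem s0 a ! p" using ps that unfolding preserved_def by blast
        finally show ?thesis .
      qed
      then show ?thesis using ps sf unfolding preserved_def same_frame_def by simp
    qed
    \<comment> \<open>The coefficients are 30 + 110 + 170, 550 + 290 and 150 + 120, all below 1000.
      This factor 1000 turns 113 into 113000.\<close>
    have cost: "clock z + 30 + (\<Sum>i\<le>length cs. round_cost i) \<le> clock s0 + 1000 * (1 + length es + ?q)"
    proof -
      have arith: "a + 30 + b \<le> c + 1000 * (1 + m + q)"
        if "a \<le> c + 110 + 550 * m + 150 * q" "b \<le> 170 + 290 * m + 120 * q" for a b c m q :: nat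
      proof -
        have "30 + (110 + 550 * m + 150 * q) + (170 + 290 * m + 120 * q) \<le> 1000 * (1 + m + q)" by simp
        with that show ?thesis by linarith
      qed
      show ?thesis by (rule arith[OF cz round_cost_le])
    qed
    have card: "card (set es) = length es" using distinct_es by (rule distinct_card)
    have "1 + length es + ?q + 113 * potential le (set es)
        \<le> 113 * (\<Sum>i\<le>length cs. potential le (sub_poset le (set es) cs i))"
      using potential_pays ne by (simp add: card)
    from mult_le_mono2[OF this, of 1000]
    have "1000 * (1 + length es + ?q) + 113000 * potential le (set es)
        \<le> 113000 * (\<Sum>i\<le>length cs. potential le (sub_poset le (set es) cs i))"
      by (simp only: add_mult_distrib2 mult.assoc[symmetric])
    moreover have "clock t + 113000 * (\<Sum>i\<le>length cs. potential le (sub_poset le (set es) cs i))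
       \<le> clock z + 30 + (\<Sum>i\<le>length cs. round_cost i) + 500000 * length Js"
      using t' by blast
    ultimately have ct: "clock t + 113000 * potential le (set es) \<le> clock s0 + 500000 * length Js"
      using cost by linarith
    \<comment> \<open>The current call adds one \<open>local_bound\<close> to those of the calls
      nested in it.\<close>
    have "ts ! k \<le> clock s0 + 500000 * (k + 1) + length es * local_bound" if k: "k < length Js" for k
    proof -
      have "1000 * (1 + length es + ?q) \<le> local_bound"
        using length_es_le incomparable_pairs_le by (simp add: local_bound_def)
      moreover have "length es * local_bound = local_bound + (length es - 1) * local_bound"
        using ne by (cases es) auto
      moreover have "ts ! k \<le> clock z + 30 + (\<Sum>i\<le>length cs. round_cost i) + 500000 * (k + 1) + (length es - 1) * local_bound"
        using t' k by blast
      ultimately show ?thesis using cost by linarith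
    qed
    then have "call_result fp es l s0 t ts Js"
      unfolding call_result_def using pt t' ct zs s0 I0 by simp
    then show "\<exists>ts Js. call_result fp es l s0 t ts Js" by blast
  qed (use ch z ne zs len sp IH in auto)
qed

end

context node_data
begin

lemma enumerate_node:
  assumes ne: "es \<noteq> []" and pre: "call_pre fp es l s"
    and IH: "\<And>fp' es' l' s'. length es' < length es \<Longrightarrow> node_data n r L fp' es' \<Longrightarrow> call_pre fp' es' l' s' \<Longrightarrow>
      wp B B (\<lambda>t. \<exists>ts Js. call_result fp' es' l' s' t ts Js) s'"
  shows "wp B enumerate_body (\<lambda>t. \<exists>ts Js. call_result fp es l s t ts Js) s"
proof -
  let ?Q = "\<lambda>t. \<exists>ts Js. call_result fp es l s t ts Js"
  let ?rounds = "rr ::= N 0 ;; FOR ri < V rk \<oplus> N 1 DO enumerate_round"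
  let ?b = "V rm \<doteq> N 0 :: register bexp"
  have node: "node fp es s" using pre by (simp add: call_pre_def)
  define s1 where "s1 = tick (1 + bcost ?b) s"
  have node1: "node fp es s1" using node by (simp add: node_def ready_def s1_def)
  have s1: "regs s1 = regs s" "mem s1 = mem s" "depth s1 = depth s" "peak s1 = peak s" "visited s1 = visited s"
    "clock s1 = clock s + 4" by (simp_all add: s1_def)
  have after: "wp B (classify_elements ;; ?rounds) ?Q z"
    if z: "frame {rh, rt, ru, rj, rv, rx, rk} {Level, LevelNext, Pred, Chain} s z" "\<forall>p<fp. mem z Chain ! p = mem s Chain ! p"
      and cs: "leveled_chain le (set es) cs f" "length cs = regs z rk" "\<forall>j<length cs. mem z Chain ! (fp + Suc j) = cs ! j"
      and clk: "clock z \<le> clock s + 60 + 250 * length es + 100 * (\<Sum>t<length es. skipped t)" for z cs f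
  proof -
    \<comment> \<open>The chain is known only from the run, so the theory of this chain is
      instantiated at the state reached after its extraction.\<close>
    have "node_chain n r L fp es cs f"
      using node_data_axioms cs(1) unfolding node_chain_def node_chain_axioms_def le_def by simp
    then interpret nc: node_chain n r L le fp es cs f
      by (simp_all add: le_def)
    have nz: "node fp es z"
      using node ready_frame[of s, OF _ z(1)] z(1) by (auto simp: node_def frame_def)
    then have ch: "nc.chained z" using cs by (simp add: nc.chained_def)
    have "preserved fp l s z" using z by (auto simp: preserved_def frame_def)
    moreover have "regs z rlen = l" "depth z = depth s" "peak z = peak s" "visited z = visited s"
      using z(1) pre by (auto simp: frame_def call_pre_def)
    ultimately show ?thesis
      using nc.classify_and_rounds[OF ch ne, of l s B] pre clk nc.node_data_part[OF ne] IH
      by (simp add: call_pre_def)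
  qed
  have extraction: "wp B extract_chain (wp B (classify_elements ;; ?rounds) ?Q) z"
    if z: "frame {rh, rt, ru, rj, rv, rx} {Level, LevelNext, Pred} s1 z"
      "levels es (regs z rh) f (mem z Level) (mem z LevelNext) (mem z Pred)"
      "clock z \<le> clock s1 + 20 + 200 * length es + 100 * (\<Sum>t<length es. skipped t)" for z f
  proof (rule wp_mono[OF extract_chain[OF _ z(2)]])
    show "node fp es z"
      using node1 ready_frame[of s1, OF _ z(1)] z(1) by (auto simp: node_def frame_def)
    fix t assume t: "frame {rk, rj, rv} {Chain} z t \<and> (\<forall>p<fp. mem t Chain ! p = mem z Chain ! p) \<and>
      (\<exists>cs. leveled_chain le (set es) cs f \<and> length cs = regs t rk \<and> (\<forall>j<length cs. mem t Chain ! (fp + Suc j) = cs ! j)) \<and>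
      clock t \<le> clock z + 20 + 50 * length es"
    then obtain cs where cs: "leveled_chain le (set es) cs f" "length cs = regs t rk"
      "\<forall>j<length cs. mem t Chain ! (fp + Suc j) = cs ! j" by blast
    have "frame {rh, rt, ru, rj, rv, rx, rk} {Level, LevelNext, Pred, Chain} s1 t"
      using frame_trans[OF z(1) conjunct1[OF t]] by auto
    then have "frame {rh, rt, ru, rj, rv, rx, rk} {Level, LevelNext, Pred, Chain} s t" by (simp add: s1_def)
    moreover have "\<forall>p<fp. mem t Chain ! p = mem s Chain ! p" using t z(1) by (simp add: frame_def s1)
    ultimately show "wp B (classify_elements ;; ?rounds) ?Q t"
      using cs t z(3) s1 by (intro after) auto
  qed
  have "wp B (antichain_decomposition ;; extract_chain ;; classify_elements ;; ?rounds) ?Q s1"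
    unfolding wp_Seq[of B antichain_decomposition] wp_Seq[of B extract_chain]
    by (rule wp_mono[OF antichain_decomposition[OF node1]]) (use extraction in blast)
  then show ?thesis
    using node ne unfolding enumerate_body_def enumerate_round_def[symmetric]
    by (simp add: node_def s1_def del: wp_Seq)
qed

end

context relabeled_poset
begin

text \<open>Induction on the size supplies the assumption about recursive calls, with the procedure
  body fixed. At a leaf, 6 + 113000 * 4 \<le> 500000.\<close>

theorem enumerate_correct:
  "node_data n r L fp es \<Longrightarrow> call_pre fp es l s \<Longrightarrow>
    wp enumerate_body enumerate_body (\<lambda>t. \<exists>ts Js. call_result fp es l s t ts Js) s"
proof (induction "length es" arbitrary: fp es l s rule: less_induct)
  case less
  show ?case
  proof (cases "es = []")
    case False
    interpret nd: node_data n r L le fp es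
      using less.prems(1) by (simp_all add: le_def)
    show ?thesis
      by (rule nd.enumerate_node[OF False less.prems(2)]) (rule less.hyps)
  next
    case True
    define J where "J = set (take l (mem s Ideal))"
    have s: "regs s rm = 0" "regs s rlen = l" "l \<le> length (mem s Ideal)" "peak s \<le> max_space"
      using less.prems(2) True by (auto simp: call_pre_def node_def ready_def)
    have result: "\<exists>ts Js. call_result fp es l s u ts Js"
      if "mem u = mem s" "peak u = peak s" "visited u = visited s @ [(clock s + 6, J)]" "clock u = clock s + 6" for u
    proof -
      have "call_result fp es l s u [clock s + 6] [J]"
        using s that by (auto simp: call_result_def preserved_def True potential_empty J_def intro: enumerates.visit)
      then show ?thesis by blast
    qed
    show ?thesis
      using s unfolding enumerate_body_def by simp (rule result, simp_all add: J_def)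
  qed
qed

end

section \<open>Initialization\<close>

lemma nth_concat_rows:
  "(\<And>xs. xs \<in> set xss \<Longrightarrow> length xs = m) \<Longrightarrow> u < length xss \<Longrightarrow> v < m \<Longrightarrow> concat xss ! (u * m + v) = xss ! u ! v"
  by (induction xss arbitrary: u) (auto simp: nth_append less_Suc_eq_0_disj)

lemma length_concat_rows: "(\<And>xs. xs \<in> set xss \<Longrightarrow> length xs = m) \<Longrightarrow> length (concat xss) = length xss * m"
  by (induction xss) auto

lemma comparability_matrix_nth:
  "u < n \<Longrightarrow> v < n \<Longrightarrow> comparability_matrix n r ! (u * n + v) = of_bool ((u, v) \<in> r)"
  by (subst comparability_matrix_def, subst nth_concat_rows) auto

lemma length_comparability_matrix: "length (comparability_matrix n r) = n * n"
  unfolding comparability_matrix_def by (subst length_concat_rows[where m = n]) auto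

lemma array_length_le: "array_length n a \<le> frame_space n"
  by (cases a) (auto simp: frame_space_def)

locale input_poset =
  fixes n :: nat and r :: "nat rel"
  assumes poset: "partial_order_on {..<n} r"
begin

section \<open>A linear extension from the sizes of principal ideals\<close>

definition down_count :: "nat \<Rightarrow> nat" where
  "down_count v = card {u. u < n \<and> (u, v) \<in> r}"

definition before :: "nat \<Rightarrow> nat \<Rightarrow> bool" where
  "before u v \<longleftrightarrow> down_count u < down_count v \<or> down_count u = down_count v \<and> u < v"

definition rank :: "nat \<Rightarrow> nat" where
  "rank v = card {u. u < n \<and> before u v}"

lemma r_refl: "u < n \<Longrightarrow> (u, u) \<in> r"
  and r_trans: "trans r"
  and r_antisym: "antisym r"
  using poset by (auto simp: partial_order_on_def preorder_on_def refl_on_def)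

lemma before_trans: "before u v \<Longrightarrow> before v w \<Longrightarrow> before u w"
  by (auto simp: before_def)

lemma before_cases: "u = v \<or> before u v \<or> before v u"
  by (auto simp: before_def)

lemma rank_less:
  assumes "u < n" "before u v" shows "rank u < rank v"
  unfolding rank_def
proof (rule psubset_card_mono)
  show "{w. w < n \<and> before w u} \<subset> {w. w < n \<and> before w v}"
    using assms before_trans by (auto simp: before_def)
qed simp

lemma rank_inj: "inj_on rank {..<n}"
proof (rule inj_onI)
  fix u v assume "u \<in> {..<n}" "v \<in> {..<n}" "rank u = rank v"
  then show "u = v" using before_cases[of u v] rank_less[of u v] rank_less[of v u] by auto
qed

lemma rank_bound: "v < n \<Longrightarrow> rank v < n"
proof -
  assume "v < n"
  have "{u. u < n \<and> before u v} \<subseteq> {..<n} - {v}" by (auto simp: before_def)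
  then have "rank v \<le> card ({..<n} - {v})" unfolding rank_def by (intro card_mono) auto
  then show ?thesis using \<open>v < n\<close> by simp
qed

lemma rank_image: "rank ` {..<n} = {..<n}"
  using rank_inj rank_bound by (intro endo_inj_surj) auto

text \<open>The principal ideal of u is properly contained in that of v, since v belongs only to the
  latter; so ties in size occur only between incomparable elements.\<close>

lemma before_of_less:
  assumes "u < n" "v < n" "(u, v) \<in> r" "u \<noteq> v" shows "before u v"
proof -
  have "{w. w < n \<and> (w, u) \<in> r} \<subset> {w. w < n \<and> (w, v) \<in> r}"
  proof
    show "{w. w < n \<and> (w, u) \<in> r} \<subseteq> {w. w < n \<and> (w, v) \<in> r}" using assms r_trans by (auto dest: transD)
    have "(v, u) \<notin> r" using assms r_antisym by (auto dest: antisymD)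
    then show "{w. w < n \<and> (w, u) \<in> r} \<noteq> {w. w < n \<and> (w, v) \<in> r}" using assms r_refl by blast
  qed
  then have "down_count u < down_count v" unfolding down_count_def by (intro psubset_card_mono) auto
  then show ?thesis by (simp add: before_def)
qed

lemma rank_mono: "u < n \<Longrightarrow> v < n \<Longrightarrow> (u, v) \<in> r \<Longrightarrow> rank u \<le> rank v"
  using before_of_less[of u v] rank_less[of u v] by (cases "u = v") auto

text \<open>\<open>rank\<close> is an injective map of a finite set into itself, hence a
  permutation, and L is its inverse.\<close>

lemma label_props:
  assumes L: "\<forall>v<n. L ! rank v = v"
  shows "(!) L ` {..<n} = {..<n}" "inj_on ((!) L) {..<n}"
    "u < n \<Longrightarrow> v < n \<Longrightarrow> (L ! u, L ! v) \<in> r \<Longrightarrow> u \<le> v" "u < n \<Longrightarrow> L ! u < n"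
proof -
  have inv: "\<exists>w<n. u = rank w \<and> L ! u = w" if "u < n" for u
    using that rank_image L by (metis (no_types, lifting) imageE lessThan_iff)
  show "inj_on ((!) L) {..<n}" using inv by (metis inj_onI lessThan_iff)
  show less: "u < n \<Longrightarrow> L ! u < n" for u using inv by metis
  show "(!) L ` {..<n} = {..<n}"
  proof
    show "{..<n} \<subseteq> (!) L ` {..<n}" using L rank_bound by (force simp: image_iff)
  qed (use less in auto)
  show "u < n \<Longrightarrow> v < n \<Longrightarrow> (L ! u, L ! v) \<in> r \<Longrightarrow> u \<le> v" using inv rank_mono by metis
qed

lemma relabeled:
  assumes L: "\<forall>v<n. L ! rank v = v"
  shows "relabeled_poset n r L"
proof (rule relabeled_poset.intro)
  show "finite_poset (inv_image r ((!) L)) {..<n}"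
  proof (rule finite_poset.intro)
    show "trans (inv_image r ((!) L))" using r_trans by (rule trans_inv_image)
    show "(u, u) \<in> inv_image r ((!) L)" if "u \<in> {..<n}" for u
      using that label_props(4)[OF L] r_refl by simp
    show "u = v" if "u \<in> {..<n}" "v \<in> {..<n}" "(u, v) \<in> inv_image r ((!) L)" "(v, u) \<in> inv_image r ((!) L)" for u v
      using that label_props(2)[OF L] r_antisym by (auto dest!: antisymD inj_onD)
  qed simp
qed (use label_props[OF L] in auto)

section \<open>Time and space of the initialization\<close>

definition space_limit :: nat where
  "space_limit = (\<Sum>a\<in>UNIV. array_length n a) + (card (UNIV :: register set) + 1)"

definition allocated :: "array set \<Rightarrow> nat \<Rightarrow> (register, array) machine \<Rightarrow> bool" where
  "allocated A k s \<longleftrightarrow> (\<forall>a\<in>A. length (mem s a) = array_length n a) \<and> (\<forall>a. length (mem s a) \<le> array_length n a) \<and>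
     mem s Matrix = comparability_matrix n r \<and> regs s rn = n \<and> regs s rw = n + 2 \<and> depth s = 0 \<and> visited s = [] \<and>
     peak s \<le> space_limit \<and> clock s \<le> k * (20 + frame_space n)"

text \<open>k counts instructions, each of which costs at most \<open>20 + frame_space n\<close>.
  The final count 14 is one assignment and 13 allocations.\<close>

lemma alloc_step:
  assumes s: "allocated A k s" and e: "aval e (regs s) = array_length n a" "acost e \<le> 10" "a \<noteq> Matrix"
    and Q: "\<And>t. allocated (insert a A) (Suc k) t \<Longrightarrow> Q t"
  shows "wp B (Alloc a e) Q s"
  unfolding wp_Alloc
proof (rule Q)
  let ?t = "tick (1 + acost e + aval e (regs s)) (set_array a (replicate (aval e (regs s)) 0) s)"
  have len: "length (mem ?t b) \<le> array_length n b" for b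
    using s e by (auto simp: allocated_def)
  have "space ?t = (\<Sum>b\<in>UNIV. length (mem ?t b)) + (card (UNIV :: register set) + 1)"
    using s by (simp add: space_def allocated_def)
  also have "\<dots> \<le> space_limit" unfolding space_limit_def using len by (intro add_mono sum_mono) auto
  finally have "space ?t \<le> space_limit" .
  then show "allocated (insert a A) (Suc k) (record_space ?t)"
    using s e array_length_le[of n a] len by (auto simp: allocated_def)
qed

lemma init_arrays:
  "wp B init_arrays (allocated UNIV 14) (start n r)"
proof -
  have "(\<Sum>a\<in>UNIV. length (mem (start n r) a)) \<le> (\<Sum>a\<in>UNIV. array_length n a)"
    by (intro sum_mono) (simp add: start_def length_comparability_matrix)
  then have start: "allocated {Matrix} 1 (tick (1 + acost (V rn \<oplus> N 2 :: register aexp))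
      (set_reg rw (aval (V rn \<oplus> N 2) (regs (start n r))) (start n r)))"
    by (auto simp: allocated_def start_def length_comparability_matrix space_limit_def space_def)
  have all: "allocated UNIV 14 t"
    if "allocated {Ideal, Temp, Pred, LevelNext, Level, BucketNext, Bucket, Upper, Chain, Elems, Leq, Label, Count, Matrix} k t"
      "k = 14" for k t
  proof -
    have "UNIV = {Ideal, Temp, Pred, LevelNext, Level, BucketNext, Bucket, Upper, Chain, Elems, Leq, Label, Count, Matrix}"
      by (auto intro: array.exhaust)
    then show ?thesis using that by simp
  qed
  show ?thesis
    unfolding init_arrays_def wp_Seq wp_Assign
    apply (insert start)
    apply (rule alloc_step, assumption, force simp: allocated_def frame_space_def, simp, simp, thin_tac "allocated _ _ _")+
    apply (erule all, simp)
    done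
qed

lemma card_less_Suc: "card {w. w < Suc u \<and> p w} = card {w. w < u \<and> p w} + of_bool (p u)"
proof -
  have "{w. w < Suc u \<and> p w} = {w. w < u \<and> p w} \<union> (if p u then {u} else {})" by (auto simp: less_Suc_eq)
  then show ?thesis by (simp add: card_insert_if)
qed

definition count_loop :: "(register, array) com" where
  "count_loop = (FOR rv < V rn DO (
       rk ::= N 0 ;;
       FOR ru < V rn DO (rx ::= Matrix\<lbrakk>V ru \<otimes> V rn \<oplus> V rv\<rbrakk> ;; rk ::= V rk \<oplus> V rx) ;;
       Count\<lbrakk>V rv\<rbrakk> ::= V rk))"

definition label_loop :: "(register, array) com" where
  "label_loop = (FOR rv < V rn DO (
       rk ::= N 0 ;;
       rj ::= Count\<lbrakk>V rv\<rbrakk> ;;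
       FOR ru < V rn DO (
         rx ::= Count\<lbrakk>V ru\<rbrakk> ;;
         IF V rx \<lhd> V rj OR (V rx \<doteq> V rj AND V ru \<lhd> V rv) THEN rk ::= V rk \<oplus> N 1 ELSE Skip) ;;
       Label\<lbrakk>V rk\<rbrakk> ::= V rv))"

definition matrix_loop :: "(register, array) com" where
  "matrix_loop = (FOR ru < V rn DO (
       rj ::= Label\<lbrakk>V ru\<rbrakk> ;;
       FOR rv < V rn DO (
         rk ::= Label\<lbrakk>V rv\<rbrakk> ;;
         rx ::= Matrix\<lbrakk>V rj \<otimes> V rn \<oplus> V rk\<rbrakk> ;;
         Leq\<lbrakk>V ru \<otimes> V rn \<oplus> V rv\<rbrakk> ::= V rx)))"

lemma init_relabel_eq: "init_relabel = count_loop ;; label_loop ;; matrix_loop ;; FOR ru < V rn DO Elems\<lbrakk>V ru\<rbrakk> ::= V ru"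
  by (simp add: init_relabel_def count_loop_def label_loop_def matrix_loop_def)

definition input_state :: "(register, array) machine \<Rightarrow> bool" where
  "input_state s \<longleftrightarrow> (\<forall>a. length (mem s a) = array_length n a) \<and> mem s Matrix = comparability_matrix n r \<and> regs s rn = n"

lemma input_stateD:
  assumes "input_state s"
  shows "length (mem s a) = array_length n a" "mem s Matrix = comparability_matrix n r" "regs s rn = n"
  using assms by (simp_all add: input_state_def)

lemma input_state_frame:
  "input_state s \<Longrightarrow> frame X A s t \<Longrightarrow> rn \<notin> X \<Longrightarrow> Matrix \<notin> A \<Longrightarrow> input_state t"
  by (auto simp: input_state_def frame_def)

lemma count_loop:
  assumes s: "input_state s"
  shows "wp B count_loop (\<lambda>z. frame {rv, rk, ru, rx} {Count} s z \<and> (\<forall>v<n. mem z Count ! v = down_count v) \<and>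
    clock z \<le> clock s + 20 + n * (40 * n + 40)) s" (is "wp B _ ?Q s")
proof -
  let ?F = "frame {rv, rk, ru, rx} {Count}"
  define I where "I v z \<longleftrightarrow> ?F s z \<and> v \<le> n \<and> regs z rv = v \<and> (\<forall>w<v. mem z Count ! w = down_count w) \<and>
    clock z \<le> clock s + 10 + v * (40 * n + 40)" for v z
  show ?thesis
    unfolding count_loop_def
  proof (rule wp_for[where I = I and m = n])
    show "I 0 (tick 2 (set_reg rv 0 s))" by (simp add: I_def)
    show "v \<le> n \<and> regs z rv = v \<and> aval (V rn) (regs z) = n" if "I v z" for v z
      using that input_stateD[OF s] by (auto simp: I_def frame_def)
    show "?Q (tick (3 + acost (V rn)) z)" if "I n z" for z using that by (auto simp: I_def)
  next
    fix v z assume I: "I v z" and v: "v < n"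
    define J where "J u y \<longleftrightarrow> frame {rk, ru, rx} {} z y \<and> u \<le> n \<and> regs y ru = u \<and>
      regs y rk = card {w. w < u \<and> (w, v) \<in> r} \<and> clock y \<le> clock z + 20 + 30 * u" for u y
    have z: "input_state z" using input_state_frame[OF s, of _ _ z] I by (auto simp: I_def)
    note zD = input_stateD[OF z]
    have zv: "regs z rv = v" using I by (simp add: I_def)
    have inner: "wp B (FOR ru < V rn DO (rx ::= Matrix\<lbrakk>V ru \<otimes> V rn \<oplus> V rv\<rbrakk> ;; rk ::= V rk \<oplus> V rx))
        (wp B (Count\<lbrakk>V rv\<rbrakk> ::= V rk) (\<lambda>u. regs u rv = v \<and> I (Suc v) (tick 4 (set_reg rv (Suc v) u)))) y0"
      if y0: "J 0 (tick 2 (set_reg ru 0 y0))" for y0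
    proof (rule wp_for[where I = J and m = n])
      show "J 0 (tick 2 (set_reg ru 0 y0))" by fact
      show "u \<le> n \<and> regs y ru = u \<and> aval (V rn) (regs y) = n" if "J u y" for u y
        using that zD by (auto simp: J_def frame_def)
    next
      fix u y assume J: "J u y" and u: "u < n"
      have y: "input_state y" using input_state_frame[OF z, of _ _ y] J by (auto simp: J_def)
      have yv: "regs y rv = v" using J zv by (simp add: J_def frame_def)
      show "wp B (rx ::= Matrix\<lbrakk>V ru \<otimes> V rn \<oplus> V rv\<rbrakk> ;; rk ::= V rk \<oplus> V rx)
          (\<lambda>x. regs x ru = u \<and> J (Suc u) (tick 4 (set_reg ru (Suc u) x))) (tick (3 + acost (V rn)) y)"
        using J u v by (simp add: J_def input_stateD[OF y] yv matrix_index_less comparability_matrix_nth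
            length_comparability_matrix card_less_Suc)
    next
      fix y assume J: "J n y"
      have y: "input_state y" using input_state_frame[OF z, of _ _ y] J by (auto simp: J_def)
      have yv: "regs y rv = v" "mem y = mem z" using J zv by (auto simp: J_def frame_def fun_eq_iff)
      have "?F s y" using frame_trans[of _ _ s z _ _ y] I J by (auto simp: I_def J_def)
      then show "wp B (Count\<lbrakk>V rv\<rbrakk> ::= V rk) (\<lambda>u. regs u rv = v \<and> I (Suc v) (tick 4 (set_reg rv (Suc v) u)))
          (tick (3 + acost (V rn)) y)"
        using I J v by (auto simp: I_def J_def zD yv down_count_def nth_list_update less_Suc_eq)
    qed
    show "wp B (rk ::= N 0 ;; FOR ru < V rn DO (rx ::= Matrix\<lbrakk>V ru \<otimes> V rn \<oplus> V rv\<rbrakk> ;; rk ::= V rk \<oplus> V rx) ;;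
        Count\<lbrakk>V rv\<rbrakk> ::= V rk) (\<lambda>u. regs u rv = v \<and> I (Suc v) (tick 4 (set_reg rv (Suc v) u))) (tick (3 + acost (V rn)) z)"
      unfolding wp_Seq wp_Assign by (rule inner) (simp add: J_def)
  qed
qed

lemma label_loop:
  assumes s: "input_state s" and count: "\<forall>v<n. mem s Count ! v = down_count v"
  shows "wp B label_loop (\<lambda>z. frame {rv, rk, ru, rx, rj} {Label} s z \<and> (\<forall>v<n. mem z Label ! rank v = v) \<and>
    clock z \<le> clock s + 20 + n * (60 * n + 40)) s" (is "wp B _ ?Q s")
proof -
  let ?F = "frame {rv, rk, ru, rx, rj} {Label}"
  let ?step = "rx ::= Count\<lbrakk>V ru\<rbrakk> ;;
     IF V rx \<lhd> V rj OR (V rx \<doteq> V rj AND V ru \<lhd> V rv) THEN rk ::= V rk \<oplus> N 1 ELSE Skip"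
  define I where "I v z \<longleftrightarrow> ?F s z \<and> v \<le> n \<and> regs z rv = v \<and> (\<forall>w<v. mem z Label ! rank w = w) \<and>
    clock z \<le> clock s + 10 + v * (60 * n + 40)" for v z
  show ?thesis
    unfolding label_loop_def
  proof (rule wp_for[where I = I and m = n])
    show "I 0 (tick 2 (set_reg rv 0 s))" by (simp add: I_def)
    show "v \<le> n \<and> regs z rv = v \<and> aval (V rn) (regs z) = n" if "I v z" for v z
      using that input_stateD[OF s] by (auto simp: I_def frame_def)
    show "?Q (tick (3 + acost (V rn)) z)" if "I n z" for z using that by (auto simp: I_def)
  next
    fix v z assume I: "I v z" and v: "v < n"
    define J where "J u y \<longleftrightarrow> frame {rk, ru, rx, rj} {} z y \<and> u \<le> n \<and> regs y ru = u \<and> regs y rj = down_count v \<and>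
      regs y rk = card {w. w < u \<and> before w v} \<and> clock y \<le> clock z + 20 + 50 * u" for u y
    have z: "input_state z" using input_state_frame[OF s, of _ _ z] I by (auto simp: I_def)
    note zD = input_stateD[OF z]
    have zv: "regs z rv = v" "mem z Count = mem s Count" using I by (auto simp: I_def frame_def)
    have inner: "wp B (FOR ru < V rn DO (?step))
        (wp B (Label\<lbrakk>V rk\<rbrakk> ::= V rv) (\<lambda>u. regs u rv = v \<and> I (Suc v) (tick 4 (set_reg rv (Suc v) u)))) y0"
      if y0: "J 0 (tick 2 (set_reg ru 0 y0))" for y0
    proof (rule wp_for[where I = J and m = n])
      show "J 0 (tick 2 (set_reg ru 0 y0))" by fact
      show "u \<le> n \<and> regs y ru = u \<and> aval (V rn) (regs y) = n" if "J u y" for u y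
        using that zD by (auto simp: J_def frame_def)
    next
      fix u y assume J: "J u y" and u: "u < n"
      have y: "input_state y" using input_state_frame[OF z, of _ _ y] J by (auto simp: J_def)
      have yv: "regs y rv = v" "mem y Count = mem s Count" using J zv by (simp_all add: J_def frame_def)
      have "length (mem s Count) = n" using input_stateD(1)[OF s, of Count] by simp
      then show "wp B (?step) (\<lambda>x. regs x ru = u \<and> J (Suc u) (tick 4 (set_reg ru (Suc u) x))) (tick (3 + acost (V rn)) y)"
        using J u v count by (auto simp: J_def yv card_less_Suc before_def)
    next
      fix y assume J: "J n y"
      have yv: "regs y rv = v" "mem y = mem z" using J zv by (auto simp: J_def frame_def fun_eq_iff)
      have "?F s y" using frame_trans[of _ _ s z _ _ y] I J by (auto simp: I_def J_def)
      moreover have "(mem z Label)[rank v := v] ! rank w = w" if w: "w < Suc v" for w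
      proof (cases "w = v")
        case True then show ?thesis using rank_bound[OF v] zD(1)[of Label] by simp
      next
        case False
        then have "rank v \<noteq> rank w" using w v rank_inj by (auto dest: inj_onD)
        then show ?thesis using I w False by (simp add: I_def)
      qed
      ultimately show "wp B (Label\<lbrakk>V rk\<rbrakk> ::= V rv) (\<lambda>u. regs u rv = v \<and> I (Suc v) (tick 4 (set_reg rv (Suc v) u)))
          (tick (3 + acost (V rn)) y)"
        using I J v rank_bound[OF v] by (simp add: I_def J_def zD yv rank_def[symmetric])
    qed
    have "length (mem s Count) = n" using input_stateD(1)[OF s, of Count] by simp
    then show "wp B (rk ::= N 0 ;; rj ::= Count\<lbrakk>V rv\<rbrakk> ;; (FOR ru < V rn DO (?step)) ;; Label\<lbrakk>V rk\<rbrakk> ::= V rv)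
        (\<lambda>u. regs u rv = v \<and> I (Suc v) (tick 4 (set_reg rv (Suc v) u))) (tick (3 + acost (V rn)) z)"
      unfolding wp_Seq[of B "rk ::= N 0"] wp_Seq[of B "rj ::= Count\<lbrakk>V rv\<rbrakk>"]
        wp_Seq[of B "FOR ru < V rn DO (?step)"] wp_Assign wp_Load
      using v count zv by (intro conjI inner) (simp_all add: J_def)
  qed
qed

lemma matrix_index_eq_iff: "v < m \<Longrightarrow> v' < m \<Longrightarrow> u * m + v = u' * m + v' \<longleftrightarrow> u = u' \<and> v = (v' :: nat)"
proof
  assume "v < m" "v' < m" and *: "u * m + v = u' * m + v'"
  then show "u = u' \<and> v = v'"
    by (metis add.commute add_left_cancel div_mult_self3 div_less add_0_right less_nat_zero_code mult.commute neq0_conv)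
qed simp

lemma matrix_loop:
  assumes s: "input_state s" and label: "\<forall>v<n. mem s Label ! rank v = v"
  shows "wp B matrix_loop (\<lambda>z. frame {rv, rk, ru, rx, rj} {Leq} s z \<and>
    (\<forall>u<n. \<forall>v<n. mem z Leq ! (u * n + v) = of_bool ((mem s Label ! u, mem s Label ! v) \<in> r)) \<and>
    clock z \<le> clock s + 20 + n * (50 * n + 40)) s" (is "wp B _ ?Q s")
proof -
  let ?F = "frame {rv, rk, ru, rx, rj} {Leq}"
  let ?L = "\<lambda>u. mem s Label ! u"
  let ?step = "rk ::= Label\<lbrakk>V rv\<rbrakk> ;; rx ::= Matrix\<lbrakk>V rj \<otimes> V rn \<oplus> V rk\<rbrakk> ;; Leq\<lbrakk>V ru \<otimes> V rn \<oplus> V rv\<rbrakk> ::= V rx"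
  have len: "length (mem s Label) = n" using input_stateD(1)[OF s, of Label] by simp
  define I where "I u z \<longleftrightarrow> ?F s z \<and> u \<le> n \<and> regs z ru = u \<and>
    (\<forall>w<u. \<forall>v<n. mem z Leq ! (w * n + v) = of_bool ((?L w, ?L v) \<in> r)) \<and>
    clock z \<le> clock s + 10 + u * (50 * n + 40)" for u z
  show ?thesis
    unfolding matrix_loop_def
  proof (rule wp_for[where I = I and m = n])
    show "I 0 (tick 2 (set_reg ru 0 s))" by (simp add: I_def)
    show "v \<le> n \<and> regs z ru = v \<and> aval (V rn) (regs z) = n" if "I v z" for v z
      using that input_stateD[OF s] by (auto simp: I_def frame_def)
    show "?Q (tick (3 + acost (V rn)) z)" if "I n z" for z using that by (auto simp: I_def)
  next
    fix u z assume I: "I u z" and u: "u < n"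
    define J where "J v y \<longleftrightarrow> ?F s y \<and> v \<le> n \<and> regs y rv = v \<and> regs y ru = u \<and> regs y rj = ?L u \<and>
      (\<forall>w<u. \<forall>v<n. mem y Leq ! (w * n + v) = of_bool ((?L w, ?L v) \<in> r)) \<and>
      (\<forall>v'<v. mem y Leq ! (u * n + v') = of_bool ((?L u, ?L v') \<in> r)) \<and> clock y \<le> clock z + 20 + 40 * v" for v y
    have z: "input_state z" using input_state_frame[OF s, of _ _ z] I by (auto simp: I_def)
    have zL: "mem z Label = mem s Label" "regs z ru = u" using I by (auto simp: I_def frame_def)
    have inner: "wp B (FOR rv < V rn DO (?step)) (\<lambda>x. regs x ru = u \<and> I (Suc u) (tick 4 (set_reg ru (Suc u) x))) y0"
      if y0: "J 0 (tick 2 (set_reg rv 0 y0))" for y0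
    proof (rule wp_for[where I = J and m = n])
      show "J 0 (tick 2 (set_reg rv 0 y0))" by fact
      show "v \<le> n \<and> regs y rv = v \<and> aval (V rn) (regs y) = n" if "J v y" for v y
        using that input_stateD[OF s] by (auto simp: J_def frame_def)
    next
      fix v y assume J: "J v y" and v: "v < n"
      have y: "input_state y" using input_state_frame[OF s, of _ _ y] J by (auto simp: J_def)
      have yL: "mem y Label = mem s Label" using J by (simp add: J_def frame_def)
      have lt: "?L u < n" "?L v < n" using label_props(4)[OF label] u v by auto
      \<comment> \<open>Row-major addresses are injective, so a store changes exactly one matrix
        entry.\<close>
      have upd: "(mem y Leq)[u * n + v := x] ! (w * n + v') = (if w = u \<and> v' = v then x else mem y Leq ! (w * n + v'))"
        if "w \<le> u" "v' < n" for w v' x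
        using that u v matrix_index_less[OF u v] matrix_index_eq_iff[of v' n v w u] input_stateD(1)[OF y, of Leq]
        by (auto simp: nth_list_update)
      have "J (Suc v) (tick k (set_reg rv (Suc v) (tick a (set_array Leq ((mem y Leq)[u * n + v := of_bool ((?L u, ?L v) \<in> r)])
          (tick b (set_reg rx (of_bool ((?L u, ?L v) \<in> r)) (tick c (set_reg rk (?L v) (tick d y)))))))))"
        if "k + a + b + c + d \<le> 40" for k a b c d
        using J v that unfolding J_def by (auto simp: upd less_Suc_eq)
      then show "wp B (?step) (\<lambda>x. regs x rv = v \<and> J (Suc v) (tick 4 (set_reg rv (Suc v) x))) (tick (3 + acost (V rn)) y)"
        using J u v lt by (simp add: J_def[of v y] input_stateD[OF y] yL len matrix_index_less comparability_matrix_nth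
            length_comparability_matrix)
    next
      fix y assume J: "J n y"
      then show "regs (tick (3 + acost (V rn)) y) ru = u \<and> I (Suc u) (tick 4 (set_reg ru (Suc u) (tick (3 + acost (V rn)) y)))"
        using I u by (auto simp: I_def J_def less_Suc_eq)
    qed
    show "wp B (rj ::= Label\<lbrakk>V ru\<rbrakk> ;; FOR rv < V rn DO (?step))
        (\<lambda>x. regs x ru = u \<and> I (Suc u) (tick 4 (set_reg ru (Suc u) x))) (tick (3 + acost (V rn)) z)"
      unfolding wp_Seq[of B "rj ::= Label\<lbrakk>V ru\<rbrakk>"] wp_Load
      using I u len by (intro conjI inner) (auto simp: J_def I_def zL)
  qed
qed

definition initialized :: "nat list \<Rightarrow> (register, array) machine \<Rightarrow> bool" where
  "initialized L s \<longleftrightarrow> relabeled_poset n r L \<and> (!) L ` {..<n} = {..<n} \<and> relabeled_poset.ready n r L s \<and>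
     (\<forall>u<n. mem s Elems ! u = u) \<and> depth s = 0 \<and> visited s = [] \<and> peak s \<le> space_limit \<and> clock s \<le> 2000 * (n\<^sup>2 + 1)"

lemma initialize:
  "wp B initialize (\<lambda>s. \<exists>L. initialized L s) (start n r)" (is "wp B _ ?Q _")
proof -
  have elems: "wp B (FOR ru < V rn DO Elems\<lbrakk>V ru\<rbrakk> ::= V ru) (\<lambda>z. frame {ru} {Elems} s z \<and>
      (\<forall>u<n. mem z Elems ! u = u) \<and> clock z \<le> clock s + 20 + n * 20) s" if s: "input_state s" for s
  proof (rule wp_for[where m = n and I = "\<lambda>u z. frame {ru} {Elems} s z \<and> u \<le> n \<and> regs z ru = u \<and>
      (\<forall>w<u. mem z Elems ! w = w) \<and> clock z \<le> clock s + 10 + u * 20"])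
    fix u z assume z: "frame {ru} {Elems} s z \<and> u \<le> n \<and> regs z ru = u \<and>
      (\<forall>w<u. mem z Elems ! w = w) \<and> clock z \<le> clock s + 10 + u * 20" and u: "u < n"
    have "length (mem z Elems) = frame_space n" using z input_stateD(1)[OF s, of Elems] by (simp add: frame_def)
    moreover have "u < frame_space n" using u by (simp add: frame_space_def)
    ultimately show "wp B (Elems\<lbrakk>V ru\<rbrakk> ::= V ru) (\<lambda>x. regs x ru = u \<and>
        (frame {ru} {Elems} s (tick 4 (set_reg ru (Suc u) x)) \<and> Suc u \<le> n \<and> regs (tick 4 (set_reg ru (Suc u) x)) ru = Suc u \<and>
         (\<forall>w<Suc u. mem (tick 4 (set_reg ru (Suc u) x)) Elems ! w = w) \<and>
         clock (tick 4 (set_reg ru (Suc u) x)) \<le> clock s + 10 + Suc u * 20)) (tick (3 + acost (V rn)) z)"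
      using z u by (auto simp: nth_list_update less_Suc_eq)
  qed (use input_stateD[OF s] in \<open>auto simp: frame_def\<close>)
  show ?thesis
    unfolding initialize_def init_relabel_eq wp_Seq
  proof (rule wp_mono[OF init_arrays], rule wp_mono[OF count_loop], goal_cases)
    case (1 s0) then show ?case by (simp add: allocated_def input_state_def)
  next
    case c1: (2 s0 s1)
    then have i0: "input_state s0" by (simp add: allocated_def input_state_def)
    have i1: "input_state s1" using input_state_frame[OF i0, of _ _ s1] c1 by auto
    show ?case
    proof (rule wp_mono[OF label_loop[OF i1]], goal_cases)
      case 1 show ?case using c1 by blast
    next
      case c2: (2 s2)
      have i2: "input_state s2" using input_state_frame[OF i1, of _ _ s2] c2 by auto
      show ?case
      proof (rule wp_mono[OF matrix_loop[OF i2]], goal_cases)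
        case 1 show ?case using c2 by blast
      next
        case c3: (2 s3)
        have i3: "input_state s3" using input_state_frame[OF i2, of _ _ s3] c3 by auto
        show ?case
        proof (rule wp_mono[OF elems[OF i3]])
          fix s4 assume c4: "frame {ru} {Elems} s3 s4 \<and> (\<forall>u<n. mem s4 Elems ! u = u) \<and> clock s4 \<le> clock s3 + 20 + n * 20"
          have i4: "input_state s4" using input_state_frame[OF i3, of _ _ s4] c4 by auto
          define L where "L = mem s2 Label"
          have L: "\<forall>v<n. L ! rank v = v" using c2 by (simp add: L_def)
          interpret relabeled_poset n r L "inv_image r ((!) L)" by (rule relabeled[OF L]) simp
          have mem: "mem s4 Label = L" "mem s4 Leq = mem s3 Leq" and reg: "regs s4 rw = regs s0 rw"
            using c1 c2 c3 c4 by (simp_all add: frame_def L_def)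
          have "regs s4 rw = n + 2" using c1(1) reg by (simp add: allocated_def)
          moreover have "\<forall>u<n. \<forall>v<n. mem s4 Leq ! (u * n + v) = of_bool ((L ! u, L ! v) \<in> r)"
            using c3 by (simp add: mem L_def)
          ultimately have "ready s4"
            unfolding ready_def using input_stateD[OF i4] by (simp add: mem)
          moreover have "depth s4 = 0" "visited s4 = []" "peak s4 \<le> space_limit"
            using c1 c2 c3 c4 by (auto simp: frame_def allocated_def)
          moreover have "clock s4 \<le> 2000 * (n\<^sup>2 + 1)"
          proof -
            have "clock s4 \<le> 14 * (20 + frame_space n) + 80 + n * (40 * n + 40) + n * (60 * n + 40) + n * (50 * n + 40) + n * 20"
              using c1 c2 c3 c4 by (simp add: allocated_def)
            also have "\<dots> = 164 * (n * n) + 182 * n + 388"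
              by (simp add: frame_space_def algebra_simps)
            also have "\<dots> \<le> 164 * (n * n) + 182 * (n * n) + 388" by simp
            also have "\<dots> \<le> 2000 * (n\<^sup>2 + 1)" by (simp add: power2_eq_square)
            finally show ?thesis .
          qed
          ultimately have "initialized L s4"
            using relabeled[OF L] label_props(1)[OF L] c4 by (simp add: initialized_def)
          then show "?Q s4" by blast
        qed
      qed
    qed
  qed
qed

end

section \<open>The main theorem\<close>

context input_poset
begin

lemma finite_poset: "finite_poset r {..<n}"
  using r_refl r_trans r_antisym by (auto intro!: finite_poset.intro dest: antisymD)

lemma array_space: "(\<Sum>a\<in>UNIV. array_length n a) \<le> 100 * (n\<^sup>2 + 1)"
proof -
  have eq: "UNIV = {Matrix, Count, Label, Leq, Elems, Chain, Upper, Bucket, BucketNext, Level, LevelNext, Pred, Temp, Ideal}"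
    by (auto intro: array.exhaust)
  have "(\<Sum>a\<in>UNIV. array_length n a) = 7 * (n * n) + 22 * n + 11"
    unfolding eq by (simp add: frame_space_def)
  also have "\<dots> \<le> 7 * (n * n) + 22 * (n * n) + 11" by simp
  also have "\<dots> \<le> 100 * (n\<^sup>2 + 1)" by (simp add: power2_eq_square)
  finally show ?thesis .
qed

lemma main_call:
  assumes init: "initialized L s"
  shows "wp enumerate_body main_call (\<lambda>t. \<exists>ts Js. visited t = zip ts Js \<and> length ts = length Js \<and>
    enumerates r {..<n} {} Js \<and> clock t \<le> clock s + 34 + 500000 * length Js \<and> peak t \<le> 1000 * (n\<^sup>2 + 1) \<and>
    (\<forall>k<length Js. ts ! k \<le> clock s + 34 + 500000 * (k + 1) +
      n * (1000 * (1 + n + card (incomparable_pairs {..<n} r))))) s" (is "wp _ _ ?Q s")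
proof -
  have rel: "relabeled_poset n r L" using init by (simp add: initialized_def)
  interpret relabeled_poset n r L "inv_image r ((!) L)" by (rule rel) simp
  have ready: "ready s" and s: "\<forall>u<n. mem s Elems ! u = u" "depth s = 0" "visited s = []" "peak s \<le> space_limit"
    and image: "(!) L ` {..<n} = {..<n}"
    using init by (simp_all add: initialized_def)
  have q: "pair_count = card (incomparable_pairs {..<n} r)"
    unfolding pair_count_def by (simp add: card_incomparable_pairs_relabel[OF inj_label] image)
  let ?args = "[(rfp, N 0), (rm, V rn), (rlen, N 0)]"
  define w where "w = enter_call ?args
      (tick (1 + 2 * card (UNIV :: register set) + sum_list (map (\<lambda>(x, e). acost e) ?args)) s)"
  have w: "regs w = (regs s)(rfp := 0, rm := n, rlen := 0)" "mem w = mem s" "depth w = 1" "visited w = []"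
      "clock w = clock s + 34"
    using readyD[OF ready] s by (auto simp: w_def enter_call_def card_register fun_eq_iff)
  have "space w = (\<Sum>a\<in>UNIV. array_length n a) + 2 * (card (UNIV :: register set) + 1)"
    using readyD[OF ready] by (simp add: space_def w)
  moreover have "peak w = max (peak s) (space w)" by (simp add: w_def enter_call_def space_def)
  ultimately have "peak w \<le> max_space"
    using s(4) by (simp add: max_space_def space_limit_def)
  moreover have "ready w" using ready by (simp add: ready_def w)
  ultimately have pre: "call_pre 0 [0..<n] 0 w"
    using s by (simp add: call_pre_def node_def w)
  have "node_data n r L 0 [0..<n]"
    using rel by (simp add: node_data_def node_data_axioms_def frame_space_def)
  from enumerate_correct[OF this pre]
  show ?thesis
    unfolding main_call_def enumerate_call_def wp_Call w_def[symmetric]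
  proof (rule wp_mono)
    fix t assume "\<exists>ts Js. call_result 0 [0..<n] 0 w t ts Js"
    then obtain ts Js where t: "call_result 0 [0..<n] 0 w t ts Js" by blast
    have "max_space \<le> 100 * (n\<^sup>2 + 1) + (n + 2) * 16"
      unfolding max_space_def card_register using array_space by simp
    also have "\<dots> \<le> 100 * (n\<^sup>2 + 1) + (n * n + 2) * 16" by simp
    also have "\<dots> \<le> 1000 * (n\<^sup>2 + 1)" by (simp add: power2_eq_square)
    finally have "max_space \<le> 1000 * (n\<^sup>2 + 1)" .
    then show "?Q (leave_call s t)"
      using t w image unfolding call_result_def local_bound_def q
      by (intro exI[of _ ts] exI[of _ Js]) (auto simp: lessThan_atLeast0)
  qed
qed

end

text \<open>Delay is measured after the initialization, whose quadratic time need not be bounded by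
  the number of ideals: an n-element chain has only n + 1. The output times include it. The empty
  ideal guarantees a nonzero divisor.\<close>

theorem theorem3p11:
  shows "\<exists>c::nat. \<forall>(n::nat) (r::nat rel). partial_order_on {..<n} r \<longrightarrow>
    (\<exists>s t. exec enumerate_body initialize (start n r) s \<and>
      exec enumerate_body main_call s t \<and>
      (let outputs = map snd (visited t);
           times = map fst (visited t);
           q = card (incomparable_pairs {..<n} r)
       in enumerates r {..<n} {} outputs \<and>
          distinct outputs \<and> set outputs = ideals {..<n} r \<and>
          clock s \<le> c * (n ^ 2 + 1) \<and>
          (real (clock t) - real (clock s)) / real (length outputs) \<le> real c \<and>
          peak t \<le> c * (n ^ 2 + 1) \<and>
          (\<forall>k\<in>{1..length outputs}. times ! (k - 1) \<le> c * (k + n * (n + q)))))"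
  (is "\<exists>c. \<forall>n r. _ \<longrightarrow> (\<exists>s t. _ \<and> _ \<and> ?P c n r s t)")
proof (intro exI[of _ 600000] allI impI)
  fix n :: nat and r :: "nat rel"
  assume "partial_order_on {..<n} r"
  then interpret input_poset n r by unfold_locales
  define q where "q = card (incomparable_pairs {..<n} r)"
  obtain s L where s: "exec enumerate_body initialize (start n r) s" "initialized L s"
    using initialize[of enumerate_body] unfolding wp_def by blast
  obtain t ts Js where t: "exec enumerate_body main_call s t"
    and vis: "visited t = zip ts Js" "length ts = length Js" and enum: "enumerates r {..<n} {} Js"
    and clk: "clock t \<le> clock s + 34 + 500000 * length Js" and peak: "peak t \<le> 1000 * (n\<^sup>2 + 1)"
    and times: "\<forall>k<length Js. ts ! k \<le> clock s + 34 + 500000 * (k + 1) + n * (1000 * (1 + n + q))"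
    using main_call[OF s(2)] unfolding wp_def q_def by blast
  have init: "clock s \<le> 2000 * (n\<^sup>2 + 1)" using s(2) by (simp add: initialized_def)
  have ideals: "distinct Js" "set Js = ideals {..<n} r"
    using enumerates_ideals[OF enum finite_poset] by auto
  have "{} \<in> ideals {..<n} r" by (simp add: ideals_def)
  then have pos: "1 \<le> length Js" using ideals(2) by (cases Js) auto
  have "real (clock t) - real (clock s) \<le> 600000 * real (length Js)"
    using clk pos by linarith
  then have amortized: "(real (clock t) - real (clock s)) / real (length Js) \<le> 600000"
    using pos by (simp add: divide_le_eq)
  have "ts ! (k - 1) \<le> 600000 * (k + n * (n + q))" if k: "k \<in> {1..length Js}" for k
  proof -
    have "ts ! (k - 1) \<le> clock s + 34 + 500000 * k + n * (1000 * (1 + n + q))"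
      using times k by (auto dest!: spec[of _ "k - 1"])
    also have "\<dots> \<le> 2000 * (n * n + 1) + 34 + 500000 * k + (1000 * n + 1000 * (n * n) + 1000 * (n * q))"
      using init by (simp add: power2_eq_square algebra_simps)
    also have "\<dots> \<le> 2000 * (n * n + 1) + 34 + 500000 * k + (1000 * (n * n) + 1000 * (n * n) + 1000 * (n * q))"
      by simp
    \<comment> \<open>As k \<ge> 1, the term 600000 k absorbs the additive constants, also for n =
      0.\<close>
    also have "\<dots> \<le> 600000 * k + 600000 * (n * n) + 600000 * (n * q)"
      using k by simp
    finally show ?thesis by (simp add: algebra_simps)
  qed
  moreover have "clock s \<le> 600000 * (n ^ 2 + 1)" "peak t \<le> 600000 * (n ^ 2 + 1)"
    using init peak by linarith+
  ultimately have "?P 600000 n r s t"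
    using enum ideals amortized vis by (simp add: Let_def q_def)
  with s(1) t show "\<exists>s t. exec enumerate_body initialize (start n r) s \<and>
      exec enumerate_body main_call s t \<and> ?P 600000 n r s t"
    by blast
qed

end
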